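(* Let $M$ be the Pascal configuration. This is the simple rank-three matroid on $[9]$ whose lines are exactly \[ \{1,6,8\},\ \{1,5,7\},\ \{2,4,7\},\ \{2,6,9\},\ \{3,4,8\},\ \{3,5,9\},\ \{7,8,9\}, \] and in which all other $3$-subsets are bases. Then the circuit variety of $M$ has the irredundant irreducible decomposition \[ V_{\mathcal{C}(M)}=V_M\cup V_{U_{2,9}}\cup V_{M(7)}\cup V_{M(8)}\cup V_{M(9)}. \]
   Context: For a matroid $N$ on $[d]$ of rank at most three: - A realization is a family $(\gamma_1,\dots,\gamma_d)\subset\mathbb{C}^3$ such that $S\subseteq[d]$ is dependent in $N$ if and only if $\{\gamma_i:i\in S\}$ is linearly dependent. - $V_N\subseteq\mathbb{C}^{3d}$ is the Zariski closure of the set of realizations. - The circuit variety $V_{\mathcal{C}(N)}$ is the set of $\gamma\in\mathbb{C}^{3d}$ such that $\{\gamma_i:i\in S\}$ is linearly dependent for every dependent set $S$ of $N$. Particular matroids: - $U_{2,9}$ is the uniform matroid on $[9]$ in which subsets of size at most $2$ are independent and larger ones dependent. - For $i\in[9]$, $M(i)$ is the matroid on $[9]$ whose independent sets are the independent sets of $M$ not containing $i$; that is, $i$ is made a loop. A line of a simple rank-three matroid is a maximal subset with at least three elements all of whose $3$-subsets are dependent. *)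

theory Defs
  imports "HOL-Analysis.Analysis"
begin

section \<open>Matroids\<close>

text \<open>
  A matroid on a finite type \<open>'d\<close> is represented by its independence predicate.  The ground set
  \<open>[9]\<close> is the numeral type \<open>9\<close> of residues modulo \<open>9\<close>: the labels \<open>1, \<dots>, 9\<close> are its nine
  distinct elements, with \<open>9 = 0\<close>.
\<close>

definition matroid :: "('d::finite set \<Rightarrow> bool) \<Rightarrow> bool" where
  "matroid N \<longleftrightarrow> N {} \<and> (\<forall>S T. N T \<longrightarrow> S \<subseteq> T \<longrightarrow> N S) \<and>
     (\<forall>S T. N S \<longrightarrow> N T \<longrightarrow> card S < card T \<longrightarrow> (\<exists>t\<in>T - S. N (insert t S)))"

definition matroid_basis :: "('d::finite set \<Rightarrow> bool) \<Rightarrow> 'd set \<Rightarrow> bool" where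
  "matroid_basis N B \<longleftrightarrow> N B \<and> (\<forall>S. B \<subset> S \<longrightarrow> \<not> N S)"

definition matroid_rank :: "('d::finite set \<Rightarrow> bool) \<Rightarrow> nat" where
  "matroid_rank N = Max {card S |S. N S}"

definition simple_matroid :: "('d::finite set \<Rightarrow> bool) \<Rightarrow> bool" where
  "simple_matroid N \<longleftrightarrow> matroid N \<and> (\<forall>S. card S \<le> 2 \<longrightarrow> N S)"

definition collinear_set :: "('d::finite set \<Rightarrow> bool) \<Rightarrow> 'd set \<Rightarrow> bool" where
  "collinear_set N L \<longleftrightarrow> 3 \<le> card L \<and> (\<forall>T. T \<subseteq> L \<longrightarrow> card T = 3 \<longrightarrow> \<not> N T)"

definition matroid_lines :: "('d::finite set \<Rightarrow> bool) \<Rightarrow> 'd set set" where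
  "matroid_lines N = {L. collinear_set N L \<and> (\<forall>L'. L \<subset> L' \<longrightarrow> \<not> collinear_set N L')}"

definition uniform_matroid :: "nat \<Rightarrow> 'd::finite set \<Rightarrow> bool" where
  "uniform_matroid r S \<longleftrightarrow> card S \<le> r"

definition make_loop :: "('d::finite set \<Rightarrow> bool) \<Rightarrow> 'd \<Rightarrow> 'd set \<Rightarrow> bool" where
  "make_loop N i S \<longleftrightarrow> N S \<and> i \<notin> S"


section \<open>The Zariski topology on tuples of vectors\<close>

text \<open>Polynomial functions in the \<open>3d\<close> coordinates of a point of \<open>(\<complex>\<^sup>3)\<^sup>d\<close>.\<close>

inductive_set polyfuns :: "(complex ^ 3 ^ 'd::finite \<Rightarrow> complex) set" where
  const: "(\<lambda>\<gamma>. c) \<in> polyfuns"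
| coord: "(\<lambda>\<gamma>. \<gamma> $ i $ j) \<in> polyfuns"
| add: "f \<in> polyfuns \<Longrightarrow> g \<in> polyfuns \<Longrightarrow> (\<lambda>\<gamma>. f \<gamma> + g \<gamma>) \<in> polyfuns"
| mult: "f \<in> polyfuns \<Longrightarrow> g \<in> polyfuns \<Longrightarrow> (\<lambda>\<gamma>. f \<gamma> * g \<gamma>) \<in> polyfuns"

definition zariski_closed :: "(complex ^ 3 ^ 'd::finite) set \<Rightarrow> bool" where
  "zariski_closed X \<longleftrightarrow> (\<exists>P \<subseteq> polyfuns. X = {\<gamma>. \<forall>f\<in>P. f \<gamma> = 0})"

definition zariski_closure :: "(complex ^ 3 ^ 'd::finite) set \<Rightarrow> (complex ^ 3 ^ 'd) set" where
  "zariski_closure X = zariski_closed hull X"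

definition zariski_irreducible :: "(complex ^ 3 ^ 'd::finite) set \<Rightarrow> bool" where
  "zariski_irreducible X \<longleftrightarrow> X \<noteq> {} \<and>
     (\<forall>A B. zariski_closed A \<longrightarrow> zariski_closed B \<longrightarrow> X \<subseteq> A \<union> B \<longrightarrow> X \<subseteq> A \<or> X \<subseteq> B)"

text \<open>The components form a list rather than a set, so that irredundancy also says that they are
  pairwise distinct.\<close>

definition irredundant_irreducible_decomposition ::
    "(complex ^ 3 ^ 'd::finite) set \<Rightarrow> (complex ^ 3 ^ 'd) set list \<Rightarrow> bool" where
  "irredundant_irreducible_decomposition X Vs \<longleftrightarrow>
     X = \<Union> (set Vs) \<and>
     (\<forall>V \<in> set Vs. zariski_closed V \<and> zariski_irreducible V) \<and>
     (\<forall>i < length Vs. \<not> Vs ! i \<subseteq> (\<Union>j \<in> {..<length Vs} - {i}. Vs ! j))"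


section \<open>Realizations, matroid varieties and circuit varieties\<close>

text \<open>Linear dependence over \<open>\<complex>\<close> of the indexed family \<open>(\<gamma>\<^sub>i)\<close> for \<open>i \<in> S\<close>; a repeated vector
  makes the family dependent.\<close>

definition family_dependent :: "complex ^ 3 ^ 'd::finite \<Rightarrow> 'd set \<Rightarrow> bool" where
  "family_dependent \<gamma> S \<longleftrightarrow> (\<exists>c. (\<exists>i\<in>S. c i \<noteq> 0) \<and> (\<Sum>i\<in>S. c i *s \<gamma> $ i) = 0)"

definition realizations :: "('d::finite set \<Rightarrow> bool) \<Rightarrow> (complex ^ 3 ^ 'd) set" where
  "realizations N = {\<gamma>. \<forall>S. \<not> N S \<longleftrightarrow> family_dependent \<gamma> S}"

definition matroid_variety :: "('d::finite set \<Rightarrow> bool) \<Rightarrow> (complex ^ 3 ^ 'd) set" where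
  "matroid_variety N = zariski_closure (realizations N)"

definition circuit_variety :: "('d::finite set \<Rightarrow> bool) \<Rightarrow> (complex ^ 3 ^ 'd) set" where
  "circuit_variety N = {\<gamma>. \<forall>S. \<not> N S \<longrightarrow> family_dependent \<gamma> S}"


section \<open>The Pascal configuration\<close>

definition pascal_configuration :: "(9 set \<Rightarrow> bool) \<Rightarrow> bool" where
  "pascal_configuration M \<longleftrightarrow> simple_matroid M \<and> matroid_rank M = 3 \<and>
     matroid_lines M = {{1,6,8}, {1,5,7}, {2,4,7}, {2,6,9}, {3,4,8}, {3,5,9}, {7,8,9}} \<and>
     (\<forall>T. card T = 3 \<longrightarrow> (\<forall>L\<in>matroid_lines M. \<not> T \<subseteq> L) \<longrightarrow> matroid_basis M T)"

text \<open>Existence: triples that pairwise meet in at most one point are the lines of a simple matroid.\<close>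

lemma simple_matroid_of_triples:
  fixes F :: "'d::finite set set"
  assumes F3: "\<And>L. L \<in> F \<Longrightarrow> card L = 3"
    and meet: "\<And>L L'. L \<in> F \<Longrightarrow> L' \<in> F \<Longrightarrow> L \<noteq> L' \<Longrightarrow> card (L \<inter> L') \<le> 1"
  defines "N \<equiv> \<lambda>S. card S \<le> 3 \<and> S \<notin> F"
  shows "simple_matroid N" and "matroid_lines N = F"
    and "card T = 3 \<Longrightarrow> T \<notin> F \<Longrightarrow> matroid_basis N T \<and> matroid_rank N = 3"
proof -
  have two: "L = L'" if "L \<in> F" "L' \<in> F" "S \<subseteq> L" "S \<subseteq> L'" "card S = 2" for L L' S
  proof (rule ccontr)
    assume "L \<noteq> L'"
    then have "card (L \<inter> L') \<le> 1" using meet that by blast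
    moreover have "card S \<le> card (L \<inter> L')" using that by (intro card_mono) auto
    ultimately show False using that by simp
  qed
  have down: "N S" if "N T" "S \<subseteq> T" for S T
  proof (cases "S = T")
    case False
    then have "card S < card T" using that by (intro psubset_card_mono) auto
    then show ?thesis using that F3 unfolding N_def by fastforce
  qed (use that in simp)
  have aug: "\<exists>t\<in>T - S. N (insert t S)" if "N S" "N T" "card S < card T" for S T
  proof (rule ccontr)
    assume no: "\<not> ?thesis"
    have dep: "insert t S \<in> F" if "t \<in> T - S" for t
      using no that \<open>N T\<close> \<open>card S < card T\<close> unfolding N_def by fastforce
    have "\<not> T \<subseteq> S" using that(3) card_mono[of S T] by fastforce
    then obtain t where t: "t \<in> T - S" by blast
    have S2: "card S = 2" using F3[OF dep[OF t]] t by simp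
    have "T \<subseteq> insert t S"
    proof
      fix u assume "u \<in> T"
      show "u \<in> insert t S"
      proof (cases "u \<in> S")
        case False
        then have "insert u S = insert t S"
          using two[of "insert u S" "insert t S" S] dep t \<open>u \<in> T\<close> S2 by blast
        then show ?thesis by blast
      qed simp
    qed
    moreover have "card (insert t S) \<le> card T" using S2 that t by simp
    ultimately have "T = insert t S" by (simp add: card_seteq)
    then show False using dep[OF t] \<open>N T\<close> unfolding N_def by simp
  qed
  have "N S" if "card S \<le> 2" for S using that F3 unfolding N_def by fastforce
  then show simple: "simple_matroid N"
    unfolding simple_matroid_def matroid_def using down aug by auto
  have coll: "collinear_set N L \<longleftrightarrow> L \<in> F" for L
  proof
    assume L: "L \<in> F"
    have "\<not> N T" if "T \<subseteq> L" "card T = 3" for T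
      using that L F3[OF L] card_subset_eq[of L T] unfolding N_def by simp
    then show "collinear_set N L" using F3[OF L] unfolding collinear_set_def by simp
  next
    assume "collinear_set N L"
    then have L: "card L \<ge> 3" "\<And>T. T \<subseteq> L \<Longrightarrow> card T = 3 \<Longrightarrow> T \<in> F"
      unfolding collinear_set_def N_def by auto
    obtain S where S: "S \<subseteq> L" "card S = 2" using obtain_subset_with_card_n[of 2 L] L(1) by auto
    have ins: "insert t S \<in> F" if "t \<in> L - S" for t
      using L(2)[of "insert t S"] that S by simp
    have "\<not> L \<subseteq> S" using L(1) S(2) card_mono[of S L] by fastforce
    then obtain t where t: "t \<in> L - S" by blast
    have "u \<in> insert t S" if "u \<in> L" for u
    proof (cases "u \<in> S")
      case False
      then have "insert u S = insert t S"
        using two[of "insert u S" "insert t S" S] ins t that S(2) by blast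
      then show ?thesis by blast
    qed simp
    then have "L = insert t S" using t S by blast
    then show "L \<in> F" using ins[OF t] by simp
  qed
  have "\<not> L \<subset> L'" if "L \<in> F" "L' \<in> F" for L L'
    using psubset_card_mono[of L' L] F3 that by fastforce
  then show "matroid_lines N = F" unfolding matroid_lines_def coll by blast
  assume T: "card T = 3" "T \<notin> F"
  then have NT: "N T" unfolding N_def by simp
  have "\<not> N S" if "T \<subset> S" for S
    using psubset_card_mono[of S T] that T unfolding N_def by simp
  moreover have "matroid_rank N = 3"
    unfolding matroid_rank_def
    by (rule Max_eqI) (use NT T in \<open>auto simp: N_def intro!: exI[of _ T]\<close>)
  ultimately show "matroid_basis N T \<and> matroid_rank N = 3"
    using NT unfolding matroid_basis_def by blast
qed

lemma pascal_configuration_exists: "\<exists>M. pascal_configuration M"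
proof -
  define F :: "9 set set" where
    "F = {{1,6,8}, {1,5,7}, {2,4,7}, {2,6,9}, {3,4,8}, {3,5,9}, {7,8,9}}"
  define N where "N = (\<lambda>S. card S \<le> 3 \<and> S \<notin> F)"
  have F3: "card L = 3" if "L \<in> F" for L using that unfolding F_def by auto
  have meet: "card (L \<inter> L') \<le> 1" if "L \<in> F" "L' \<in> F" "L \<noteq> L'" for L L'
    using that unfolding F_def by (elim insertE emptyE) (simp_all add: Int_insert_left)
  note tr = simple_matroid_of_triples[of F, OF F3 meet, folded N_def]
  have "\<not> {1,2,3} \<subseteq> L" if "L \<in> F" for L using that unfolding F_def by auto
  then have "{1,2,3} \<notin> F" by blast
  moreover have "card {1,2,3::9} = 3" by simp
  ultimately have "matroid_rank N = 3" using tr(3) by blast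
  moreover have "matroid_basis N T" if "card T = 3" "\<forall>L\<in>F. \<not> T \<subseteq> L" for T
    using tr(3) that by blast
  ultimately have "pascal_configuration N"
    using tr(1,2) unfolding pascal_configuration_def by (simp add: F_def)
  then show ?thesis by blast
qed

end

(*
  Points of a Zariski closed set are reached as limits of polynomial curves, so each inclusion into a
  matroid variety is an explicit deformation, and irreducibility follows by joining any two points of
  a parametrized set by a polynomial curve inside it.

  The points 1, 6, 2, 4, 3, 5 form a hexagon whose i-th and (i+3)-rd sides meet in one of the
  diagonal points 7, 8, 9.  Let a family satisfy the seven incidences.  If a diagonal point
  vanishes, the other points form a quadrilateral, and every quadrilateral deforms to a generic
  one.  If no diagonal point vanishes and the family has rank three, then the diagonal points are
  first made pairwise distinct by moving them apart together with the sides through them, and then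
  the sides that coincide with the diagonal line are rotated off it.  The rotation is possible
  because the sides do not all coincide with that line.
*)
theory Submission
  imports Defs "HOL-Computational_Algebra.Polynomial"
begin

section \<open>Vector algebra in three-space\<close>

text \<open>Each of the labels 7, 8, 9 lies on three lines, every other label on two. A vertex of
  the hexagon is a scalar multiple of the meet of its two sides, and the scalar may be zero, so a
  vanishing vertex needs no component of its own. A vanishing diagonal point releases three lines at
  once; this is the source of the three loop components. The planar component comes from a cyclic
  condition. If all six sides lie on the diagonal line, then turning them off it prescribes the
  ratio of the speeds of consecutive sides at every vertex, and the product of these ratios around
  the hexagon must be one. A single side off the line breaks the cycle, so families of rank three
  meet no such condition. Dimension theory is replaced by one fact: a polynomial restricted to a
  polynomial curve vanishes identically or at finitely many parameters. A generic condition may thus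
  be verified at any single parameter, even away from the one where the limit is taken. It also
  suffices to parametrize, by an affine space, some family between the realizations and their
  closure.\<close>

definition dot :: "complex ^ 3 \<Rightarrow> complex ^ 3 \<Rightarrow> complex" where
  "dot a b = a $ 1 * b $ 1 + a $ 2 * b $ 2 + a $ 3 * b $ 3"

text \<open>Points and lines of the projective plane are both vectors, a line being a covector
  paired through \<open>dot\<close>. Hence \<open>cross\<close> is the join of two points and also
  the meet of two lines. There is no conjugation in \<open>dot\<close>, so everything stays
  polynomial.\<close>

definition cross :: "complex ^ 3 \<Rightarrow> complex ^ 3 \<Rightarrow> complex ^ 3" where
  "cross a b = vector [a $ 2 * b $ 3 - a $ 3 * b $ 2, a $ 3 * b $ 1 - a $ 1 * b $ 3,
                       a $ 1 * b $ 2 - a $ 2 * b $ 1]"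

definition triple :: "complex ^ 3 \<Rightarrow> complex ^ 3 \<Rightarrow> complex ^ 3 \<Rightarrow> complex" where
  "triple a b c = dot (cross a b) c"

lemma vec3_eq_iff: "(a::complex ^ 3) = b \<longleftrightarrow> a $ 1 = b $ 1 \<and> a $ 2 = b $ 2 \<and> a $ 3 = b $ 3"
  by (simp add: vec_eq_iff forall_3)

lemma cross_nth [simp]:
  "cross a b $ 1 = a $ 2 * b $ 3 - a $ 3 * b $ 2"
  "cross a b $ 2 = a $ 3 * b $ 1 - a $ 1 * b $ 3"
  "cross a b $ 3 = a $ 1 * b $ 2 - a $ 2 * b $ 1"
  by (simp_all add: cross_def)

lemma dot_commute: "dot a b = dot b a"
  by (simp add: dot_def mult.commute)

lemma dot_linear [simp]:
  "dot a 0 = 0" "dot 0 a = 0"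
  "dot a (b + c) = dot a b + dot a c" "dot (b + c) a = dot b a + dot c a"
  "dot a (b - c) = dot a b - dot a c" "dot (b - c) a = dot b a - dot c a"
  "dot a (s *s b) = s * dot a b" "dot (s *s b) a = s * dot b a"
  by (simp_all add: dot_def algebra_simps)

lemma cross_linear [simp]:
  "cross a 0 = 0" "cross 0 a = 0"
  "cross a (b + c) = cross a b + cross a c" "cross (b + c) a = cross b a + cross c a"
  "cross a (b - c) = cross a b - cross a c" "cross (b - c) a = cross b a - cross c a"
  "cross a (s *s b) = s *s cross a b" "cross (s *s b) a = s *s cross b a"
  by (simp_all add: vec3_eq_iff algebra_simps)

lemma cross_self [simp]: "cross a a = 0"
  by (simp add: vec3_eq_iff)

lemma cross_skew: "cross a b = - cross b a"
  by (simp add: vec3_eq_iff)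

lemma cross_eq_0_commute: "cross a b = 0 \<longleftrightarrow> cross b a = 0"
  using cross_skew[of a b] by simp

lemma dot_cross_self [simp]:
  "dot a (cross a b) = 0" "dot a (cross b a) = 0" "dot (cross a b) a = 0" "dot (cross b a) a = 0"
  by (simp_all add: dot_def algebra_simps)

lemma cross_cross_left: "cross (cross a b) c = dot a c *s b - dot b c *s a"
  by (simp add: vec3_eq_iff dot_def algebra_simps)

lemma cross_cross_right: "cross a (cross b c) = dot a c *s b - dot a b *s c"
  by (simp add: vec3_eq_iff dot_def algebra_simps)

lemma triple_perm:
  "triple b a c = - triple a b c" "triple a c b = - triple a b c" "triple c b a = - triple a b c"
  "triple b c a = triple a b c" "triple c a b = triple a b c"
  by (simp_all add: triple_def dot_def algebra_simps)

lemma triple_repeat [simp]: "triple a a b = 0" "triple a b a = 0" "triple b a a = 0"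
  by (simp_all add: triple_def dot_def algebra_simps)

lemma triple_0 [simp]: "triple 0 a b = 0" "triple a 0 b = 0" "triple a b 0 = 0"
  by (simp_all add: triple_def)

lemma parallel_imp_multiple:
  assumes "a \<noteq> 0" "cross a b = 0"
  obtains s where "b = s *s a"
proof -
  obtain j where j: "a $ j \<noteq> 0" using assms(1) by (auto simp: vec_eq_iff)
  have "b = (b $ j / a $ j) *s a"
    using assms(2) j exhaust_3[of j] by (auto simp: vec3_eq_iff field_simps)
  then show ?thesis using that by blast
qed

text \<open>The usual solution divides by \<open>dot a a\<close>, which can vanish for a nonzero
  complex vector. The division is therefore by a nonzero coordinate of \<open>a\<close>, whence the
  three cases.\<close>

lemma orthogonal_imp_cross:
  assumes "a \<noteq> 0" "dot a c = 0"
  obtains v where "c = cross a v"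
proof -
  consider "a $ 1 \<noteq> 0" | "a $ 2 \<noteq> 0" | "a $ 3 \<noteq> 0"
    using assms(1) by (auto simp: vec3_eq_iff)
  then show ?thesis
  proof cases
    case 1
    then have "c = cross a (vector [0, c $ 3 / a $ 1, - c $ 2 / a $ 1])"
      using assms(2) by (auto simp: vec3_eq_iff dot_def field_simps) algebra
    then show ?thesis by (rule that)
  next
    case 2
    then have "c = cross a (vector [- c $ 3 / a $ 2, 0, c $ 1 / a $ 2])"
      using assms(2) by (auto simp: vec3_eq_iff dot_def field_simps) algebra
    then show ?thesis by (rule that)
  next
    case 3
    then have "c = cross a (vector [c $ 2 / a $ 3, - c $ 1 / a $ 3, 0])"
      using assms(2) by (auto simp: vec3_eq_iff dot_def field_simps) algebra
    then show ?thesis by (rule that)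
  qed
qed

lemma orthogonal_pair_imp_multiple:
  assumes "cross a b \<noteq> 0" "dot a c = 0" "dot b c = 0"
  obtains s where "c = s *s cross a b"
proof -
  have "cross (cross a b) c = 0" using assms by (simp add: cross_cross_left)
  then show ?thesis using parallel_imp_multiple[OF assms(1)] that by blast
qed

lemma in_span_of_orthogonal:
  assumes "cross u w \<noteq> 0" "dot (cross u w) x = 0"
  obtains a b where "x = a *s u + b *s w"
proof -
  obtain v where "x = cross (cross u w) v" using orthogonal_imp_cross[OF assms] .
  then have "x = (- dot w v) *s u + dot u v *s w"
    by (simp add: cross_cross_left vec3_eq_iff)
  then show ?thesis by (rule that)
qed

lemma obtain_orthogonal:
  obtains u where "u \<noteq> 0" "dot m u = 0"
proof (cases "m $ 1 = 0 \<and> m $ 2 = 0")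
  case True
  then show ?thesis by (intro that[of "vector [1, 0, 0]"]) (auto simp: vec3_eq_iff dot_def)
next
  case False
  then show ?thesis
    by (intro that[of "vector [- m $ 2, m $ 1, 0]"]) (auto simp: vec3_eq_iff dot_def)
qed

lemma obtain_plane_basis:
  assumes "m \<noteq> 0"
  obtains u w where "m = cross u w"
proof -
  obtain u where u: "u \<noteq> 0" "dot m u = 0" by (rule obtain_orthogonal)
  then show ?thesis using orthogonal_imp_cross[of u m] that by (metis dot_commute)
qed

lemma obtain_dot_1:
  assumes "m \<noteq> 0"
  obtains n where "dot m n = 1"
proof -
  obtain j where j: "m $ j \<noteq> 0" using assms by (auto simp: vec_eq_iff)
  then have "dot m (axis j (1 / m $ j)) = 1"
    using exhaust_3[of j] by (auto simp: dot_def axis_def)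
  then show ?thesis by (rule that)
qed

text \<open>A nonzero cross product of two of the vectors is a normal of their plane. When the
  vectors are parallel no cross product helps, and any normal of a nonzero one will do.\<close>

lemma obtain_common_orthogonal:
  assumes "triple a b c = 0"
  obtains m where "m \<noteq> 0" "dot m a = 0" "dot m b = 0" "dot m c = 0"
proof -
  have main: "\<exists>m. m \<noteq> 0 \<and> dot m a = 0 \<and> dot m b = 0 \<and> dot m c = 0"
    if a: "a \<noteq> 0" and abc: "triple a b c = 0" for a b c
  proof (cases "cross a b = 0")
    case False
    then show ?thesis using abc unfolding triple_def by (intro exI[of _ "cross a b"]) auto
  next
    case True
    then obtain s where s: "b = s *s a" using parallel_imp_multiple[OF a] by blast
    show ?thesis
    proof (cases "cross a c = 0")
      case False
      then show ?thesis using s by (intro exI[of _ "cross a c"]) auto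
    next
      case True
      then obtain s' where s': "c = s' *s a" using parallel_imp_multiple[OF a] by blast
      obtain m where "m \<noteq> 0" "dot a m = 0" by (rule obtain_orthogonal)
      then show ?thesis using s s' by (intro exI[of _ m]) (auto simp: dot_commute)
    qed
  qed
  consider "a \<noteq> 0" | "b \<noteq> 0" | "c \<noteq> 0" | "a = 0" "b = 0" "c = 0" by blast
  then show ?thesis
  proof cases
    case 1 then show ?thesis using main[of a b c] assms that by blast
  next
    case 2 then show ?thesis using main[of b c a] assms that triple_perm(4) by metis
  next
    case 3 then show ?thesis using main[of c a b] assms that triple_perm(5) by metis
  next
    case 4
    then show ?thesis using that[of "axis 1 1"] by (auto simp: axis_eq_0_iff)
  qed
qed

lemma triple_eq_0_orthogonal:
  assumes "m \<noteq> 0" "dot m a = 0" "dot m b = 0" "dot m c = 0"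
  shows "triple a b c = 0"
proof -
  obtain u v w where "a = cross m u" "b = cross m v" "c = cross m w"
    using orthogonal_imp_cross[OF assms(1)] assms by metis
  then show ?thesis
    by (simp add: triple_def cross_cross_left cross_cross_right)
qed

lemma triple_span:
  "triple a b (x *s a + y *s b) = 0" "triple (x *s u + y *s w) (x' *s u + y' *s w) (x'' *s u + y'' *s w) = 0"
  by (simp_all add: triple_def dot_def algebra_simps)

lemma parallel_trans:
  assumes "b \<noteq> 0" "cross a b = 0" "cross b c = 0"
  shows "cross a c = 0"
proof -
  obtain s where "a = s *s b"
    using parallel_imp_multiple[OF assms(1)] assms(2) cross_eq_0_commute by metis
  moreover obtain t where "c = t *s b" using parallel_imp_multiple[OF assms(1,3)] by blast
  ultimately show ?thesis by simp
qed

lemma parallel_orthogonal: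
  assumes "a \<noteq> 0" "cross a b = 0" "dot a x = 0"
  shows "dot b x = 0"
  using parallel_imp_multiple[OF assms(1,2)] assms(3) by (metis dot_linear(8) mult_zero_right)

lemma orthogonal_pair_parallel:
  assumes "cross u w \<noteq> 0" "dot a u = 0" "dot a w = 0" "dot b u = 0" "dot b w = 0"
  shows "cross a b = 0"
proof -
  obtain s t where "a = s *s cross u w" "b = t *s cross u w"
    using orthogonal_pair_imp_multiple[OF assms(1)] assms dot_commute by metis
  then show ?thesis by simp
qed


section \<open>Polynomial curves\<close>

definition poly_fun :: "(complex \<Rightarrow> complex) \<Rightarrow> bool" where
  "poly_fun f \<longleftrightarrow> (\<exists>p. \<forall>t. f t = poly p t)"

definition poly_vec :: "(complex \<Rightarrow> complex ^ 3) \<Rightarrow> bool" where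
  "poly_vec v \<longleftrightarrow> (\<forall>j. poly_fun (\<lambda>t. v t $ j))"

text \<open>Curves have no denominators, so a limit point is simply a value of the curve. A
  construction that needs division by the parameter has the quotient written out in its
  formula.\<close>

definition poly_curve :: "(complex \<Rightarrow> complex ^ 3 ^ 'd::finite) \<Rightarrow> bool" where
  "poly_curve c \<longleftrightarrow> (\<forall>i. poly_vec (\<lambda>t. c t $ i))"

named_theorems poly_intros

lemma poly_fun_const [poly_intros]: "poly_fun (\<lambda>t. k)"
  unfolding poly_fun_def by (rule exI[of _ "[:k:]"]) simp

lemma poly_fun_id [poly_intros]: "poly_fun (\<lambda>t. t)"
  unfolding poly_fun_def by (rule exI[of _ "[:0, 1:]"]) simp

lemma poly_fun_add [poly_intros]: "poly_fun f \<Longrightarrow> poly_fun g \<Longrightarrow> poly_fun (\<lambda>t. f t + g t)"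
  unfolding poly_fun_def by (metis poly_add)

lemma poly_fun_diff [poly_intros]: "poly_fun f \<Longrightarrow> poly_fun g \<Longrightarrow> poly_fun (\<lambda>t. f t - g t)"
  unfolding poly_fun_def by (metis poly_diff)

lemma poly_fun_mult [poly_intros]: "poly_fun f \<Longrightarrow> poly_fun g \<Longrightarrow> poly_fun (\<lambda>t. f t * g t)"
  unfolding poly_fun_def by (metis poly_mult)

lemma poly_fun_power [poly_intros]: "poly_fun f \<Longrightarrow> poly_fun (\<lambda>t. f t ^ n)"
  unfolding poly_fun_def by (metis poly_power)

lemma poly_vec_const [poly_intros]: "poly_vec (\<lambda>t. v)"
  unfolding poly_vec_def by (intro allI poly_intros)

lemma poly_vec_add [poly_intros]: "poly_vec v \<Longrightarrow> poly_vec w \<Longrightarrow> poly_vec (\<lambda>t. v t + w t)"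
  unfolding poly_vec_def by (simp add: poly_intros)

lemma poly_vec_diff [poly_intros]: "poly_vec v \<Longrightarrow> poly_vec w \<Longrightarrow> poly_vec (\<lambda>t. v t - w t)"
  unfolding poly_vec_def by (simp add: poly_intros)

lemma poly_vec_scale [poly_intros]: "poly_fun f \<Longrightarrow> poly_vec v \<Longrightarrow> poly_vec (\<lambda>t. f t *s v t)"
  unfolding poly_vec_def by (simp add: poly_intros)

lemma poly_vec_cross [poly_intros]: "poly_vec v \<Longrightarrow> poly_vec w \<Longrightarrow> poly_vec (\<lambda>t. cross (v t) (w t))"
  unfolding poly_vec_def forall_3 by (simp add: poly_intros)

lemma poly_fun_nth [poly_intros]: "poly_vec v \<Longrightarrow> poly_fun (\<lambda>t. v t $ j)"
  unfolding poly_vec_def by blast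

lemma poly_vec_curve [poly_intros]: "poly_curve c \<Longrightarrow> poly_vec (\<lambda>t. c t $ i)"
  unfolding poly_curve_def by blast

lemma poly_vec_if [poly_intros]:
  "(b \<Longrightarrow> poly_vec v) \<Longrightarrow> (\<not> b \<Longrightarrow> poly_vec w) \<Longrightarrow> poly_vec (\<lambda>t. if b then v t else w t)"
  by (cases b) simp_all

lemma poly_fun_if [poly_intros]:
  "(b \<Longrightarrow> poly_fun v) \<Longrightarrow> (\<not> b \<Longrightarrow> poly_fun w) \<Longrightarrow> poly_fun (\<lambda>t. if b then v t else w t)"
  by (cases b) simp_all

lemma poly_fun_polyfuns:
  assumes "f \<in> polyfuns" "poly_curve c"
  shows "poly_fun (\<lambda>t. f (c t))"
  using assms(1) by induction (intro poly_intros assms(2); assumption)+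

text \<open>A nonzero univariate polynomial has finitely many roots. The filter
  \<open>cofinite\<close> stands for general parameters throughout, and finitely many general
  conditions can be met together.\<close>

lemma poly_fun_generically_nonzero:
  assumes "poly_fun f" "f s \<noteq> 0"
  shows "\<forall>\<^sub>F t in cofinite. f t \<noteq> 0"
proof -
  obtain p where p: "\<And>t. f t = poly p t" using assms(1) unfolding poly_fun_def by blast
  then have "p \<noteq> 0" using assms(2) by auto
  then show ?thesis using poly_roots_finite[of p] by (simp add: eventually_cofinite p)
qed

lemma poly_vec_generically_nonzero:
  assumes "poly_vec v" "v s \<noteq> 0"
  shows "\<forall>\<^sub>F t in cofinite. v t \<noteq> 0"
proof -
  obtain j where j: "v s $ j \<noteq> 0" using assms(2) by (auto simp: vec_eq_iff)
  show ?thesis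
    using poly_fun_generically_nonzero[OF poly_fun_nth[OF assms(1)] j]
    by (rule eventually_mono) auto
qed

lemma generically_neq: "\<forall>\<^sub>F t in cofinite. t \<noteq> (a::complex)"
  by (simp add: eventually_cofinite)

lemma generically_witness: "\<forall>\<^sub>F t in cofinite. P (t::complex) \<Longrightarrow> \<exists>t. P t"
  using eventually_happens'[of "cofinite :: complex filter" P] infinite_UNIV_char_0
  by (simp add: cofinite_bot)

section \<open>Zariski closures\<close>

lemma polyfuns_diff: "f \<in> polyfuns \<Longrightarrow> g \<in> polyfuns \<Longrightarrow> (\<lambda>\<gamma>. f \<gamma> - g \<gamma>) \<in> polyfuns"
  using polyfuns.add[OF _ polyfuns.mult[OF polyfuns.const[of "-1"]]] by fastforce

lemma polyfuns_dot:
  assumes "\<And>j. (\<lambda>\<gamma>. v \<gamma> $ j) \<in> polyfuns" "\<And>j. (\<lambda>\<gamma>. w \<gamma> $ j) \<in> polyfuns"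
  shows "(\<lambda>\<gamma>. dot (v \<gamma>) (w \<gamma>)) \<in> polyfuns"
  unfolding dot_def by (intro polyfuns.add polyfuns.mult assms)

lemma polyfuns_cross:
  assumes "\<And>j. (\<lambda>\<gamma>. v \<gamma> $ j) \<in> polyfuns" "\<And>j. (\<lambda>\<gamma>. w \<gamma> $ j) \<in> polyfuns"
  shows "(\<lambda>\<gamma>. cross (v \<gamma>) (w \<gamma>) $ j) \<in> polyfuns"
  using exhaust_3[of j] assms by (auto intro!: polyfuns.mult polyfuns_diff)

lemma polyfuns_triple:
  assumes "\<And>j. (\<lambda>\<gamma>. u \<gamma> $ j) \<in> polyfuns" "\<And>j. (\<lambda>\<gamma>. v \<gamma> $ j) \<in> polyfuns"
    "\<And>j. (\<lambda>\<gamma>. w \<gamma> $ j) \<in> polyfuns"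
  shows "(\<lambda>\<gamma>. triple (u \<gamma>) (v \<gamma>) (w \<gamma>)) \<in> polyfuns"
  unfolding triple_def by (intro polyfuns_dot polyfuns_cross assms)

lemma polyfuns_prod:
  assumes "finite I" "\<And>i. i \<in> I \<Longrightarrow> f i \<in> polyfuns"
  shows "(\<lambda>\<gamma>. \<Prod>i\<in>I. f i \<gamma>) \<in> polyfuns"
  using assms by (induction I rule: finite_induct) (auto intro: polyfuns.const polyfuns.mult)

lemma zariski_closed_zeros:
  assumes "\<And>f. f \<in> P \<Longrightarrow> f \<in> polyfuns"
  shows "zariski_closed {\<gamma>. \<forall>f\<in>P. f \<gamma> = 0}"
proof -
  have "P \<subseteq> polyfuns" using assms by (rule subsetI)
  then show ?thesis unfolding zariski_closed_def by (metis (no_types))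
qed

lemma zariski_closed_common_zeros:
  assumes "\<And>x. x \<in> I \<Longrightarrow> f x \<in> polyfuns"
  shows "zariski_closed {\<gamma>. \<forall>x\<in>I. f x \<gamma> = 0}"
  using zariski_closed_zeros[of "f ` I"] assms by auto

lemma zariski_closed_zero: "f \<in> polyfuns \<Longrightarrow> zariski_closed {\<gamma>. f \<gamma> = 0}"
  using zariski_closed_zeros[of "{f}"] by simp

lemma zariski_closed_Inter:
  assumes "\<And>X. X \<in> \<X> \<Longrightarrow> zariski_closed X"
  shows "zariski_closed (\<Inter>\<X>)"
proof -
  have "\<forall>X\<in>\<X>. \<exists>P. P \<subseteq> polyfuns \<and> X = {\<gamma>. \<forall>f\<in>P. f \<gamma> = 0}"
    using assms unfolding zariski_closed_def by blast
  then obtain P where P: "\<forall>X\<in>\<X>. P X \<subseteq> polyfuns \<and> X = {\<gamma>. \<forall>f\<in>P X. f \<gamma> = 0}"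
    unfolding bchoice_iff by blast
  have "\<Inter>\<X> = {\<gamma>. \<forall>f\<in>\<Union>(P ` \<X>). f \<gamma> = 0}" 
  proof (intro set_eqI iffI)
    fix \<gamma> assume "\<gamma> \<in> \<Inter>\<X>"
    then have "f \<gamma> = 0" if "X \<in> \<X>" "f \<in> P X" for X f using bspec[OF P that(1)] that by auto
    then show "\<gamma> \<in> {\<gamma>. \<forall>f\<in>\<Union>(P ` \<X>). f \<gamma> = 0}" by auto
  next
    fix \<gamma> assume "\<gamma> \<in> {\<gamma>. \<forall>f\<in>\<Union>(P ` \<X>). f \<gamma> = 0}"
    then have "\<gamma> \<in> X" if "X \<in> \<X>" for X using bspec[OF P that] that by auto
    then show "\<gamma> \<in> \<Inter>\<X>" by blast
  qed
  moreover have "\<Union>(P ` \<X>) \<subseteq> polyfuns" using P by auto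
  ultimately show ?thesis using zariski_closed_zeros[of "\<Union>(P ` \<X>)"] by (metis subsetD)
qed

lemma zariski_closed_Int: "zariski_closed X \<Longrightarrow> zariski_closed Y \<Longrightarrow> zariski_closed (X \<inter> Y)"
  using zariski_closed_Inter[of "{X, Y}"] by auto

lemma zariski_closed_closure: "zariski_closed (zariski_closure X)"
  unfolding zariski_closure_def by (rule hull_in) (simp add: zariski_closed_Inter)

lemma zariski_closure_superset: "X \<subseteq> zariski_closure X"
  unfolding zariski_closure_def by (rule hull_subset)

lemma zariski_closure_minimal: "X \<subseteq> Y \<Longrightarrow> zariski_closed Y \<Longrightarrow> zariski_closure X \<subseteq> Y"
  unfolding zariski_closure_def by (rule hull_minimal)

lemma zariski_closed_separate:
  assumes "zariski_closed X" "\<gamma> \<notin> X"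
  obtains f where "f \<in> polyfuns" "f \<gamma> \<noteq> 0" "\<And>\<delta>. \<delta> \<in> X \<Longrightarrow> f \<delta> = 0"
proof -
  obtain P where P: "P \<subseteq> polyfuns" "X = {\<gamma>. \<forall>f\<in>P. f \<gamma> = 0}"
    using assms(1) unfolding zariski_closed_def by (elim exE conjE)
  then obtain f where "f \<in> P" "f \<gamma> \<noteq> 0" using assms(2) by auto
  then show ?thesis using P by (intro that[of f]) auto
qed

text \<open>A polynomial separating \<open>c s\<close> from \<open>X\<close> would be nonzero along
  the curve at almost all parameters, but also zero at almost all of them. No metric limit is
  involved.\<close>

lemma zariski_closed_curve_limit:
  assumes "zariski_closed X" "poly_curve c" "\<forall>\<^sub>F t in cofinite. c t \<in> X"
  shows "c s \<in> X"
proof (rule ccontr)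
  assume "c s \<notin> X"
  then obtain f where f: "f \<in> polyfuns" "f (c s) \<noteq> 0" "\<And>\<delta>. \<delta> \<in> X \<Longrightarrow> f \<delta> = 0"
    using zariski_closed_separate[OF assms(1)] by blast
  have "\<forall>\<^sub>F t in cofinite. f (c t) \<noteq> 0"
    using poly_fun_generically_nonzero[OF poly_fun_polyfuns[OF f(1) assms(2)] f(2)] .
  with assms(3) have "\<forall>\<^sub>F t in cofinite. c t \<in> X \<and> f (c t) \<noteq> 0" by (rule eventually_conj)
  then show False using generically_witness f(3) by blast
qed


section \<open>Dependent families\<close>

lemma family_dependent_mono: "family_dependent \<gamma> S \<Longrightarrow> S \<subseteq> T \<Longrightarrow> family_dependent \<gamma> T"
proof -
  assume "family_dependent \<gamma> S" and ST: "S \<subseteq> T"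
  then obtain c i where c: "i \<in> S" "c i \<noteq> 0" "(\<Sum>i\<in>S. c i *s \<gamma> $ i) = 0"
    unfolding family_dependent_def by blast
  let ?c = "\<lambda>i. if i \<in> S then c i else 0"
  have "(\<Sum>i\<in>T. ?c i *s \<gamma> $ i) = (\<Sum>i\<in>S. c i *s \<gamma> $ i)"
    using ST by (intro sum.mono_neutral_cong_right) auto
  then show ?thesis
    using c ST unfolding family_dependent_def by (intro exI[of _ ?c]) auto
qed

lemma family_dependent_empty [simp]: "\<not> family_dependent \<gamma> {}"
  unfolding family_dependent_def by simp

lemma family_dependent_singleton [simp]: "family_dependent \<gamma> {i} \<longleftrightarrow> \<gamma> $ i = 0"
  unfolding family_dependent_def by (auto simp: vector_mul_eq_0 intro!: exI[of _ "\<lambda>_. 1"])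

lemma family_dependent_zero: "\<gamma> $ i = 0 \<Longrightarrow> i \<in> S \<Longrightarrow> family_dependent \<gamma> S"
  using family_dependent_mono[of \<gamma> "{i}" S] by simp

lemma family_dependent_pair:
  assumes "i \<noteq> j"
  shows "family_dependent \<gamma> {i, j} \<longleftrightarrow> cross (\<gamma> $ i) (\<gamma> $ j) = 0"
proof
  assume "family_dependent \<gamma> {i, j}"
  then obtain c where c: "c i \<noteq> 0 \<or> c j \<noteq> 0" "c i *s \<gamma> $ i + c j *s \<gamma> $ j = 0"
    unfolding family_dependent_def using assms by auto
  have "c i *s cross (\<gamma> $ i) (\<gamma> $ j) = cross (c i *s \<gamma> $ i + c j *s \<gamma> $ j) (\<gamma> $ j)" by simp
  moreover have "c j *s cross (\<gamma> $ i) (\<gamma> $ j) = cross (\<gamma> $ i) (c i *s \<gamma> $ i + c j *s \<gamma> $ j)" by simp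
  ultimately show "cross (\<gamma> $ i) (\<gamma> $ j) = 0" using c by (auto simp: vector_mul_eq_0)
next
  assume eq: "cross (\<gamma> $ i) (\<gamma> $ j) = 0"
  show "family_dependent \<gamma> {i, j}"
  proof (cases "\<gamma> $ i = 0")
    case False
    then obtain s where "\<gamma> $ j = s *s \<gamma> $ i" using parallel_imp_multiple eq by blast
    then show ?thesis
      unfolding family_dependent_def using assms
      by (intro exI[of _ "(\<lambda>_. 1)(i := - s)"]) (auto simp: vec_eq_iff)
  qed (simp add: family_dependent_zero)
qed

lemma family_dependent_triple:
  assumes "i \<noteq> j" "i \<noteq> k" "j \<noteq> k"
  shows "family_dependent \<gamma> {i, j, k} \<longleftrightarrow> triple (\<gamma> $ i) (\<gamma> $ j) (\<gamma> $ k) = 0"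
proof
  let ?a = "\<gamma> $ i" and ?b = "\<gamma> $ j" and ?c = "\<gamma> $ k"
  assume "family_dependent \<gamma> {i, j, k}"
  then obtain c where c: "c i \<noteq> 0 \<or> c j \<noteq> 0 \<or> c k \<noteq> 0" "c i *s ?a + (c j *s ?b + c k *s ?c) = 0"
    unfolding family_dependent_def using assms by auto
  let ?s = "c i *s ?a + (c j *s ?b + c k *s ?c)"
  have "c i * triple ?a ?b ?c = triple ?s ?b ?c" "c j * triple ?a ?b ?c = triple ?a ?s ?c"
    "c k * triple ?a ?b ?c = triple ?a ?b ?s"
    by (simp_all add: triple_def dot_def algebra_simps)
  then show "triple ?a ?b ?c = 0" using c by auto
next
  let ?a = "\<gamma> $ i" and ?b = "\<gamma> $ j" and ?c = "\<gamma> $ k"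
  assume tr: "triple ?a ?b ?c = 0"
  show "family_dependent \<gamma> {i, j, k}"
  proof (cases "cross ?a ?b = 0")
    case True
    then have "family_dependent \<gamma> {i, j}" using family_dependent_pair assms(1) by blast
    then show ?thesis using family_dependent_mono by blast
  next
    case False
    then obtain x y where "?c = x *s ?a + y *s ?b"
      using in_span_of_orthogonal tr unfolding triple_def by blast
    then show ?thesis
      unfolding family_dependent_def using assms
      by (intro exI[of _ "(\<lambda>_. - 1)(i := x, j := y)"]) (auto simp: vec_eq_iff algebra_simps)
  qed
qed

lemma family_dependent_card:
  assumes "card S > 3"
  shows "family_dependent \<gamma> S"
proof -
  obtain T where T: "T \<subseteq> S" "card T = 4" using obtain_subset_with_card_n[of 4 S] assms by auto
  then obtain l T' where l: "T = insert l T'" "l \<notin> T'" "card T' = 3"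
    using card_Suc_eq[of T 3] by auto
  then obtain i j k where T': "T' = {i, j, k}" and d: "i \<noteq> j" "i \<noteq> k" "j \<noteq> k"
    by (auto simp: card_3_iff)
  let ?a = "\<gamma> $ i" and ?b = "\<gamma> $ j" and ?c = "\<gamma> $ k" and ?d = "\<gamma> $ l"
  have "family_dependent \<gamma> T"
  proof (cases "triple ?a ?b ?c = 0")
    case True
    then have "family_dependent \<gamma> T'" using family_dependent_triple d T' by blast
    then show ?thesis using family_dependent_mono l by blast
  next
    case False
    \<comment> \<open>Cramer's rule: the four maximal minors, with alternating signs, are the
      coefficients of a linear relation among four vectors.\<close>
    let ?\<kappa> = "(\<lambda>_. triple ?a ?b ?c)(i := - triple ?b ?c ?d, j := triple ?a ?c ?d, k := - triple ?a ?b ?d)"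
    have "triple ?a ?b ?c *s ?d + (- triple ?b ?c ?d *s ?a + (triple ?a ?c ?d *s ?b +
        - triple ?a ?b ?d *s ?c)) = 0"
      by (simp add: vec3_eq_iff triple_def dot_def algebra_simps)
    then have "(\<Sum>x\<in>T. ?\<kappa> x *s \<gamma> $ x) = 0"
      unfolding l(1) T' using d l(2) T' by simp
    moreover have "?\<kappa> l \<noteq> 0" "l \<in> T" using False l T' by auto
    ultimately show ?thesis
      unfolding family_dependent_def by blast
  qed
  then show ?thesis using family_dependent_mono T(1) by blast
qed

lemma card_le_3_cases:
  assumes "finite S" "card S \<le> 3"
  obtains "S = {}" | i where "S = {i}" | i j where "S = {i, j}" "i \<noteq> j"
    | i j k where "S = {i, j, k}" "i \<noteq> j" "i \<noteq> k" "j \<noteq> k"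
proof -
  have "card S = 0 \<or> card S = 1 \<or> card S = 2 \<or> card S = 3" using assms(2) by linarith
  then show ?thesis
    using that assms(1) by (auto simp: card_1_singleton_iff card_2_iff card_3_iff)
qed

text \<open>Independence is an open condition: \<open>f\<close> is a minor of size
  \<open>card S\<close> that does not vanish at the given family, namely 1, a coordinate, a
  coordinate of a cross product, or a determinant.\<close>

lemma independent_witness:
  assumes "\<not> family_dependent \<gamma> S"
  obtains f where "f \<in> polyfuns" "f \<gamma> \<noteq> 0" "\<And>\<delta>. f \<delta> \<noteq> 0 \<Longrightarrow> \<not> family_dependent \<delta> S"
proof -
  have "card S \<le> 3" using assms family_dependent_card by (meson not_le)
  with finite[of S] show ?thesis
  proof (cases rule: card_le_3_cases)
    case 1
    then show ?thesis using that[OF polyfuns.const[of 1]] by simp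
  next
    case (2 i)
    then obtain j where "\<gamma> $ i $ j \<noteq> 0" using assms by (auto simp: vec_eq_iff)
    moreover have "\<delta> $ i \<noteq> 0" if "\<delta> $ i $ j \<noteq> 0" for \<delta> :: "complex ^ 3 ^ 'a"
      using that by auto
    ultimately show ?thesis using that[OF polyfuns.coord[of i j]] 2 by auto
  next
    case (3 i j)
    then obtain l where l: "cross (\<gamma> $ i) (\<gamma> $ j) $ l \<noteq> 0"
      using assms family_dependent_pair[of i j \<gamma>] by (auto simp: vec_eq_iff[of _ 0])
    show ?thesis
    proof (rule that[where f = "\<lambda>\<gamma>. cross (\<gamma> $ i) (\<gamma> $ j) $ l"])
      show "(\<lambda>\<gamma>. cross (\<gamma> $ i) (\<gamma> $ j) $ l) \<in> polyfuns"
        by (intro polyfuns_cross polyfuns.coord)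
    qed (use 3 l in \<open>auto simp: family_dependent_pair\<close>)
  next
    case (4 i j k)
    then have l: "triple (\<gamma> $ i) (\<gamma> $ j) (\<gamma> $ k) \<noteq> 0"
      using assms family_dependent_triple by blast
    show ?thesis
    proof (rule that[where f = "\<lambda>\<gamma>. triple (\<gamma> $ i) (\<gamma> $ j) (\<gamma> $ k)"])
      show "(\<lambda>\<gamma>. triple (\<gamma> $ i) (\<gamma> $ j) (\<gamma> $ k)) \<in> polyfuns"
        by (intro polyfuns_triple polyfuns.coord)
    qed (use 4 l family_dependent_triple in auto)
  qed
qed

lemma curve_generically_independent:
  assumes "poly_curve c" "\<not> family_dependent (c s) S"
  shows "\<forall>\<^sub>F t in cofinite. \<not> family_dependent (c t) S"
proof -
  obtain f where f: "f \<in> polyfuns" "f (c s) \<noteq> 0" "\<And>\<delta>. f \<delta> \<noteq> 0 \<Longrightarrow> \<not> family_dependent \<delta> S"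
    using independent_witness[OF assms(2)] by blast
  show ?thesis
    using poly_fun_generically_nonzero[OF poly_fun_polyfuns[OF f(1) assms(1)] f(2)]
    by (rule eventually_mono) (use f(3) in blast)
qed


section \<open>Matroid varieties from connecting curves\<close>

text \<open>This replaces irreducibility of the image of an affine space: for such an image,
  interpolating the parameters linearly gives the required curve.\<close>

definition curve_connected :: "(complex ^ 3 ^ 'd::finite) set \<Rightarrow> bool" where
  "curve_connected X \<longleftrightarrow>
     (\<forall>\<gamma>\<in>X. \<forall>\<delta>\<in>X. \<exists>c. poly_curve c \<and> c 0 = \<gamma> \<and> c 1 = \<delta> \<and> (\<forall>t. c t \<in> X))"

lemma zariski_closed_matroid_variety: "zariski_closed (matroid_variety N)"
  unfolding matroid_variety_def by (rule zariski_closed_closure)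

lemma realizations_subset: "realizations N \<subseteq> matroid_variety N"
  unfolding matroid_variety_def by (rule zariski_closure_superset)

lemma matroid_variety_minimal:
  "realizations N \<subseteq> X \<Longrightarrow> zariski_closed X \<Longrightarrow> matroid_variety N \<subseteq> X"
  unfolding matroid_variety_def by (rule zariski_closure_minimal)

text \<open>A single realization in \<open>X\<close> suffices. On a curve from a given point to it,
  dependent sets stay dependent because \<open>X\<close> lies in the circuit variety, and each of
  the finitely many independent sets is independent at \<open>t = 1\<close>, hence at almost all
  \<open>t\<close>.\<close>

lemma curve_connected_subset_matroid_variety:
  assumes conn: "curve_connected X" and circ: "X \<subseteq> circuit_variety N"
    and \<gamma>\<^sub>0: "\<gamma>\<^sub>0 \<in> X" "\<gamma>\<^sub>0 \<in> realizations N"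
  shows "X \<subseteq> matroid_variety N"
proof
  fix \<gamma> assume "\<gamma> \<in> X"
  then obtain c where c: "poly_curve c" "c 0 = \<gamma>" "c 1 = \<gamma>\<^sub>0" "\<And>t. c t \<in> X"
    using conn \<gamma>\<^sub>0(1) unfolding curve_connected_def by blast
  have "\<forall>\<^sub>F t in cofinite. N S \<longrightarrow> \<not> family_dependent (c t) S" for S
    using curve_generically_independent[OF c(1), of 1 S] \<gamma>\<^sub>0(2) c(3)
    by (cases "N S") (auto simp: realizations_def)
  then have "\<forall>\<^sub>F t in cofinite. \<forall>S\<in>UNIV. N S \<longrightarrow> \<not> family_dependent (c t) S"
    by (intro eventually_ball_finite) auto
  then have "\<forall>\<^sub>F t in cofinite. c t \<in> matroid_variety N"
  proof (rule eventually_mono)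
    fix t assume "\<forall>S\<in>UNIV. N S \<longrightarrow> \<not> family_dependent (c t) S"
    moreover have "\<not> N S \<Longrightarrow> family_dependent (c t) S" for S
      using c(4)[of t] circ unfolding circuit_variety_def by blast
    ultimately have "c t \<in> realizations N" unfolding realizations_def by blast
    then show "c t \<in> matroid_variety N" using realizations_subset by blast
  qed
  then show "\<gamma> \<in> matroid_variety N"
    using zariski_closed_curve_limit[OF zariski_closed_matroid_variety c(1)] c(2) by metis
qed

text \<open>If neither closed set contains all realizations, each is avoided by some realization. On
  a curve joining these two, a general point avoids both sets although it lies in the
  variety.\<close>

lemma curve_connected_irreducible:
  assumes conn: "curve_connected X" and sub: "X \<subseteq> matroid_variety N"
    and real: "realizations N \<subseteq> X" and ne: "realizations N \<noteq> {}"
  shows "zariski_irreducible (matroid_variety N)"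
  unfolding zariski_irreducible_def
proof (intro conjI allI impI)
  show "matroid_variety N \<noteq> {}" using realizations_subset ne by blast
next
  fix A B assume A: "zariski_closed A" and B: "zariski_closed B"
    and cover: "matroid_variety N \<subseteq> A \<union> B"
  show "matroid_variety N \<subseteq> A \<or> matroid_variety N \<subseteq> B"
  proof (rule ccontr)
    assume "\<not> ?thesis"
    then have nA: "\<not> realizations N \<subseteq> A" and nB: "\<not> realizations N \<subseteq> B"
      using matroid_variety_minimal[OF _ A] matroid_variety_minimal[OF _ B] by blast+
    obtain \<gamma> where \<gamma>: "\<gamma> \<in> realizations N" "\<gamma> \<notin> A" using nA by blast
    obtain \<delta> where \<delta>: "\<delta> \<in> realizations N" "\<delta> \<notin> B" using nB by blast
    obtain f where f: "f \<in> polyfuns" "f \<gamma> \<noteq> 0" "\<And>\<xi>. \<xi> \<in> A \<Longrightarrow> f \<xi> = 0"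
      by (rule zariski_closed_separate[OF A \<gamma>(2)]) (rule that)
    obtain g where g: "g \<in> polyfuns" "g \<delta> \<noteq> 0" "\<And>\<xi>. \<xi> \<in> B \<Longrightarrow> g \<xi> = 0"
      by (rule zariski_closed_separate[OF B \<delta>(2)]) (rule that)
    obtain c where c: "poly_curve c" "c 0 = \<gamma>" "c 1 = \<delta>" "\<And>t. c t \<in> X"
      using conn real \<gamma>(1) \<delta>(1) unfolding curve_connected_def by blast
    have "\<forall>\<^sub>F t in cofinite. f (c t) \<noteq> 0"
      by (rule poly_fun_generically_nonzero[OF poly_fun_polyfuns[OF f(1) c(1)], of 0])
        (simp add: c(2) f(2))
    moreover have "\<forall>\<^sub>F t in cofinite. g (c t) \<noteq> 0"
      by (rule poly_fun_generically_nonzero[OF poly_fun_polyfuns[OF g(1) c(1)], of 1])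
        (simp add: c(3) g(2))
    ultimately have "\<forall>\<^sub>F t in cofinite. f (c t) \<noteq> 0 \<and> g (c t) \<noteq> 0" by (rule eventually_conj)
    then obtain t where "f (c t) \<noteq> 0" "g (c t) \<noteq> 0" using generically_witness by blast
    moreover have "c t \<in> A \<union> B" using c(4) sub cover by blast
    ultimately show False using f(3) g(3) by blast
  qed
qed

lemma realizations_make_loop:
  assumes "\<gamma> \<in> realizations N"
  shows "(\<chi> j. if j = i then 0 else \<gamma> $ j) \<in> realizations (make_loop N i)"
proof -
  let ?\<delta> = "\<chi> j. if j = i then 0 else \<gamma> $ j"
  have "family_dependent ?\<delta> S \<longleftrightarrow> family_dependent \<gamma> S" if "i \<notin> S" for S
    using that unfolding family_dependent_def
    by (intro ex_cong1 conj_cong refl arg_cong[of _ _ "\<lambda>x. x = 0"] sum.cong) auto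
  moreover have "family_dependent ?\<delta> S" if "i \<in> S" for S
    using that by (intro family_dependent_zero[of _ i]) auto
  ultimately show ?thesis
    using assms unfolding realizations_def make_loop_def by blast
qed

lemma circuit_variety_make_loop:
  "circuit_variety (make_loop N i) = {\<gamma> \<in> circuit_variety N. \<gamma> $ i = 0}"
proof (intro set_eqI iffI)
  fix \<gamma> assume \<gamma>: "\<gamma> \<in> circuit_variety (make_loop N i)"
  then have "family_dependent \<gamma> {i}"
    unfolding circuit_variety_def make_loop_def by blast
  then show "\<gamma> \<in> {\<gamma> \<in> circuit_variety N. \<gamma> $ i = 0}"
    using \<gamma> unfolding circuit_variety_def make_loop_def by simp
qed (auto simp: circuit_variety_def make_loop_def family_dependent_zero)

lemma realizations_subset_circuit_variety: "realizations N \<subseteq> circuit_variety N"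
  unfolding realizations_def circuit_variety_def by blast

section \<open>Families of rank two\<close>

lemma rank_two_parametrization:
  assumes "m \<noteq> 0" "\<And>i. dot m (\<gamma> $ i) = 0"
  obtains u w a b where "\<And>i. \<gamma> $ i = a i *s u + b i *s w"
proof -
  obtain u w where m: "m = cross u w" using obtain_plane_basis[OF assms(1)] .
  have "\<exists>a b. \<gamma> $ i = a *s u + b *s w" for i
    using in_span_of_orthogonal[of u w "\<gamma> $ i"] assms m by metis
  then show ?thesis using that by metis
qed

text \<open>These are the families of rank at most two, written as the image of an affine space so
  that they can be joined by curves; \<open>u\<close> and \<open>w\<close> may be dependent.\<close>

definition plane_families :: "(complex ^ 3 ^ 'd::finite) set" where
  "plane_families = {(\<chi> i. a i *s u + b i *s w) |a b u w. True}"

lemma plane_families_lambda: "(\<chi> i. a i *s u + b i *s w) \<in> plane_families"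
  unfolding plane_families_def by (rule CollectI, rule exI[of _ a], rule exI[of _ b]) blast

lemma plane_familiesI:
  assumes "m \<noteq> 0" "\<And>i. dot m (\<gamma> $ i) = 0"
  shows "\<gamma> \<in> plane_families"
proof -
  obtain u w a b where "\<And>i. \<gamma> $ i = a i *s u + b i *s w"
    by (rule rank_two_parametrization[OF assms]) (rule that)
  then have "\<gamma> = (\<chi> i. a i *s u + b i *s w)" by (simp add: vec_eq_iff)
  then show ?thesis by (simp only: plane_families_lambda)
qed

lemma plane_families_triple: "\<gamma> \<in> plane_families \<Longrightarrow> triple (\<gamma> $ i) (\<gamma> $ j) (\<gamma> $ k) = 0"
  unfolding plane_families_def by (auto simp: triple_span)

lemma plane_families_dependent:
  assumes "\<gamma> \<in> plane_families" "card S \<ge> 3"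
  shows "family_dependent \<gamma> S"
proof -
  obtain T where "T \<subseteq> S" "card T = 3" using obtain_subset_with_card_n assms(2) by metis
  then obtain i j k where "{i, j, k} \<subseteq> S" "i \<noteq> j" "i \<noteq> k" "j \<noteq> k" by (auto simp: card_3_iff)
  then show ?thesis
    using plane_families_triple[OF assms(1)] family_dependent_triple family_dependent_mono by metis
qed

lemma poly_curve_vec_lambda [poly_intros]:
  "(\<And>i. poly_vec (\<lambda>t. v t i)) \<Longrightarrow> poly_curve (\<lambda>t. \<chi> i. v t i)"
  unfolding poly_curve_def by simp

text \<open>A straight segment between families in different planes may leave rank two, so the
  spanning vectors and the coefficients are interpolated separately.\<close>

lemma curve_connected_plane_families: "curve_connected plane_families"
  unfolding curve_connected_def
proof (intro ballI)
  fix \<gamma> \<delta> :: "complex ^ 3 ^ 'a"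
  assume "\<gamma> \<in> plane_families" "\<delta> \<in> plane_families"
  then obtain a b u w a' b' u' w' where
    g: "\<gamma> = (\<chi> i. a i *s u + b i *s w)" and d: "\<delta> = (\<chi> i. a' i *s u' + b' i *s w')"
    unfolding plane_families_def by blast
  let ?c = "\<lambda>t. (\<chi> i. ((1 - t) * a i + t * a' i) *s ((1 - t) *s u + t *s u') +
                     ((1 - t) * b i + t * b' i) *s ((1 - t) *s w + t *s w')) :: complex ^ 3 ^ 'a"
  have "poly_curve ?c" by (intro poly_intros)
  moreover have "?c 0 = \<gamma>" "?c 1 = \<delta>" by (simp_all add: g d)
  moreover have "?c t \<in> plane_families" for t by (rule plane_families_lambda)
  ultimately show "\<exists>c. poly_curve c \<and> c 0 = \<gamma> \<and> c 1 = \<delta> \<and> (\<forall>t. c t \<in> plane_families)"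
    by (intro exI[of _ ?c]) simp
qed

lemma realizations_uniform_2_nonempty:
  "realizations (uniform_matroid 2) \<inter> (plane_families :: (complex ^ 3 ^ 'd::finite) set) \<noteq> {}"
proof -
  obtain f :: "'d \<Rightarrow> nat" where f: "inj f" using finite_imp_inj_to_nat_seg[of "UNIV :: 'd set"] by auto
  let ?u = "vector [1, 0, 0] :: complex ^ 3" and ?w = "vector [0, 1, 0] :: complex ^ 3"
  \<comment> \<open>Distinct slopes \<open>f i\<close> make the vectors pairwise nonparallel, and
    all of them lie in one plane.\<close>
  let ?\<gamma> = "(\<chi> i. 1 *s ?u + of_nat (f i) *s ?w) :: complex ^ 3 ^ 'd"
  have in_pl: "?\<gamma> \<in> plane_families" by (rule plane_families_lambda)
  have "\<not> family_dependent ?\<gamma> S" if "card S \<le> 2" for S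
    using finite[of S]
  proof (cases rule: card_le_3_cases)
    show "card S \<le> 3" using that by simp
    show "\<not> family_dependent ?\<gamma> S" if "S = {i}" for i
      using that by (simp add: vec3_eq_iff)
    show "\<not> family_dependent ?\<gamma> S" if "S = {i, j}" "i \<noteq> j" for i j
      using that inj_eq[OF f, of i j] by (auto simp: family_dependent_pair vec3_eq_iff)
  qed (use that in auto)
  moreover have "family_dependent ?\<gamma> S" if "\<not> card S \<le> 2" for S
    using plane_families_dependent[OF in_pl] that by simp
  ultimately have "?\<gamma> \<in> realizations (uniform_matroid 2)"
    unfolding realizations_def uniform_matroid_def by blast
  with in_pl show ?thesis by blast
qed

text \<open>The parametrized set is already closed, being the zero set of all triple products; this
  gives the inclusion from left to right. Two distinct labels are needed so that a realization spans
  a plane.\<close>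

lemma uniform_2_variety:
  assumes "card (UNIV :: 'd::finite set) \<ge> 2"
  shows "matroid_variety (uniform_matroid 2) = (plane_families :: (complex ^ 3 ^ 'd) set)"
    and "zariski_irreducible (matroid_variety (uniform_matroid 2) :: (complex ^ 3 ^ 'd) set)"
proof -
  let ?X = "plane_families :: (complex ^ 3 ^ 'd) set"
  have "?X \<subseteq> circuit_variety (uniform_matroid 2)"
    using plane_families_dependent unfolding circuit_variety_def uniform_matroid_def by force
  then have sub: "?X \<subseteq> matroid_variety (uniform_matroid 2)"
    using curve_connected_subset_matroid_variety[OF curve_connected_plane_families]
      realizations_uniform_2_nonempty by blast
  have real: "realizations (uniform_matroid 2) \<subseteq> ?X"
  proof
    fix \<gamma> :: "complex ^ 3 ^ 'd" assume \<gamma>: "\<gamma> \<in> realizations (uniform_matroid 2)"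
    then have dep: "family_dependent \<gamma> S \<longleftrightarrow> card S > 2" for S
      using spec[of "\<lambda>S. (\<not> uniform_matroid 2 S) = family_dependent \<gamma> S" S]
      by (simp add: realizations_def uniform_matroid_def not_le)
    obtain i j :: 'd where ij: "i \<noteq> j"
      using assms by (metis card_2_iff obtain_subset_with_card_n)
    then have m: "cross (\<gamma> $ i) (\<gamma> $ j) \<noteq> 0"
      using dep[of "{i, j}"] by (simp add: family_dependent_pair)
    show "\<gamma> \<in> ?X"
    proof (rule plane_familiesI[OF m])
      fix k
      have "triple (\<gamma> $ i) (\<gamma> $ j) (\<gamma> $ k) = 0"
      proof (cases "k = i \<or> k = j")
        case False
        then show ?thesis using dep[of "{i, j, k}"] ij by (auto simp: family_dependent_triple)
      qed auto
      then show "dot (cross (\<gamma> $ i) (\<gamma> $ j)) (\<gamma> $ k) = 0" by (simp add: triple_def)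
    qed
  qed
  have "matroid_variety (uniform_matroid 2) \<subseteq> ?X"
  proof -
    have "zariski_closed {\<gamma> :: complex ^ 3 ^ 'd. \<forall>(i, j, k)\<in>UNIV. triple (\<gamma> $ i) (\<gamma> $ j) (\<gamma> $ k) = 0}"
      (is "zariski_closed ?Y")
      using zariski_closed_common_zeros[of UNIV "\<lambda>(i, j, k) \<gamma>. triple (\<gamma> $ i) (\<gamma> $ j) (\<gamma> $ k)"]
      by (simp add: polyfuns_triple polyfuns.coord split_def)
    moreover have "?Y = ?X"
    proof (intro set_eqI iffI)
      fix \<gamma> assume "\<gamma> \<in> ?Y"
      then have tr: "triple (\<gamma> $ i) (\<gamma> $ j) (\<gamma> $ k) = 0" for i j k by auto
      show "\<gamma> \<in> ?X"
      proof (cases "\<exists>i j. cross (\<gamma> $ i) (\<gamma> $ j) \<noteq> 0")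
        case True
        then show ?thesis using plane_familiesI tr unfolding triple_def by blast
      next
        case par: False
        show ?thesis
        proof (cases "\<exists>i. \<gamma> $ i \<noteq> 0")
          case True
          then obtain i where i: "\<gamma> $ i \<noteq> 0" by blast
          \<comment> \<open>All vectors are parallel here, so no pair determines a plane; any plane
            through a nonzero one contains the family.\<close>
          obtain m where m: "m \<noteq> 0" "dot (\<gamma> $ i) m = 0" by (rule obtain_orthogonal)
          have "dot m (\<gamma> $ j) = 0" for j
            using parallel_orthogonal[OF i _ m(2)] par dot_commute by metis
          then show ?thesis using plane_familiesI m by blast
        next
          case False
          then show ?thesis by (intro plane_familiesI[of "axis 1 1"]) (auto simp: axis_eq_0_iff)
        qed
      qed
    qed (auto simp: plane_families_triple)
    ultimately show ?thesis using matroid_variety_minimal[OF real] by simp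
  qed
  with sub show "matroid_variety (uniform_matroid 2) = ?X" by blast
  show "zariski_irreducible (matroid_variety (uniform_matroid 2) :: (complex ^ 3 ^ 'd) set)"
    using curve_connected_irreducible[OF curve_connected_plane_families sub real]
      realizations_uniform_2_nonempty by blast
qed


section \<open>The Pascal configuration as a hexagon\<close>

definition pascal_lines :: "9 set set" where
  "pascal_lines = {{1,6,8}, {1,5,7}, {2,4,7}, {2,6,9}, {3,4,8}, {3,5,9}, {7,8,9}}"

text \<open>The diagonal points are indexed modulo 3 and the vertices modulo 6 in cyclic order,
  which makes the six sides interchangeable in later arguments. The predecessor of \<open>i\<close>
  is written \<open>(i + 5) mod 6\<close> to avoid truncated subtraction.\<close>

definition assemble :: "(nat \<Rightarrow> complex ^ 3) \<Rightarrow> (nat \<Rightarrow> complex ^ 3) \<Rightarrow> complex ^ 3 ^ 9" where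
  "assemble p q = (\<chi> j. if j = 7 then p 0 else if j = 8 then p 1 else if j = 9 then p 2
     else if j = 1 then q 0 else if j = 6 then q 1 else if j = 2 then q 2
     else if j = 4 then q 3 else if j = 3 then q 4 else q 5)"

text \<open>Side \<open>i\<close> of the hexagon \<open>q\<close> joins \<open>q (i - 1)\<close> to \<open>q i\<close> and passes through \<open>p (i mod 3)\<close>.\<close>

definition incident :: "(nat \<Rightarrow> complex ^ 3) \<Rightarrow> (nat \<Rightarrow> complex ^ 3) \<Rightarrow> bool" where
  "incident p q \<longleftrightarrow> triple (p 0) (p 1) (p 2) = 0 \<and>
     (\<forall>i<6. triple (p (i mod 3)) (q i) (q ((i + 5) mod 6)) = 0)"

lemma all_less_3: "(\<forall>i<3. P i) \<longleftrightarrow> P 0 \<and> P 1 \<and> P (2::nat)"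
proof -
  have eq: "{..<3::nat} = {0,1,2}" by auto
  have "(\<forall>i<3. P i) \<longleftrightarrow> (\<forall>i\<in>{..<3}. P i)" by auto
  then show ?thesis unfolding eq by simp
qed

lemma all_less_4: "(\<forall>i<4. P i) \<longleftrightarrow> P 0 \<and> P 1 \<and> P 2 \<and> P (3::nat)"
proof -
  have eq: "{..<4::nat} = {0,1,2,3}" by auto
  have "(\<forall>i<4. P i) \<longleftrightarrow> (\<forall>i\<in>{..<4}. P i)" by auto
  then show ?thesis unfolding eq by simp
qed

lemma all_less_6: "(\<forall>i<6. P i) \<longleftrightarrow> P 0 \<and> P 1 \<and> P 2 \<and> P 3 \<and> P 4 \<and> P (5::nat)"
proof -
  have eq: "{..<6::nat} = {0,1,2,3,4,5}" by auto
  have "(\<forall>i<6. P i) \<longleftrightarrow> (\<forall>i\<in>{..<6}. P i)" by auto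
  then show ?thesis unfolding eq by simp
qed

lemma exhaust_9:
  fixes x :: 9
  shows "x = 1 \<or> x = 2 \<or> x = 3 \<or> x = 4 \<or> x = 5 \<or> x = 6 \<or> x = 7 \<or> x = 8 \<or> x = 9"
proof (induct x)
  case (of_int z)
  then have "z = 0 \<or> z = 1 \<or> z = 2 \<or> z = 3 \<or> z = 4 \<or> z = 5 \<or> z = 6 \<or> z = 7 \<or> z = 8" by simp arith
  then show ?case by auto
qed

lemma forall_9: "(\<forall>i::9. P i) \<longleftrightarrow> P 1 \<and> P 2 \<and> P 3 \<and> P 4 \<and> P 5 \<and> P 6 \<and> P 7 \<and> P 8 \<and> P 9"
  by (metis exhaust_9)

lemma assemble_nth [simp]:
  "assemble p q $ 7 = p 0" "assemble p q $ 8 = p 1" "assemble p q $ 9 = p 2"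
  "assemble p q $ 1 = q 0" "assemble p q $ 6 = q 1" "assemble p q $ 2 = q 2"
  "assemble p q $ 4 = q 3" "assemble p q $ 3 = q 4" "assemble p q $ 5 = q 5"
  by (simp_all add: assemble_def)

lemma assemble_cong:
  assumes "\<And>k. k < 3 \<Longrightarrow> p k = p' k" "\<And>i. i < 6 \<Longrightarrow> q i = q' i"
  shows "assemble p q = assemble p' q'"
  by (simp add: vec_eq_iff forall_9 assms)

lemma assemble_surj:
  obtains p q where "\<gamma> = assemble p q"
proof
  show "\<gamma> = assemble (\<lambda>k. if k = 0 then \<gamma> $ 7 else if k = 1 then \<gamma> $ 8 else \<gamma> $ 9)
    (\<lambda>i. if i = 0 then \<gamma> $ 1 else if i = 1 then \<gamma> $ 6 else if i = 2 then \<gamma> $ 2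
      else if i = 3 then \<gamma> $ 4 else if i = 4 then \<gamma> $ 3 else \<gamma> $ 5)"
    by (subst vec_eq_iff) (simp add: forall_9)
qed

lemma poly_curve_assemble [poly_intros]:
  assumes "\<And>k. k < 3 \<Longrightarrow> poly_vec (\<lambda>t. p t k)" "\<And>i. i < 6 \<Longrightarrow> poly_vec (\<lambda>t. q t i)"
  shows "poly_curve (\<lambda>t. assemble (p t) (q t))"
  unfolding poly_curve_def forall_9 by (simp add: assms)

lemma all_assemble:
  "(\<forall>j. P (assemble p q $ j)) \<longleftrightarrow> (\<forall>k<3. P (p k)) \<and> (\<forall>i<6. P (q i))"
  unfolding forall_9 all_less_3 all_less_6 by auto

section \<open>The Pascal matroid in hexagon coordinates: dependent sets, equations and a
  realization\<close>

lemma pascal_independent_iff: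
  assumes "pascal_configuration M"
  shows "M S \<longleftrightarrow> card S \<le> 3 \<and> S \<notin> pascal_lines"
proof -
  have small: "\<forall>S. card S \<le> 2 \<longrightarrow> M S"
    using assms unfolding pascal_configuration_def simple_matroid_def by (elim conjE)
  have basis: "\<forall>T. card T = 3 \<longrightarrow> (\<forall>L\<in>matroid_lines M. \<not> T \<subseteq> L) \<longrightarrow> matroid_basis M T"
    using assms unfolding pascal_configuration_def by (elim conjE)
  have lines: "matroid_lines M = pascal_lines"
    using assms unfolding pascal_configuration_def pascal_lines_def by (elim conjE)
  have card3: "card L = 3" if "L \<in> pascal_lines" for L
    using that unfolding pascal_lines_def by auto
  have "card S \<le> 3" if "M S"
  proof -
    have "card S \<in> {card S |S. M S}" using that by blast
    moreover have "finite {card S |S. M S}"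
      by (simp add: setcompr_eq_image)
    ultimately have "card S \<le> matroid_rank M" unfolding matroid_rank_def by (intro Max_ge)
    moreover have "matroid_rank M = 3" using assms unfolding pascal_configuration_def by (elim conjE)
    ultimately show ?thesis by simp
  qed
  moreover have "\<not> M S" if "S \<in> pascal_lines"
  proof -
    have "collinear_set M S" using that lines unfolding matroid_lines_def by blast
    then show ?thesis using card3[OF that] unfolding collinear_set_def by blast
  qed
  \<comment> \<open>Every line has exactly three elements, so a triple contained in a line is that
    line.\<close>
  moreover have "M S" if "card S = 3" "S \<notin> pascal_lines"
  proof -
    have "\<not> S \<subseteq> L" if "L \<in> matroid_lines M" for L
      using that lines card3 \<open>card S = 3\<close> \<open>S \<notin> pascal_lines\<close> card_subset_eq[of L S] by auto
    then show ?thesis using basis \<open>card S = 3\<close> unfolding matroid_basis_def by blast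
  qed
  moreover have "M S" if "card S \<le> 2" using small that by blast
  ultimately show ?thesis by (metis le_eq_less_or_eq less_Suc_eq_le numeral_2_eq_2 numeral_3_eq_3)
qed

lemma pascal_matroid: "pascal_configuration M \<Longrightarrow> matroid M"
  unfolding pascal_configuration_def simple_matroid_def by blast

text \<open>Sets with more than three elements are always dependent in three-space, so only the
  seven lines impose equations. The permutations of \<open>triple\<close> match each line with the
  order used by \<open>incident\<close>.\<close>

lemma assemble_in_circuit_variety_iff:
  assumes "pascal_configuration M"
  shows "assemble p q \<in> circuit_variety M \<longleftrightarrow> incident p q"
proof -
  let ?\<gamma> = "assemble p q"
  have "?\<gamma> \<in> circuit_variety M \<longleftrightarrow> (\<forall>T\<in>pascal_lines. family_dependent ?\<gamma> T)"
    unfolding circuit_variety_def pascal_independent_iff[OF assms]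
    using family_dependent_card[of _ ?\<gamma>] by (auto simp: not_le)
  also have "\<dots> \<longleftrightarrow> incident p q"
    using triple_perm(5)[of "p 0" "q 0" "q 5"] triple_perm(3)[of "p 1" "q 1" "q 0"]
      triple_perm(5)[of "p 2" "q 2" "q 1"] triple_perm(3)[of "p 0" "q 3" "q 2"]
      triple_perm(5)[of "p 1" "q 4" "q 3"] triple_perm(3)[of "p 2" "q 5" "q 4"]
    unfolding incident_def all_less_6
    by (simp add: family_dependent_triple pascal_lines_def) argo
  finally show ?thesis .
qed

lemma zariski_closed_circuit_variety_pascal:
  assumes "pascal_configuration M"
  shows "zariski_closed (circuit_variety M)"
proof -
  define I where "I = {(i, j, k). {i, j, k :: 9} \<in> pascal_lines \<and> i \<noteq> j \<and> i \<noteq> k \<and> j \<noteq> k}"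
  have "circuit_variety M = {\<gamma>. \<forall>(i, j, k)\<in>I. triple (\<gamma> $ i) (\<gamma> $ j) (\<gamma> $ k) = 0}"
  proof (intro set_eqI iffI CollectI)
    fix \<gamma> assume "\<gamma> \<in> circuit_variety M"
    then have "family_dependent \<gamma> T" if "T \<in> pascal_lines" for T
      using that unfolding circuit_variety_def pascal_independent_iff[OF assms] by simp
    then show "\<forall>(i, j, k)\<in>I. triple (\<gamma> $ i) (\<gamma> $ j) (\<gamma> $ k) = 0"
      unfolding I_def using family_dependent_triple by fastforce
  next
    fix \<gamma> :: "complex ^ 3 ^ 9"
    assume "\<gamma> \<in> {\<gamma>. \<forall>(i, j, k)\<in>I. triple (\<gamma> $ i) (\<gamma> $ j) (\<gamma> $ k) = 0}"
    then have \<gamma>: "triple (\<gamma> $ i) (\<gamma> $ j) (\<gamma> $ k) = 0" if "(i, j, k) \<in> I" for i j k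
      using that by auto
    have "family_dependent \<gamma> T" if T: "T \<in> pascal_lines" for T
    proof -
      have "card T = 3" using T unfolding pascal_lines_def by auto
      then obtain i j k where ijk: "T = {i, j, k}" "i \<noteq> j" "i \<noteq> k" "j \<noteq> k" by (auto simp: card_3_iff)
      then have "(i, j, k) \<in> I" using T unfolding I_def by simp
      then show ?thesis using \<gamma> ijk by (simp add: family_dependent_triple)
    qed
    then show "\<gamma> \<in> circuit_variety M"
      unfolding circuit_variety_def pascal_independent_iff[OF assms]
      using family_dependent_card by (auto simp: not_le)
  qed
  moreover have "zariski_closed {\<gamma>. \<forall>(i, j, k)\<in>I. triple (\<gamma> $ i) (\<gamma> $ j) (\<gamma> $ k) = 0}"
    using zariski_closed_common_zeros[of I "\<lambda>(i, j, k) \<gamma>. triple (\<gamma> $ i) (\<gamma> $ j) (\<gamma> $ k)"]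
    by (simp add: polyfuns_triple polyfuns.coord split_def)
  ultimately show ?thesis by simp
qed

text \<open>Smaller independent sets need no separate test: augmentation from the basis
  \<open>{1, 2, 3}\<close> extends them to independent triples, and independence passes to
  subsets.\<close>

lemma realizations_pascal_iff:
  assumes "pascal_configuration M"
  shows "\<gamma> \<in> realizations M \<longleftrightarrow> (\<forall>T. card T = 3 \<longrightarrow> (family_dependent \<gamma> T \<longleftrightarrow> T \<in> pascal_lines))"
proof
  assume "\<gamma> \<in> realizations M"
  then show "\<forall>T. card T = 3 \<longrightarrow> (family_dependent \<gamma> T \<longleftrightarrow> T \<in> pascal_lines)"
    unfolding realizations_def pascal_independent_iff[OF assms] mem_Collect_eq by (metis order_refl)
next
  assume R: "\<forall>T. card T = 3 \<longrightarrow> (family_dependent \<gamma> T \<longleftrightarrow> T \<in> pascal_lines)"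
  note M = pascal_independent_iff[OF assms]
  have "\<not> family_dependent \<gamma> S" if "M S" for S
    using that
  proof (induction "3 - card S" arbitrary: S)
    case 0
    then show ?case using R M by (metis diff_is_0_eq le_antisym)
  next
    case (Suc n)
    have "{1, 2, 3} \<notin> pascal_lines" by (simp add: pascal_lines_def set_eq_iff forall_9)
    then have "M {1, 2, 3}" using M[of "{1, 2, 3}"] by simp
    moreover have "card S < card {1, 2, 3 :: 9}" using Suc.hyps(2) by simp
    ultimately obtain t where t: "t \<in> {1, 2, 3} - S" "M (insert t S)"
      using pascal_matroid[OF assms] Suc.prems unfolding matroid_def by metis
    then have "\<not> family_dependent \<gamma> (insert t S)" using Suc.hyps by (intro Suc.hyps(1)) auto
    then show ?case using family_dependent_mono by blast
  qed
  moreover have "family_dependent \<gamma> S" if "\<not> M S" for S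
  proof (cases "card S > 3")
    case False
    then have "S \<in> pascal_lines" using M that by auto
    moreover then have "card S = 3" unfolding pascal_lines_def by auto
    ultimately show ?thesis using R by blast
  qed (rule family_dependent_card)
  ultimately show "\<gamma> \<in> realizations M" unfolding realizations_def by blast
qed

text \<open>Labels are listed by the numbers 0 to 8, with 0 standing for the label 9. Sorting leaves
  84 triples to be evaluated for an explicit family.\<close>

lemma obtain_sorted_triple:
  assumes "card (T :: 9 set) = 3"
  obtains x y z where "z < 9" "y < z" "x < y" "T = {of_nat x, of_nat y, of_nat z}"
proof -
  have surj: "\<exists>n<9. i = of_nat n" for i :: 9
    using exhaust_9[of i]
    by (elim disjE) (auto intro: exI[of _ 1] exI[of _ 2] exI[of _ 3] exI[of _ 4] exI[of _ 5]
      exI[of _ 6] exI[of _ 7] exI[of _ 8] exI[of _ 0])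
  obtain i j k where "T = {i, j, k}" "i \<noteq> j" "i \<noteq> k" "j \<noteq> k" using assms by (auto simp: card_3_iff)
  then obtain a b c where abc: "T = {of_nat a, of_nat b, of_nat c}" "a < 9" "b < 9" "c < 9"
    "a \<noteq> b" "a \<noteq> c" "b \<noteq> c"
    using surj by metis
  then consider "a < b" "b < c" | "a < c" "c < b" | "b < a" "a < c" | "b < c" "c < a"
    | "c < a" "a < b" | "c < b" "b < a" by linarith
  then show ?thesis
  proof cases
    case 1 then show ?thesis using abc that[of c b a] by simp
  next
    case 2 then show ?thesis using abc that[of b c a] by (simp add: insert_commute)
  next
    case 3 then show ?thesis using abc that[of c a b] by (simp add: insert_commute)
  next
    case 4 then show ?thesis using abc that[of a c b] by (simp add: insert_commute)
  next
    case 5 then show ?thesis using abc that[of b a c] by (simp add: insert_commute)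
  next
    case 6 then show ?thesis using abc that[of a b c] by (simp add: insert_commute)
  qed
qed

lemma pascal_realization_exists:
  assumes "pascal_configuration M"
  shows "realizations M \<noteq> {}"
proof -
  \<comment> \<open>The diagonal points are the points at infinity of the horizontal, the vertical
    and the slope-one direction. Up to scaling, the vertices are the affine points (1,0), (1,-1),
    (3,1), (0,1), (0,1/2), (-1/2,0): a hexagon with opposite sides parallel.\<close>
  define \<gamma> :: "complex ^ 3 ^ 9" where
    "\<gamma> = assemble (\<lambda>k. if k = 0 then vector [1, 0, 0] else if k = 1 then vector [0, 1, 0] else vector [1, 1, 0])
      (\<lambda>i. if i = 0 then vector [-1, 0, -1] else if i = 1 then vector [1, -1, 1]
        else if i = 2 then vector [3, 1, 1] else if i = 3 then vector [0, -1, -1]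
        else if i = 4 then vector [0, -1, -2] else vector [1, 0, -2])"
  have nth: "\<gamma> $ 0 = vector [1, 1, 0]" "\<gamma> $ 1 = vector [-1, 0, -1]" "\<gamma> $ 2 = vector [3, 1, 1]"
    "\<gamma> $ 3 = vector [0, -1, -2]" "\<gamma> $ 4 = vector [0, -1, -1]" "\<gamma> $ 5 = vector [1, 0, -2]"
    "\<gamma> $ 6 = vector [1, -1, 1]" "\<gamma> $ 7 = vector [1, 0, 0]" "\<gamma> $ 8 = vector [0, 1, 0]"
    using assemble_nth(3) by (simp_all add: \<gamma>_def) (simp add: assemble_def)
  \<comment> \<open>Bounded quantifiers become explicit lists of numerals, so that simplification
    can evaluate every triple.\<close>
  have all9: "(\<forall>z<9. \<forall>y<z. \<forall>x<y. P x y z) \<longleftrightarrow>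
      (\<forall>z\<in>{0,1,2,3,4,5,6,7,8}. \<forall>y\<in>{0,1,2,3,4,5,6,7,8}. y < z \<longrightarrow>
        (\<forall>x\<in>{0,1,2,3,4,5,6,7,8}. x < y \<longrightarrow> P x y z))" for P :: "nat \<Rightarrow> nat \<Rightarrow> nat \<Rightarrow> bool"
  proof -
    have eq: "{0,1,2,3,4,5,6,7,8} = {..<9::nat}" by auto
    show ?thesis
      unfolding eq
    proof (intro iffI allI impI)
      fix z y x :: nat
      assume H: "\<forall>z\<in>{..<9}. \<forall>y\<in>{..<9}. y < z \<longrightarrow> (\<forall>x\<in>{..<9}. x < y \<longrightarrow> P x y z)"
        and "z < 9" "y < z" "x < y"
      then have "z \<in> {..<9}" "y \<in> {..<9}" "x \<in> {..<9}" by auto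
      then show "P x y z" using H \<open>y < z\<close> \<open>x < y\<close> by blast
    qed simp
  qed
  have eval: "\<forall>z<9. \<forall>y<z. \<forall>x<y. triple (\<gamma> $ of_nat x) (\<gamma> $ of_nat y) (\<gamma> $ of_nat z) = 0 \<longleftrightarrow>
      {of_nat x, of_nat y, of_nat z} \<in> pascal_lines"
    unfolding all9
    by (simp add: nth triple_def dot_def pascal_lines_def set_eq_iff forall_9)
  have inj: "of_nat x \<noteq> (of_nat y :: 9)" if "x < y" "y < 9" for x y :: nat
    using that by (auto simp: numeral_eq_Suc less_Suc_eq)
  have "family_dependent \<gamma> T \<longleftrightarrow> T \<in> pascal_lines" if T3: "card T = 3" for T
  proof -
    obtain x y z where xyz: "z < 9" "y < z" "x < y" and T: "T = {of_nat x, of_nat y, of_nat z}"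
      using obtain_sorted_triple[OF T3] .
    have "family_dependent \<gamma> T \<longleftrightarrow> triple (\<gamma> $ of_nat x) (\<gamma> $ of_nat y) (\<gamma> $ of_nat z) = 0"
      unfolding T by (intro family_dependent_triple inj) (use xyz in auto)
    then show ?thesis using eval xyz T by blast
  qed
  then show ?thesis using realizations_pascal_iff[OF assms] by blast
qed

section \<open>Parametrization of the Pascal configuration\<close>

text \<open>The parameters obey no equations. The line through the three points is spanned by
  \<open>u\<close> and \<open>w\<close>, side \<open>i\<close> is the line
  \<open>cross (p (i mod 3)) (v i)\<close> through its diagonal point, and a vertex is a multiple of
  the meet of sides \<open>i\<close> and \<open>i + 1\<close>. A zero factor \<open>s i\<close>
  allows a vanishing vertex.\<close>

definition pascal_families :: "(complex ^ 3 ^ 9) set" where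
  "pascal_families = {assemble p q |p q. \<exists>u w a b v s.
     (\<forall>k<3. p k = a k *s u + b k *s w) \<and>
     (\<forall>i<6. q i = s i *s cross (cross (p (i mod 3)) (v i)) (cross (p (Suc i mod 3)) (v (Suc i mod 6))))}"

lemma pascal_familiesI:
  assumes "\<forall>k<3. p k = a k *s u + b k *s w"
    and "\<forall>i<6. q i = s i *s cross (cross (p (i mod 3)) (v i)) (cross (p (Suc i mod 3)) (v (Suc i mod 6)))"
  shows "assemble p q \<in> pascal_families"
  unfolding pascal_families_def
  by (rule CollectI, rule exI[of _ p], rule exI[of _ q], rule conjI[OF refl],
      rule exI[of _ u], rule exI[of _ w], rule exI[of _ a], rule exI[of _ b],
      rule exI[of _ v], rule exI[of _ s]) (rule conjI[OF assms])

lemma pascal_familiesE: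
  assumes "\<gamma> \<in> pascal_families"
  obtains u w a b v s where
    "\<gamma> = assemble (\<lambda>k. a k *s u + b k *s w)
       (\<lambda>i. s i *s cross (cross (a (i mod 3) *s u + b (i mod 3) *s w) (v i))
         (cross (a (Suc i mod 3) *s u + b (Suc i mod 3) *s w) (v (Suc i mod 6))))"
proof -
  obtain p q u w a b v s where \<gamma>: "\<gamma> = assemble p q"
    and p: "\<forall>k<3. p k = a k *s u + b k *s w"
    and q: "\<forall>i<6. q i = s i *s cross (cross (p (i mod 3)) (v i)) (cross (p (Suc i mod 3)) (v (Suc i mod 6)))"
    using assms unfolding pascal_families_def mem_Collect_eq by (elim exE conjE) (rule that)
  have "\<gamma> = assemble (\<lambda>k. a k *s u + b k *s w)
       (\<lambda>i. s i *s cross (cross (a (i mod 3) *s u + b (i mod 3) *s w) (v i))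
         (cross (a (Suc i mod 3) *s u + b (Suc i mod 3) *s w) (v (Suc i mod 6))))"
    unfolding \<gamma> by (rule assemble_cong) (use p q in simp_all)
  then show ?thesis by (rule that)
qed

lemma curve_connected_pascal_families: "curve_connected pascal_families"
  unfolding curve_connected_def
proof (intro ballI)
  fix \<gamma> \<delta> assume "\<gamma> \<in> pascal_families" "\<delta> \<in> pascal_families"
  obtain u w a b v s where g: "\<gamma> = assemble (\<lambda>k. a k *s u + b k *s w)
       (\<lambda>i. s i *s cross (cross (a (i mod 3) *s u + b (i mod 3) *s w) (v i))
         (cross (a (Suc i mod 3) *s u + b (Suc i mod 3) *s w) (v (Suc i mod 6))))"
    using \<open>\<gamma> \<in> pascal_families\<close> by (rule pascal_familiesE)
  obtain u' w' a' b' v' s' where d: "\<delta> = assemble (\<lambda>k. a' k *s u' + b' k *s w')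
       (\<lambda>i. s' i *s cross (cross (a' (i mod 3) *s u' + b' (i mod 3) *s w') (v' i))
         (cross (a' (Suc i mod 3) *s u' + b' (Suc i mod 3) *s w') (v' (Suc i mod 6))))"
    using \<open>\<delta> \<in> pascal_families\<close> by (rule pascal_familiesE)
  define p where "p t k = ((1 - t) * a k + t * a' k) *s ((1 - t) *s u + t *s u') +
      ((1 - t) * b k + t * b' k) *s ((1 - t) *s w + t *s w')" for t :: complex and k
  define V where "V t i = (1 - t) *s v i + t *s v' i" for t i
  define q where "q t i = ((1 - t) * s i + t * s' i) *s
      cross (cross (p t (i mod 3)) (V t i)) (cross (p t (Suc i mod 3)) (V t (Suc i mod 6)))" for t i
  let ?c = "\<lambda>t. assemble (p t) (q t)"
  have "poly_curve ?c" unfolding q_def p_def V_def by (intro poly_intros)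
  moreover have "?c 0 = \<gamma>" "?c 1 = \<delta>"
    unfolding g d by (rule assemble_cong; simp add: q_def p_def V_def del: cross_linear)+
  moreover have "?c t \<in> pascal_families" for t
  proof (rule pascal_familiesI)
    show "\<forall>k<3. p t k = ((1 - t) * a k + t * a' k) *s ((1 - t) *s u + t *s u') +
        ((1 - t) * b k + t * b' k) *s ((1 - t) *s w + t *s w')"
      unfolding p_def by (intro allI impI refl)
    show "\<forall>i<6. q t i = ((1 - t) * s i + t * s' i) *s
        cross (cross (p t (i mod 3)) (V t i)) (cross (p t (Suc i mod 3)) (V t (Suc i mod 6)))"
      unfolding q_def by (intro allI impI refl)
  qed
  ultimately show "\<exists>c. poly_curve c \<and> c 0 = \<gamma> \<and> c 1 = \<delta> \<and> (\<forall>t. c t \<in> pascal_families)"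
    by (intro exI[of _ ?c]) simp
qed

lemma triple_on_line:
  "dot C p = 0 \<Longrightarrow> triple p (s *s cross C D) (s' *s cross E C) = 0"
proof (cases "C = 0")
  case False
  then show "dot C p = 0 \<Longrightarrow> triple p (s *s cross C D) (s' *s cross E C) = 0"
    by (intro triple_eq_0_orthogonal) auto
qed simp

lemma incident_lines:
  assumes "triple (p 0) (p 1) (p 2) = 0"
    and "\<forall>i<6. dot (L i) (p (i mod 3)) = 0 \<and> q i = s i *s cross (L i) (L (Suc i mod 6))"
  shows "incident p q"
  unfolding incident_def
proof (intro conjI allI impI)
  fix i :: nat assume i: "i < 6"
  then have "Suc ((i + 5) mod 6) mod 6 = i" by presburger
  then have "q ((i + 5) mod 6) = s ((i + 5) mod 6) *s cross (L ((i + 5) mod 6)) (L i)"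
    using assms(2) by simp
  then show "triple (p (i mod 3)) (q i) (q ((i + 5) mod 6)) = 0"
    using assms(2) i triple_on_line by metis
qed (rule assms(1))

lemma Suc_mod_6_mod_3: "Suc i mod 6 mod 3 = Suc i mod (3::nat)"
  by (simp add: mod_mod_cancel)

lemma pascal_families_circuit:
  assumes "pascal_configuration M"
  shows "pascal_families \<subseteq> circuit_variety M"
proof
  fix \<gamma> assume "\<gamma> \<in> pascal_families"
  then obtain u w a b v s where g: "\<gamma> = assemble (\<lambda>k. a k *s u + b k *s w)
       (\<lambda>i. s i *s cross (cross (a (i mod 3) *s u + b (i mod 3) *s w) (v i))
         (cross (a (Suc i mod 3) *s u + b (Suc i mod 3) *s w) (v (Suc i mod 6))))"
    by (rule pascal_familiesE)
  show "\<gamma> \<in> circuit_variety M"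
    unfolding g assemble_in_circuit_variety_iff[OF assms]
    by (rule incident_lines[of _ "\<lambda>i. cross (a (i mod 3) *s u + b (i mod 3) *s w) (v i)" _ s])
      (simp_all add: triple_span Suc_mod_6_mod_3 del: cross_linear dot_linear)
qed

text \<open>The vertex \<open>q i\<close> lies on sides \<open>i\<close> and \<open>i + 1\<close>,
  which pass through these two diagonal points. The noncollinearity says that the two sides are
  different lines.\<close>

lemma pascal_realization_independent:
  assumes "pascal_configuration M" "assemble p q \<in> realizations M"
  shows "\<forall>i<6. triple (p (i mod 3)) (q i) (p (Suc i mod 3)) \<noteq> 0"
proof -
  have "triple (assemble p q $ i) (assemble p q $ j) (assemble p q $ k) \<noteq> 0"
    if "{i, j, k} \<notin> pascal_lines" "i \<noteq> j" "i \<noteq> k" "j \<noteq> k" for i j k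
  proof -
    have "card {i, j, k} = 3" using that by simp
    then show ?thesis
      using assms(2) that family_dependent_triple unfolding realizations_pascal_iff[OF assms(1)] by blast
  qed
  from this[of 7 1 8] this[of 8 6 9] this[of 9 2 7] this[of 7 4 8] this[of 8 3 9] this[of 9 5 7]
  show ?thesis
    unfolding all_less_6 by (simp add: pascal_lines_def set_eq_iff forall_9 numeral_2_eq_2)
qed

lemma cross_neq_0_of_dot: "dot A p = 0 \<Longrightarrow> dot B p \<noteq> 0 \<Longrightarrow> A \<noteq> 0 \<Longrightarrow> cross A B \<noteq> 0"
  using parallel_orthogonal by blast

lemma realizations_subset_pascal_families:
  assumes M: "pascal_configuration M"
  shows "realizations M \<subseteq> pascal_families"
proof
  fix \<gamma> assume "\<gamma> \<in> realizations M"
  moreover obtain p q where \<gamma>: "\<gamma> = assemble p q" by (rule assemble_surj)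
  ultimately have R: "assemble p q \<in> realizations M" by simp
  then have inc: "incident p q"
    using realizations_subset_circuit_variety assemble_in_circuit_variety_iff[OF M] by blast
  have ind: "triple (p (i mod 3)) (q i) (p (Suc i mod 3)) \<noteq> 0" if "i < 6" for i
    using pascal_realization_independent[OF M R] that by blast
  have c: "cross (p 0) (p 1) \<noteq> 0"
    using ind[of 0] triple_perm(2)[of "p 0" "p 1" "q 0"] by (auto simp: triple_def)
  then obtain a b where ab: "p 2 = a *s p 0 + b *s p 1"
    using in_span_of_orthogonal[OF c] inc unfolding incident_def triple_def by metis
  \<comment> \<open>In a realization, side \<open>i\<close> is the join of its diagonal point and
    \<open>q i\<close>. It misses the next diagonal point, through which side \<open>i + 1\<close>
    passes, so the two sides meet exactly in \<open>q i\<close>.\<close>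
  define A where "A i = cross (p (i mod 3)) (q i)" for i
  have "\<exists>s. q i = s *s cross (A i) (A (Suc i mod 6))" if i: "i < 6" for i
  proof -
    have S: "Suc i mod 6 < 6" "Suc i mod 6 mod 3 = Suc i mod 3" "(Suc i mod 6 + 5) mod 6 = i"
      using i by (simp_all add: Suc_mod_6_mod_3, presburger)
    have "dot (A (Suc i mod 6)) (p (Suc i mod 3)) = 0" by (simp add: A_def S)
    moreover have "dot (A i) (p (Suc i mod 3)) \<noteq> 0" using ind[OF i] by (simp add: A_def triple_def)
    moreover have "A (Suc i mod 6) \<noteq> 0" using ind[OF S(1)] by (auto simp: A_def triple_def)
    ultimately have nz: "cross (A i) (A (Suc i mod 6)) \<noteq> 0"
      using cross_neq_0_of_dot cross_eq_0_commute by metis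
    have "triple (p (Suc i mod 3)) (q (Suc i mod 6)) (q i) = 0"
      using inc S unfolding incident_def by metis
    then have "dot (A (Suc i mod 6)) (q i) = 0" by (simp add: A_def S triple_def)
    moreover have "dot (A i) (q i) = 0" by (simp add: A_def)
    ultimately show ?thesis using orthogonal_pair_imp_multiple[OF nz] by metis
  qed
  then obtain s where s: "\<forall>i<6. q i = s i *s cross (A i) (A (Suc i mod 6))" by metis
  show "\<gamma> \<in> pascal_families"
    unfolding \<gamma>
  proof (rule pascal_familiesI)
    show "\<forall>k<3. p k = (if k = 0 then 1 else if k = 1 then 0 else a) *s p 0 +
        (if k = 0 then 0 else if k = 1 then 1 else b) *s p 1"
      unfolding all_less_3 using ab by simp
    show "\<forall>i<6. q i = s i *s cross (cross (p (i mod 3)) (q i)) (cross (p (Suc i mod 3)) (q (Suc i mod 6)))"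
      using s by (simp add: A_def Suc_mod_6_mod_3)
  qed
qed

lemma pascal_families_subset_variety:
  assumes "pascal_configuration M"
  shows "pascal_families \<subseteq> matroid_variety M"
  using curve_connected_subset_matroid_variety[OF curve_connected_pascal_families
      pascal_families_circuit[OF assms]]
    pascal_realization_exists[OF assms] realizations_subset_pascal_families[OF assms] by blast

lemma pascal_variety_irreducible:
  assumes "pascal_configuration M"
  shows "zariski_irreducible (matroid_variety M)"
  using curve_connected_irreducible[OF curve_connected_pascal_families
      pascal_families_subset_variety[OF assms] realizations_subset_pascal_families[OF assms]
      pascal_realization_exists[OF assms]] .

lemma plane_span:
  assumes "m \<noteq> 0" "\<forall>k<3. dot m (p k) = (0::complex)"
  obtains u w a b where "\<forall>k<3. p (k::nat) = a k *s u + b k *s w"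
proof -
  obtain u w where m: "m = cross u w" using obtain_plane_basis[OF assms(1)] .
  have "\<exists>a b. k < 3 \<longrightarrow> p k = a *s u + b *s w" for k
    using in_span_of_orthogonal[of u w "p k"] assms m by metis
  then show ?thesis using that by metis
qed

text \<open>Deformations produce moving sides, and this turns them into parameters. Only a nonzero
  diagonal point lets each line through it be written as a cross product with it.\<close>

lemma lines_in_pascal_families:
  assumes tr: "triple (p 0) (p 1) (p 2) = 0" and nz: "\<forall>k<3. p k \<noteq> 0"
    and L: "\<forall>i<6. dot (L i) (p (i mod 3)) = 0"
    and q: "\<forall>i<6. q i = s i *s cross (L i) (L (Suc i mod 6))"
  shows "assemble p q \<in> pascal_families"
proof -
  obtain m where m: "m \<noteq> 0" "dot m (p 0) = 0" "dot m (p 1) = 0" "dot m (p 2) = 0"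
    using obtain_common_orthogonal[OF tr] .
  then obtain u w a b where ab: "\<forall>k<3. p k = a k *s u + b k *s w"
    using plane_span[of m p] unfolding all_less_3 by metis
  have "\<exists>v. L i = cross (p (i mod 3)) v" if "i < 6" for i
    using orthogonal_imp_cross[of "p (i mod 3)" "L i"] nz L that
    by (metis dot_commute mod_less_divisor zero_less_numeral)
  then obtain v where v: "\<forall>i<6. L i = cross (p (i mod 3)) (v i)" by metis
  show ?thesis
  proof (rule pascal_familiesI[OF ab])
    show "\<forall>i<6. q i = s i *s cross (cross (p (i mod 3)) (v i)) (cross (p (Suc i mod 3)) (v (Suc i mod 6)))"
      using q v by (simp add: Suc_mod_6_mod_3)
  qed
qed

section \<open>Deforming hexagons with distinct diagonal points\<close>

lemma assemble_limit:
  assumes X: "zariski_closed X"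
    and p: "\<And>k. k < 3 \<Longrightarrow> poly_vec (\<lambda>t. P t k)" "\<And>k. k < 3 \<Longrightarrow> P 0 k = p k"
    and q: "\<And>i. i < 6 \<Longrightarrow> poly_vec (\<lambda>t. Q t i)" "\<And>i. i < 6 \<Longrightarrow> Q 0 i = q i"
    and gen: "\<forall>\<^sub>F t in cofinite. assemble (P t) (Q t) \<in> X"
  shows "assemble p q \<in> X"
proof -
  have "assemble (P 0) (Q 0) \<in> X"
    by (rule zariski_closed_curve_limit[OF X _ gen]) (intro poly_intros p(1) q(1))
  moreover have "assemble (P 0) (Q 0) = assemble p q" by (intro assemble_cong p(2) q(2))
  ultimately show ?thesis by simp
qed

lemma generically_not_in_closed:
  assumes "zariski_closed X" "poly_curve c" "c s \<notin> X"
  shows "\<forall>\<^sub>F t in cofinite. c t \<notin> X"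
proof -
  obtain f where f: "f \<in> polyfuns" "f (c s) \<noteq> 0" "\<And>\<delta>. \<delta> \<in> X \<Longrightarrow> f \<delta> = 0"
    by (rule zariski_closed_separate[OF assms(1,3)]) (rule that)
  have "\<forall>\<^sub>F t in cofinite. f (c t) \<noteq> 0"
    by (rule poly_fun_generically_nonzero[OF poly_fun_polyfuns[OF f(1) assms(2)] f(2)])
  then show ?thesis by (rule eventually_mono) (use f(3) in blast)
qed

lemma zariski_closed_plane_families: "zariski_closed (plane_families :: (complex ^ 3 ^ 9) set)"
proof -
  have "matroid_variety (uniform_matroid 2) = (plane_families :: (complex ^ 3 ^ 9) set)"
    by (rule uniform_2_variety) simp
  then show ?thesis using zariski_closed_matroid_variety by metis
qed

text \<open>\<open>L\<close> chooses a genuine line for every side, also where the points on it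
  coincide or vanish and do not determine one.\<close>

definition supports :: "(nat \<Rightarrow> complex ^ 3) \<Rightarrow> (nat \<Rightarrow> complex ^ 3) \<Rightarrow> (nat \<Rightarrow> complex ^ 3) \<Rightarrow> bool" where
  "supports L p q \<longleftrightarrow> (\<forall>i<6. L i \<noteq> 0 \<and> dot (L i) (p (i mod 3)) = 0 \<and>
     dot (L i) (q i) = 0 \<and> dot (L i) (q ((i + 5) mod 6)) = 0)"

lemma incident_imp_supports:
  assumes "incident p q"
  obtains L where "supports L p q"
proof -
  have "\<exists>m. m \<noteq> 0 \<and> dot m (p (i mod 3)) = 0 \<and> dot m (q i) = 0 \<and> dot m (q ((i + 5) mod 6)) = 0"
    if "i < 6" for i
  proof -
    have "triple (p (i mod 3)) (q i) (q ((i + 5) mod 6)) = 0"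
      using assms that unfolding incident_def by blast
    then show ?thesis by (rule obtain_common_orthogonal) blast
  qed
  then obtain L where "\<forall>i<6. L i \<noteq> 0 \<and> dot (L i) (p (i mod 3)) = 0 \<and> dot (L i) (q i) = 0 \<and>
      dot (L i) (q ((i + 5) mod 6)) = 0" by metis
  then show ?thesis using that unfolding supports_def by blast
qed

lemma plane_families_assembleI:
  assumes "m \<noteq> 0" "\<And>k. k < 3 \<Longrightarrow> dot m (p k) = 0" "\<And>i. i < 6 \<Longrightarrow> dot m (q i) = 0"
  shows "assemble p q \<in> plane_families"
proof (rule plane_familiesI[OF assms(1)])
  show "dot m (assemble p q $ i) = 0" for i
    using assms(2,3) all_assemble[of "\<lambda>v. dot m v = 0" p q] by blast
qed

text \<open>On a full cycle the prescribed ratios would need product one. Omitting the ratio at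
  \<open>z\<close> opens the cycle to a path, where partial products solve the recursion.\<close>

lemma cyclic_ratios:
  fixes r :: "nat \<Rightarrow> complex"
  assumes "z < 6" "\<forall>i<6. r i \<noteq> 0"
  obtains a where "\<forall>i<6. a i \<noteq> 0" "\<forall>i<6. i \<noteq> z \<longrightarrow> a (Suc i mod 6) = r i * a i"
proof -
  define b where "b n = (\<Prod>k<n. r ((z + 1 + k) mod 6))" for n
  \<comment> \<open>\<open>(j + 5 - z) mod 6\<close> counts the steps from the start
    \<open>z + 1\<close> of the path to \<open>j\<close>; the subtraction is not truncated because
    \<open>z < 6\<close>.\<close>
  define a where "a j = b ((j + 5 - z) mod 6)" for j
  have "a i \<noteq> 0" for i using assms(2) by (auto simp: a_def b_def)
  moreover have "a (Suc i mod 6) = r i * a i" if i: "i < 6" "i \<noteq> z" for i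
  proof -
    have "\<forall>z<6. \<forall>i<6. i \<noteq> z \<longrightarrow> (Suc i mod 6 + 5 - z) mod 6 = Suc ((i + 5 - z) mod 6) \<and>
        (z + 1 + (i + 5 - z) mod 6) mod 6 = i"
      unfolding all_less_6 by simp
    then have "(Suc i mod 6 + 5 - z) mod 6 = Suc ((i + 5 - z) mod 6)"
      "(z + 1 + (i + 5 - z) mod 6) mod 6 = i"
      using i assms(1) by blast+
    then show ?thesis by (simp add: a_def b_def)
  qed
  ultimately show ?thesis using that by blast
qed

lemma pred_mod_6: "i < 6 \<Longrightarrow> Suc ((i + 5) mod 6) mod 6 = (i::nat)"
  by presburger

lemma succ_mod_6: "i < 6 \<Longrightarrow> (Suc i mod 6 + 5) mod 6 = (i::nat)"
  by presburger

text \<open>The sides lying on the line \<open>m\<close> of the diagonal points are rotated off it at speeds \<open>a i\<close>; the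
  ratio of the speeds of two consecutive such sides fixes the limit of their intersection on \<open>m\<close>.\<close>

lemma hexagon_rotate:
  assumes X: "zariski_closed X" "pascal_families \<subseteq> X"
    and p: "\<forall>k<3. p k \<noteq> 0 \<and> dot m (p k) = 0" "m \<noteq> 0"
    and ind: "\<forall>i<6. cross (p (i mod 3)) (p (Suc i mod 3)) \<noteq> 0"
    and L: "supports L p q" and norm: "\<forall>i<6. cross m (L i) = 0 \<longrightarrow> L i = m"
    and z: "z < 6" "L z \<noteq> m"
    and xy: "\<forall>i<6. L i = m \<and> L (Suc i mod 6) = m \<longrightarrow>
      x i \<noteq> 0 \<and> y i \<noteq> 0 \<and> q i = x i *s p (i mod 3) + y i *s p (Suc i mod 3)"
  shows "assemble p q \<in> X"
proof -
  \<comment> \<open>At these vertices both sides lie on the diagonal line, so their meet does not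
    determine the vertex.\<close>
  define B where "B i \<longleftrightarrow> L i = m \<and> L (Suc i mod 6) = m" for i
  \<comment> \<open>To first order, the sides \<open>m + (t * a i) *s \<alpha> i\<close> meet in the
    direction \<open>a (i + 1) *s p (i + 1) - a i *s p i\<close>. Proportionality to
    \<open>x i *s p i + y i *s p (i + 1)\<close> forces the speed ratio
    \<open>- y i / x i\<close>.\<close>
  define r where "r i = (if B i then - y i / x i else 1)" for i
  have "\<forall>i<6. r i \<noteq> 0" using xy by (auto simp: r_def B_def)
  then obtain a where a: "\<forall>i<6. a i \<noteq> 0" "\<forall>i<6. i \<noteq> z \<longrightarrow> a (Suc i mod 6) = r i * a i"
    using cyclic_ratios[OF z(1)] by metis
  obtain n where n: "dot m n = 1" using obtain_dot_1[OF p(2)] .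
  \<comment> \<open>Since \<open>dot m n = 1\<close> and \<open>p\<close> is orthogonal to
    \<open>m\<close>, this choice gives \<open>cross m (\<alpha> i) = p (i mod 3)\<close>. As
    \<open>\<alpha> i\<close> is orthogonal to \<open>p (i mod 3)\<close>, the rotated side still
    passes through that point.\<close>
  define \<alpha> where "\<alpha> i = cross (p (i mod 3)) n" for i :: nat
  have m\<alpha>: "cross m (\<alpha> i) = p (i mod 3)" "cross (\<alpha> i) m = - p (i mod 3)" if "i < 6" for i
  proof -
    show "cross m (\<alpha> i) = p (i mod 3)" using p(1) n by (simp add: \<alpha>_def cross_cross_right)
    then show "cross (\<alpha> i) m = - p (i mod 3)" using cross_skew by metis
  qed
  have S: "Suc i mod 6 < 6" "p (Suc i mod 6 mod 3) = p (Suc i mod 3)" for i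
    by (simp_all add: Suc_mod_6_mod_3)
  have "\<exists>s. q i = s *s cross (L i) (L (Suc i mod 6))" if i: "i < 6" "\<not> B i" for i
  proof -
    have Li: "L i \<noteq> 0" "dot (L i) (p (i mod 3)) = 0" "dot (L i) (q i) = 0"
      using L i unfolding supports_def by blast+
    have LS: "L (Suc i mod 6) \<noteq> 0" "dot (L (Suc i mod 6)) (p (Suc i mod 3)) = 0"
      "dot (L (Suc i mod 6)) (q i) = 0"
      using L[unfolded supports_def, rule_format, OF S(1)[of i]] S(2)[of i] succ_mod_6[OF i(1)]
      by simp_all
    \<comment> \<open>If the sides coincided, they would contain two distinct diagonal points and
      hence be the diagonal line; by the normalization both would equal \<open>m\<close>.\<close>
    have "cross (L i) (L (Suc i mod 6)) \<noteq> 0"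
    proof
      assume par: "cross (L i) (L (Suc i mod 6)) = 0"
      have "dot (L i) (p (Suc i mod 3)) = 0"
        using parallel_orthogonal[OF LS(1) _ LS(2)] par cross_eq_0_commute by blast
      then have 1: "cross m (L i) = 0"
        using orthogonal_pair_parallel[OF ind[rule_format, OF i(1)]] p(1) Li by simp
      then have "cross m (L (Suc i mod 6)) = 0" using parallel_trans[OF Li(1)] par by blast
      with 1 show False using norm i S(1) unfolding B_def by blast
    qed
    then show ?thesis using orthogonal_pair_imp_multiple Li(3) LS(3) by metis
  qed
  then obtain s where s: "\<And>i. i < 6 \<Longrightarrow> \<not> B i \<Longrightarrow> q i = s i *s cross (L i) (L (Suc i mod 6))" by metis
  define l where "l t i = L i + (if L i = m then t * a i else 0) *s \<alpha> i" for t i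
  \<comment> \<open>In the first branch the common factor \<open>t\<close> of the meet has been
    cancelled, so the formula is polynomial and still meaningful at \<open>t = 0\<close>; the factor
    \<open>- x i / a i\<close> makes it equal to \<open>q i\<close> there.\<close>
  define Q where "Q t i = (if B i then (- x i / a i) *s (a (Suc i mod 6) *s p (Suc i mod 3) - a i *s p (i mod 3) +
      (t * a i * a (Suc i mod 6)) *s cross (\<alpha> i) (\<alpha> (Suc i mod 6)))
    else s i *s cross (l t i) (l t (Suc i mod 6)))" for t i
  show ?thesis
  proof (rule assemble_limit[OF X(1), of "\<lambda>t. p" _ Q])
    show "poly_vec (\<lambda>t. Q t i)" for i
      unfolding Q_def l_def by (intro poly_intros)
  next
    fix i :: nat assume i: "i < 6"
    show "Q 0 i = q i"
    proof (cases "B i")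
      case True
      then have "i \<noteq> z" using z by (auto simp: B_def)
      then have "a (Suc i mod 6) = (- y i / x i) * a i" using a(2) i True by (simp add: r_def)
      then show ?thesis
        using xy[rule_format, OF i] True a(1) i by (simp add: Q_def B_def vec3_eq_iff field_simps)
    qed (simp add: Q_def l_def s i)
  next
    show "\<forall>\<^sub>F t in cofinite. assemble p (Q t) \<in> X"
    proof (rule eventually_mono[OF generically_neq[of 0]])
      fix t :: complex assume t: "t \<noteq> 0"
      have "assemble p (Q t) \<in> pascal_families"
      proof (rule lines_in_pascal_families)
        show "\<forall>i<6. Q t i = (if B i then - x i / a i / t else s i) *s cross (l t i) (l t (Suc i mod 6))"
        proof (intro allI impI)
          fix i :: nat assume i: "i < 6"
          show "Q t i = (if B i then - x i / a i / t else s i) *s cross (l t i) (l t (Suc i mod 6))"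
          proof (cases "B i")
            case True
            then have "l t i = m + (t * a i) *s \<alpha> i"
              "l t (Suc i mod 6) = m + (t * a (Suc i mod 6)) *s \<alpha> (Suc i mod 6)"
              by (simp_all add: l_def B_def)
            then have "cross (l t i) (l t (Suc i mod 6)) = t *s (a (Suc i mod 6) *s p (Suc i mod 3) -
                a i *s p (i mod 3) + (t * a i * a (Suc i mod 6)) *s cross (\<alpha> i) (\<alpha> (Suc i mod 6)))"
              by (simp add: m\<alpha>[OF i] m\<alpha>[OF S(1)] S(2))
            then show ?thesis using True t by (simp add: Q_def)
          qed (simp add: Q_def)
        qed
        show "\<forall>i<6. dot (l t i) (p (i mod 3)) = 0"
          using L by (simp add: l_def supports_def \<alpha>_def)
        show "triple (p 0) (p 1) (p 2) = 0" using triple_eq_0_orthogonal[OF p(2)] p(1) by simp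
      qed (use p(1) in simp)
      then show "assemble p (Q t) \<in> X" using X(2) by blast
    qed
  qed (simp_all add: poly_intros)
qed

text \<open>Prepares the rotation. Some side is off the diagonal line, as otherwise the family would
  be planar, and a small perturbation makes the coefficients of the vertices between two sides on
  \<open>m\<close> nonzero.\<close>

lemma hexagon_distinct_diagonal_points:
  assumes X: "zariski_closed X" "pascal_families \<subseteq> X"
    and inc: "incident p q" and ind: "\<forall>k<3. cross (p k) (p (Suc k mod 3)) \<noteq> 0"
    and nonplanar: "assemble p q \<notin> plane_families"
  shows "assemble p q \<in> X"
proof -
  have ind6: "\<forall>i<6. cross (p (i mod 3)) (p (Suc i mod 3)) \<noteq> 0"
    using ind by (metis mod_Suc_eq mod_less_divisor zero_less_numeral)
  obtain m where m: "m \<noteq> 0" and "dot m (p 0) = 0" "dot m (p 1) = 0" "dot m (p 2) = 0"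
    using inc obtain_common_orthogonal unfolding incident_def by metis
  then have mp: "\<forall>k<3. p k \<noteq> 0 \<and> dot m (p k) = 0"
    using ind unfolding all_less_3 by auto
  obtain K where K: "supports K p q" using incident_imp_supports[OF inc] .
  \<comment> \<open>Sides on the diagonal line are rescaled to be literally \<open>m\<close>, so
    that being on it becomes an equality.\<close>
  define L where "L i = (if cross m (K i) = 0 then m else K i)" for i
  have L: "supports L p q"
  proof -
    have "dot m v = 0" if "cross m (K i) = 0" "dot (K i) v = 0" "i < 6" for i v
      using parallel_orthogonal[of "K i" m v] that K cross_eq_0_commute unfolding supports_def by blast
    then show ?thesis using K m unfolding supports_def L_def by auto
  qed
  have norm: "\<forall>i<6. cross m (L i) = 0 \<longrightarrow> L i = m" by (simp add: L_def)
  obtain z where z: "z < 6" "L z \<noteq> m"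
  proof -
    have "\<exists>z<6. L z \<noteq> m"
    proof (rule ccontr)
      assume "\<not> ?thesis"
      then have "dot m (q i) = 0" if "i < 6" for i using L that unfolding supports_def by metis
      then show False using nonplanar plane_families_assembleI[OF m] mp by blast
    qed
    then show ?thesis using that by blast
  qed
  define B where "B i \<longleftrightarrow> L i = m \<and> L (Suc i mod 6) = m" for i
  have "\<exists>x y. q i = x *s p (i mod 3) + y *s p (Suc i mod 3)" if i: "i < 6" "B i" for i
  proof -
    have "dot m (q i) = 0" using L i unfolding supports_def B_def by metis
    then have "triple (p (i mod 3)) (p (Suc i mod 3)) (q i) = 0"
      using mp by (intro triple_eq_0_orthogonal[OF m]) simp_all
    then show ?thesis
      using in_span_of_orthogonal[OF ind6[rule_format, OF i(1)]] unfolding triple_def by metis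
  qed
  then obtain x y where xy: "\<And>i. i < 6 \<Longrightarrow> B i \<Longrightarrow> q i = x i *s p (i mod 3) + y i *s p (Suc i mod 3)"
    by metis
  \<comment> \<open>Both coefficients grow by \<open>t\<close>, hence are nonzero for general
    \<open>t\<close>. Only vertices between two sides equal to \<open>m\<close> move, and they move
    along \<open>m\<close>, so the supports remain valid.\<close>
  define Q where "Q t i = (if B i then q i + t *s (p (i mod 3) + p (Suc i mod 3)) else q i)" for t i
  show ?thesis
  proof (rule assemble_limit[OF X(1), of "\<lambda>t. p" _ Q])
    show "poly_vec (\<lambda>t. Q t i)" for i unfolding Q_def by (intro poly_intros)
    show "Q 0 i = q i" for i by (simp add: Q_def)
    have "\<forall>\<^sub>F t in cofinite. x i + t \<noteq> 0 \<and> y i + t \<noteq> 0" for i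
      using eventually_conj[OF generically_neq[of "- x i"] generically_neq[of "- y i"]]
      by (rule eventually_mono) (auto simp: add_eq_0_iff)
    then have "\<forall>\<^sub>F t in cofinite. \<forall>i\<in>{..<6}. x i + t \<noteq> 0 \<and> y i + t \<noteq> 0"
      by (intro eventually_ball_finite) auto
    then show "\<forall>\<^sub>F t in cofinite. assemble p (Q t) \<in> X"
    proof (rule eventually_mono)
      fix t assume t: "\<forall>i\<in>{..<6}. x i + t \<noteq> 0 \<and> y i + t \<noteq> 0"
      show "assemble p (Q t) \<in> X"
      proof (rule hexagon_rotate[OF X mp m ind6 _ norm z])
        have "dot (L i) (Q t i) = 0" "dot (L i) (Q t ((i + 5) mod 6)) = 0" if "i < 6" for i
          using L mp that pred_mod_6[OF that] unfolding supports_def Q_def B_def by auto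
        then show "supports L p (Q t)" using L unfolding supports_def by blast
        show "\<forall>i<6. L i = m \<and> L (Suc i mod 6) = m \<longrightarrow> x i + t \<noteq> 0 \<and> y i + t \<noteq> 0 \<and>
            Q t i = (x i + t) *s p (i mod 3) + (y i + t) *s p (Suc i mod 3)"
          using t xy by (auto simp: Q_def B_def vec_eq_iff algebra_simps)
      qed
    qed
  qed (simp_all add: poly_intros)
qed

section \<open>Moving a diagonal point\<close>

text \<open>\<open>C\<close> is the side through the moving diagonal point \<open>r\<close>; its
  ends \<open>x\<close> and \<open>y\<close> must stay on the neighbouring sides \<open>B\<close>
  and \<open>A\<close>. Here \<open>B\<close> is the same line as \<open>C\<close>, while
  \<open>A\<close> crosses it and therefore determines \<open>y\<close>.\<close>

lemma line_lift_one_sided: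
  assumes C: "C \<noteq> 0" "dot C r = 0" "dot C x = 0" "dot C y = 0" and r: "r \<noteq> 0"
    and B: "cross C B = 0" "dot B x = 0" and A: "dot A y = 0" "cross C A \<noteq> 0"
  shows "\<exists>f g. poly_vec f \<and> poly_vec g \<and> f 0 = x \<and> g 0 = y \<and>
    (\<forall>t. dot B (f t) = 0 \<and> dot A (g t) = 0 \<and> triple (r + t\<^sup>2 *s w) (f t) (g t) = 0)"
proof -
  obtain s where y: "y = s *s cross C A" using orthogonal_pair_imp_multiple[OF A(2) C(4) A(1)] .
  have CB: "dot B v = 0" if "dot C v = 0" for v using parallel_orthogonal[OF C(1) B(1) that] .
  show ?thesis
  proof (cases "cross r x = 0")
    case False
    have "dot r C = 0" "dot x C = 0" using C dot_commute by metis+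
    then obtain \<kappa> where \<kappa>: "C = \<kappa> *s cross r x" using orthogonal_pair_imp_multiple[OF False] by metis
    \<comment> \<open>As \<open>x\<close> is not parallel to \<open>r\<close>, the side can be
      turned about the fixed \<open>x\<close>, and \<open>y\<close> follows as its meet with
      \<open>A\<close>.\<close>
    let ?g = "\<lambda>t. (s * \<kappa>) *s cross (cross (r + t\<^sup>2 *s w) x) A"
    have "poly_vec ?g" by (intro poly_intros)
    moreover have "?g 0 = y" by (simp add: y \<kappa> del: cross_nth)
    moreover have "triple (r + t\<^sup>2 *s w) x (?g t) = 0" for t
      unfolding triple_def dot_linear(7) dot_cross_self by simp
    moreover have "dot A (?g t) = 0" for t unfolding dot_linear(7) dot_cross_self by simp
    ultimately show ?thesis
      using B(2) by (intro exI[of _ "\<lambda>t. x"] exI[of _ ?g]) (simp add: poly_intros)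
  next
    case True
    then obtain c where x: "x = c *s r" using parallel_imp_multiple[OF r] by metis
    obtain v where v: "C = cross r v" using orthogonal_imp_cross[OF r] C(2) dot_commute by metis
    \<comment> \<open>With \<open>x = c *s r\<close>, shifting \<open>x\<close> along
      \<open>C\<close> by \<open>t *s v\<close> makes the join of the moved points divisible by
      \<open>t\<close>, and the quotient is \<open>C\<close> at \<open>t = 0\<close>. A motion of
      \<open>r\<close> linear in \<open>t\<close> would leave the extra term
      \<open>c *s cross w r\<close> in that limit.\<close>
    define D where "D t = C + (t * c) *s cross w r + t\<^sup>2 *s cross w v" for t
    have D: "cross (r + t\<^sup>2 *s w) (x + t *s v) = t *s D t" for t
      unfolding D_def x v by (simp add: vec3_eq_iff algebra_simps power2_eq_square)
    let ?f = "\<lambda>t. x + t *s v" and ?g = "\<lambda>t. s *s cross (D t) A"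
    have "poly_vec ?f" "poly_vec ?g" unfolding D_def by (intro poly_intros)+
    moreover have "?g 0 = y" by (simp add: D_def y)
    moreover have "dot B (?f t) = 0" for t using CB C(3) by (simp add: v)
    moreover have "triple (r + t\<^sup>2 *s w) (?f t) (?g t) = 0" for t
      unfolding triple_def D by simp
    moreover have "dot A (?g t) = 0" for t by simp
    ultimately show ?thesis by (intro exI[of _ ?f] exI[of _ ?g]) simp
  qed
qed

text \<open>The cases record which neighbours are the same line as \<open>C\<close>. If both are,
  the ends stay where they are, and \<open>r\<close> may only move along \<open>C\<close>; this is
  the sole restriction on \<open>w\<close>.\<close>

lemma line_lift:
  assumes C: "C \<noteq> 0" "dot C r = 0" "dot C x = 0" "dot C y = 0" and r: "r \<noteq> 0"
    and B: "dot B x = 0" and A: "dot A y = 0"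
    and w: "cross C B = 0 \<Longrightarrow> cross C A = 0 \<Longrightarrow> dot C w = 0"
  shows "\<exists>f g. poly_vec f \<and> poly_vec g \<and> f 0 = x \<and> g 0 = y \<and>
    (\<forall>t. dot B (f t) = 0 \<and> dot A (g t) = 0 \<and> triple (r + t\<^sup>2 *s w) (f t) (g t) = 0)"
proof -
  consider "cross C B = 0" "cross C A = 0" | "cross C B = 0" "cross C A \<noteq> 0"
    | "cross C B \<noteq> 0" "cross C A = 0" | "cross C B \<noteq> 0" "cross C A \<noteq> 0" by blast
  then show ?thesis
  proof cases
    case 1
    then have "triple (r + t\<^sup>2 *s w) x y = 0" for t
      using C w by (intro triple_eq_0_orthogonal[OF C(1)]) simp_all
    then show ?thesis
      using B A by (intro exI[of _ "\<lambda>t. x"] exI[of _ "\<lambda>t. y"]) (simp add: poly_intros)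
  next
    case 2
    show ?thesis by (rule line_lift_one_sided[OF C r 2(1) B A 2(2)])
  next
    case 3
    obtain g f where gf: "poly_vec g" "poly_vec f" "g 0 = y" "f 0 = x"
      "\<forall>t. dot A (g t) = 0 \<and> dot B (f t) = 0 \<and> triple (r + t\<^sup>2 *s w) (g t) (f t) = 0"
      using line_lift_one_sided[OF C(1,2,4,3) r 3(2) A B 3(1), of w] by (elim exE conjE) (rule that)
    have "triple (r + t\<^sup>2 *s w) (f t) (g t) = 0" for t
      using gf(5) triple_perm(2)[of "r + t\<^sup>2 *s w" "g t" "f t"] by simp
    then show ?thesis using gf by (intro exI[of _ f] exI[of _ g]) simp
  next
    case 4
    obtain a where a: "x = a *s cross C B" using orthogonal_pair_imp_multiple[OF 4(1) C(3) B] .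
    obtain b where b: "y = b *s cross C A" using orthogonal_pair_imp_multiple[OF 4(2) C(4) A] .
    obtain v where v: "C = cross r v" using orthogonal_imp_cross[OF r] C(2) dot_commute by metis
    \<comment> \<open>Both ends are determined by crossing neighbours, so the side turns freely:
      \<open>v\<close> stays fixed, and the ends are recomputed as meets with \<open>B\<close> and
      \<open>A\<close>.\<close>
    define D where "D t = cross (r + t\<^sup>2 *s w) v" for t
    let ?f = "\<lambda>t. a *s cross (D t) B" and ?g = "\<lambda>t. b *s cross (D t) A"
    have "poly_vec ?f" "poly_vec ?g" unfolding D_def by (intro poly_intros)+
    moreover have "?f 0 = x" "?g 0 = y" by (simp_all add: D_def a b v)
    moreover have "triple (r + t\<^sup>2 *s w) (?f t) (?g t) = 0" for t
    proof (cases "D t = 0")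
      case False
      moreover have "dot (D t) (r + t\<^sup>2 *s w) = 0" unfolding D_def by (rule dot_cross_self)
      ultimately show ?thesis by (intro triple_eq_0_orthogonal[of "D t"]) simp_all
    qed simp
    moreover have "dot B (?f t) = 0 \<and> dot A (?g t) = 0" for t by simp
    ultimately show ?thesis by (intro exI[of _ ?f] exI[of _ ?g]) simp
  qed
qed

text \<open>Collects the restriction from \<open>line_lift\<close> for the two sides through
  diagonal point \<open>k\<close>: a side that is the same line as both neighbours must contain the
  direction \<open>w\<close>.\<close>

definition unobstructed :: "(nat \<Rightarrow> complex ^ 3) \<Rightarrow> nat \<Rightarrow> complex ^ 3 \<Rightarrow> bool" where
  "unobstructed L k w \<longleftrightarrow> (\<forall>i<6. i mod 3 = k \<longrightarrow> cross (L i) (L ((i + 5) mod 6)) = 0 \<longrightarrow>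
     cross (L i) (L (Suc i mod 6)) = 0 \<longrightarrow> dot (L i) w = 0)"

text \<open>The square in \<open>t\<^sup>2 *s w\<close> leaves room for a first-order perturbation of a vertex that coincides
  with the moving diagonal point.\<close>

lemma move_diagonal_point:
  assumes k: "k < 3" "p k \<noteq> 0" and L: "supports L p q" and w: "unobstructed L k w"
    and tr: "\<And>t. triple ((p(k := p k + t\<^sup>2 *s w)) 0) ((p(k := p k + t\<^sup>2 *s w)) 1)
      ((p(k := p k + t\<^sup>2 *s w)) 2) = 0"
  shows "\<exists>Q. (\<forall>i. poly_vec (\<lambda>t. Q t i)) \<and> Q 0 = q \<and> (\<forall>t. incident (p(k := p k + t\<^sup>2 *s w)) (Q t))"
proof -
  have "\<exists>f g. poly_vec f \<and> poly_vec g \<and> f 0 = q ((i + 5) mod 6) \<and> g 0 = q i \<and>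
      (\<forall>t. dot (L ((i + 5) mod 6)) (f t) = 0 \<and> dot (L (Suc i mod 6)) (g t) = 0 \<and>
        triple (p k + t\<^sup>2 *s w) (f t) (g t) = 0)" if i: "i < 6" "i mod 3 = k" for i
  proof (rule line_lift)
    show "L i \<noteq> 0" "dot (L i) (p k) = 0" "dot (L i) (q ((i + 5) mod 6)) = 0" "dot (L i) (q i) = 0"
      using L i unfolding supports_def by blast+
    show "dot (L ((i + 5) mod 6)) (q ((i + 5) mod 6)) = 0" using L unfolding supports_def by simp
    show "dot (L (Suc i mod 6)) (q i) = 0"
      using L[unfolded supports_def, rule_format, of "Suc i mod 6"] succ_mod_6[OF i(1)] by simp
    show "dot (L i) w = 0" if "cross (L i) (L ((i + 5) mod 6)) = 0" "cross (L i) (L (Suc i mod 6)) = 0"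
      using w that i unfolding unobstructed_def by blast
  qed (rule k)
  then have "\<forall>i. \<exists>f g. i < 6 \<and> i mod 3 = k \<longrightarrow> poly_vec f \<and> poly_vec g \<and> f 0 = q ((i + 5) mod 6) \<and> g 0 = q i \<and>
      (\<forall>t. dot (L ((i + 5) mod 6)) (f t) = 0 \<and> dot (L (Suc i mod 6)) (g t) = 0 \<and>
        triple (p k + t\<^sup>2 *s w) (f t) (g t) = 0)" by blast
  then obtain f g where fg: "\<And>i. i < 6 \<Longrightarrow> i mod 3 = k \<Longrightarrow>
      poly_vec (f i) \<and> poly_vec (g i) \<and> f i 0 = q ((i + 5) mod 6) \<and> g i 0 = q i \<and>
      (\<forall>t. dot (L ((i + 5) mod 6)) (f i t) = 0 \<and> dot (L (Suc i mod 6)) (g i t) = 0 \<and>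
        triple (p k + t\<^sup>2 *s w) (f i t) (g i t) = 0)" by metis
  \<comment> \<open>The two sides through point \<open>k\<close> are opposite and share no vertex,
    so their lifts are independent: \<open>g j\<close> moves the end of side \<open>j\<close>,
    \<open>f (j + 1)\<close> the start of side \<open>j + 1\<close>, and the other two vertices
    stay.\<close>
  define Q where "Q t j = (if j < 6 then if j mod 3 = k then g j t
    else if Suc j mod 3 = k then f (Suc j mod 6) t else q j else q j)" for t j
  have S: "Suc j mod 6 < 6" "Suc j mod 6 mod 3 = Suc j mod 3" for j
    by (simp_all add: Suc_mod_6_mod_3)
  have "poly_vec (\<lambda>t. Q t j)" for j
  proof -
    have "poly_vec (g j)" if "j < 6" "j mod 3 = k" using fg[OF that] by blast
    moreover have "poly_vec (f (Suc j mod 6))" if "Suc j mod 3 = k"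
      using fg[OF S(1)[of j]] S(2)[of j] that by simp
    ultimately show ?thesis unfolding Q_def by (intro poly_intros)
  qed
  moreover have "Q 0 j = q j" for j
  proof -
    have "g j 0 = q j" if "j < 6" "j mod 3 = k" using fg[OF that] by blast
    moreover have "f (Suc j mod 6) 0 = q j" if "j < 6" "Suc j mod 3 = k"
      using fg[OF S(1)[of j]] S(2)[of j] that succ_mod_6[of j] by simp
    ultimately show ?thesis by (simp add: Q_def)
  qed
  moreover have "incident (p(k := p k + t\<^sup>2 *s w)) (Q t)" for t
    unfolding incident_def
  proof (intro conjI allI impI tr)
    fix i :: nat assume i: "i < 6"
    define j where "j = (i + 5) mod 6"
    have j: "j < 6" "Suc j mod 6 = i" using pred_mod_6[OF i] by (simp_all add: j_def)
    then have j3: "Suc j mod 3 = i mod 3" "Suc (Suc j) mod 3 = Suc i mod 3"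
      using Suc_mod_6_mod_3[of j] by (auto simp: mod_Suc)
    have cyc: "n mod 3 = l \<or> Suc n mod 3 = l \<or> Suc (Suc n) mod 3 = l"
      "n mod 3 \<noteq> Suc n mod 3" "n mod 3 \<noteq> Suc (Suc n) mod 3" if "l < 3" for n l :: nat
      using that mod_less_divisor[of 3 n] by (auto simp: mod_Suc)
    \<comment> \<open>Either side \<open>i\<close> is one of the moving sides, or the side before or
      after it moves. In the latter cases the shared vertex slides along \<open>L i\<close>, which
      therefore still supports side \<open>i\<close>.\<close>
    consider "i mod 3 = k" | "j mod 3 = k" | "Suc i mod 3 = k" using cyc(1)[OF k(1), of j] j3 by auto
    then show "triple ((p(k := p k + t\<^sup>2 *s w)) (i mod 3)) (Q t i) (Q t ((i + 5) mod 6)) = 0"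
      unfolding j_def[symmetric]
    proof cases
      case 1
      then have "j mod 3 \<noteq> k" using cyc(2)[OF k(1), of j] j3 by auto
      then have "Q t i = g i t" "Q t j = f i t" using 1 i j j3 by (simp_all add: Q_def)
      then show "triple ((p(k := p k + t\<^sup>2 *s w)) (i mod 3)) (Q t i) (Q t j) = 0"
        using fg[OF i 1] 1 triple_perm(2)[of "p k + t\<^sup>2 *s w" "f i t" "g i t"] by simp
    next
      case 2
      then have ne: "i mod 3 \<noteq> k" "Suc i mod 3 \<noteq> k" using cyc(2,3)[OF k(1), of j] cyc(2)[OF k(1), of i] j3 by auto
      have "Q t i = q i" "Q t j = g j t" using 2 i j j3 ne by (simp_all add: Q_def)
      moreover have "dot (L i) (g j t) = 0" using fg[OF j(1) 2] j(2) by simp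
      ultimately show "triple ((p(k := p k + t\<^sup>2 *s w)) (i mod 3)) (Q t i) (Q t j) = 0"
        using L i ne unfolding supports_def by (intro triple_eq_0_orthogonal[of "L i"]) simp_all
    next
      case 3
      then have ne: "i mod 3 \<noteq> k" "j mod 3 \<noteq> k" using cyc(2,3)[OF k(1), of j] cyc(2)[OF k(1), of i] j3 by auto
      have "Q t i = f (Suc i mod 6) t" "Q t j = q j" using 3 i j j3 ne by (simp_all add: Q_def)
      moreover have "dot (L i) (f (Suc i mod 6) t) = 0"
        using fg[OF S(1)[of i]] S(2)[of i] 3 succ_mod_6[OF i] by simp
      ultimately show "triple ((p(k := p k + t\<^sup>2 *s w)) (i mod 3)) (Q t i) (Q t j) = 0"
        using L i ne unfolding supports_def j_def by (intro triple_eq_0_orthogonal[of "L i"]) simp_all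
    qed
  qed
  ultimately show ?thesis by (intro exI[of _ Q]) auto
qed

text \<open>Packages a reduction: \<open>P\<close> describes diagonal points in a case already
  settled by \<open>step\<close>. Nonplanarity survives for general \<open>t\<close> because the
  planar families are closed.\<close>

lemma move_diagonal_point_limit:
  assumes X: "zariski_closed X" and k: "k < 3" "p k \<noteq> 0"
    and L: "supports L p q" and w: "unobstructed L k w"
    and tr: "\<And>t. triple ((p(k := p k + t\<^sup>2 *s w)) 0) ((p(k := p k + t\<^sup>2 *s w)) 1)
      ((p(k := p k + t\<^sup>2 *s w)) 2) = 0"
    and nonplanar: "assemble p q \<notin> plane_families"
    and gen: "\<forall>\<^sub>F t in cofinite. P (p(k := p k + t\<^sup>2 *s w))"
    and step: "\<And>p q. incident p q \<Longrightarrow> assemble p q \<notin> plane_families \<Longrightarrow> P p \<Longrightarrow> assemble p q \<in> X"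
  shows "assemble p q \<in> X"
proof -
  obtain Q where Q: "\<forall>i. poly_vec (\<lambda>t. Q t i)" "Q 0 = q" "\<forall>t. incident (p(k := p k + t\<^sup>2 *s w)) (Q t)"
    using move_diagonal_point[OF k L w tr] by blast
  have pv: "poly_vec (\<lambda>t. (p(k := p k + t\<^sup>2 *s w)) j)" for j
    by (cases "j = k") (simp_all add: poly_intros)
  have "poly_curve (\<lambda>t. assemble (p(k := p k + t\<^sup>2 *s w)) (Q t))"
    by (intro poly_intros pv Q(1)[rule_format])
  then have "\<forall>\<^sub>F t in cofinite. assemble (p(k := p k + t\<^sup>2 *s w)) (Q t) \<notin> plane_families"
    by (rule generically_not_in_closed[OF zariski_closed_plane_families, of _ 0])
      (simp add: Q(2) nonplanar)
  with gen have "\<forall>\<^sub>F t in cofinite. P (p(k := p k + t\<^sup>2 *s w)) \<and>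
      assemble (p(k := p k + t\<^sup>2 *s w)) (Q t) \<notin> plane_families"
    by (rule eventually_conj)
  then have lim: "\<forall>\<^sub>F t in cofinite. assemble (p(k := p k + t\<^sup>2 *s w)) (Q t) \<in> X"
    by (rule eventually_mono) (use step Q(3) in blast)
  show ?thesis
    by (rule assemble_limit[OF X pv _ _ _ lim]) (simp_all add: Q)
qed

lemma cyclic_3:
  assumes "j < (3::nat)"
  shows "Suc j mod 3 < 3" "Suc (Suc j) mod 3 < 3" "Suc (Suc (Suc j)) mod 3 = j"
    "Suc j mod 3 \<noteq> j" "Suc (Suc j) mod 3 \<noteq> j" "Suc (Suc j) mod 3 \<noteq> Suc j mod 3"
    "(\<forall>k<3. R k) \<longleftrightarrow> R j \<and> R (Suc j mod 3) \<and> R (Suc (Suc j) mod 3)"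
proof -
  show "Suc j mod 3 < 3" "Suc (Suc j) mod 3 < 3" by simp_all
  show "Suc (Suc (Suc j)) mod 3 = j" "Suc j mod 3 \<noteq> j" "Suc (Suc j) mod 3 \<noteq> j"
    "Suc (Suc j) mod 3 \<noteq> Suc j mod 3"
    using assms by presburger+
  have "j = 0 \<or> j = 1 \<or> j = 2" using assms by auto
  then show "(\<forall>k<3. R k) \<longleftrightarrow> R j \<and> R (Suc j mod 3) \<and> R (Suc (Suc j) mod 3)"
    unfolding all_less_3 by (auto simp: numeral_2_eq_2)
qed

lemma triple_0_1_2_orthogonal:
  assumes "m \<noteq> 0" "\<forall>k<3. dot m (p k) = 0"
  shows "triple (p 0) (p 1) (p (2::nat)) = 0"
  using assms(2) by (intro triple_eq_0_orthogonal[OF assms(1)]) simp_all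

text \<open>Moving one of the two coinciding points towards the third keeps all three collinear and
  makes them pairwise distinct.\<close>

lemma hexagon_two_diagonal_points:
  assumes X: "zariski_closed X" "pascal_families \<subseteq> X"
    and inc: "incident p q" and nonplanar: "assemble p q \<notin> plane_families"
    and nz: "\<forall>k<3. p k \<noteq> 0" and j: "j < 3"
    and par: "cross (p j) (p (Suc j mod 3)) = 0"
    and ind: "cross (p (Suc j mod 3)) (p (Suc (Suc j) mod 3)) \<noteq> 0"
  shows "assemble p q \<in> X"
proof -
  obtain L where L: "supports L p q" using incident_imp_supports[OF inc] .
  define w where "w = p (Suc (Suc j) mod 3)"
  note c = cyclic_3[OF j]
  obtain m where m: "m \<noteq> 0" "dot m (p 0) = 0" "dot m (p 1) = 0" "dot m (p 2) = 0"
    using inc obtain_common_orthogonal unfolding incident_def by metis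
  then have mp: "\<forall>k<3. dot m (p k) = 0" unfolding all_less_3 by blast
  have pj: "cross w (p j) \<noteq> 0"
  proof
    assume "cross w (p j) = 0"
    then have "cross w (p (Suc j mod 3)) = 0" using parallel_trans par nz j by blast
    then show False using ind cross_eq_0_commute unfolding w_def by blast
  qed
  show ?thesis
  proof (rule move_diagonal_point_limit[OF X(1) j _ L _ _ nonplanar,
        of w "\<lambda>p. \<forall>k<3. cross (p k) (p (Suc k mod 3)) \<noteq> 0"])
    show "p j \<noteq> 0" using nz j by blast
    show "unobstructed L j w"
      unfolding unobstructed_def
    proof (intro allI impI)
      fix i :: nat assume i: "i < 6" "i mod 3 = j" and LL: "cross (L i) (L ((i + 5) mod 6)) = 0"
      \<comment> \<open>The side before a side through point \<open>j\<close> passes through point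
        \<open>j + 2\<close>, which is the direction \<open>w\<close>. A side that is the same line
        as its predecessor thus contains \<open>w\<close>, and nothing is obstructed.\<close>
      have "(i + 5) mod 6 mod 3 = Suc (Suc j) mod 3"
      proof -
        have "(i + 5) mod 6 mod 3 = (Suc (Suc i) + 3) mod 3"
          by (simp add: mod_mod_cancel add.commute)
        then show ?thesis unfolding i(2)[symmetric] mod_add_self2 by (simp add: mod_simps)
      qed
      then have "L ((i + 5) mod 6) \<noteq> 0" "dot (L ((i + 5) mod 6)) w = 0"
        using L[unfolded supports_def, rule_format, of "(i + 5) mod 6"] by (simp_all add: w_def)
      then show "dot (L i) w = 0" using parallel_orthogonal LL cross_eq_0_commute by blast
    qed
    show "triple ((p(j := p j + t\<^sup>2 *s w)) 0) ((p(j := p j + t\<^sup>2 *s w)) 1)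
        ((p(j := p j + t\<^sup>2 *s w)) 2) = 0" for t
      by (rule triple_0_1_2_orthogonal[OF m(1)]) (use mp c in \<open>simp add: w_def\<close>)
    show "\<forall>\<^sub>F t in cofinite. \<forall>k<3. cross ((p(j := p j + t\<^sup>2 *s w)) k)
        ((p(j := p j + t\<^sup>2 *s w)) (Suc k mod 3)) \<noteq> 0"
    proof (rule eventually_mono[OF generically_neq[of 0]])
      fix t :: complex assume t: "t \<noteq> 0"
      have "cross w (p (Suc j mod 3)) \<noteq> 0" using ind cross_eq_0_commute unfolding w_def by blast
      then show "\<forall>k<3. cross ((p(j := p j + t\<^sup>2 *s w)) k) ((p(j := p j + t\<^sup>2 *s w)) (Suc k mod 3)) \<noteq> 0"
        unfolding c(7) using t par ind pj c by (simp add: w_def mod_Suc_eq vector_mul_eq_0)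
    qed
  qed (rule hexagon_distinct_diagonal_points[OF X])
qed

text \<open>Every side passes through the common point. The task is to find a diagonal point
  \<open>k\<close> that can leave it in an unobstructed direction; afterwards two distinct points
  remain and the previous case applies.\<close>

lemma hexagon_one_diagonal_point:
  assumes X: "zariski_closed X" "pascal_families \<subseteq> X"
    and inc: "incident p q" and nonplanar: "assemble p q \<notin> plane_families"
    and nz: "\<forall>k<3. p k \<noteq> 0" and par: "\<forall>k<3. cross (p 0) (p k) = 0"
  shows "assemble p q \<in> X"
proof -
  obtain L where L: "supports L p q" using incident_imp_supports[OF inc] .
  have Lp: "dot (L i) (p 0) = 0" "L i \<noteq> 0" if "i < 6" for i
  proof -
    have "p (i mod 3) \<noteq> 0" "cross (p (i mod 3)) (p 0) = 0"
      using nz par cross_eq_0_commute by (meson mod_less_divisor zero_less_numeral)+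
    moreover have "dot (p (i mod 3)) (L i) = 0"
      using L that unfolding supports_def by (subst dot_commute) blast
    ultimately have "dot (p 0) (L i) = 0" by (rule parallel_orthogonal)
    then show "dot (L i) (p 0) = 0" by (simp add: dot_commute)
    show "L i \<noteq> 0" using L that unfolding supports_def by blast
  qed
  define ob where "ob i \<longleftrightarrow> cross (L i) (L ((i + 5) mod 6)) = 0 \<and> cross (L i) (L (Suc i mod 6)) = 0" for i
  have unob: "unobstructed L k w" 
    if "k < 3" and w: "ob k \<longrightarrow> dot (L k) w = 0" "ob (k + 3) \<longrightarrow> dot (L (k + 3)) w = 0" for k w
    unfolding unobstructed_def
  proof (intro allI impI)
    fix i :: nat assume i: "i < 6" "i mod 3 = k"
      and "cross (L i) (L ((i + 5) mod 6)) = 0" "cross (L i) (L (Suc i mod 6)) = 0"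
    then have "ob i" by (simp add: ob_def)
    moreover have "i = k \<or> i = k + 3" using i by presburger
    ultimately show "dot (L i) w = 0" using w by blast
  qed
  \<comment> \<open>The directions available to point \<open>k\<close> vanish only if both its sides
    are obstructed and are different lines, since then \<open>w\<close> would have to lie on
    both.\<close>
  have pick: "\<exists>w. unobstructed L k w \<and> cross (p 0) w \<noteq> 0"
    if k: "k < 3" and free: "\<not> (ob k \<and> ob (k + 3) \<and> cross (L k) (L (k + 3)) \<noteq> 0)" for k
  proof -
    \<comment> \<open>Each side is the join of the common point and some \<open>w\<close>, so moving
      in direction \<open>w\<close> stays on that side.\<close>
    have *: "\<exists>w. L i = cross (p 0) w \<and> dot (L i) w = 0 \<and> cross (p 0) w \<noteq> 0" if i: "i < 6" for i
    proof -
      obtain w where "L i = cross (p 0) w"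
        using orthogonal_imp_cross[of "p 0" "L i"] Lp[OF i] nz dot_commute by (metis zero_less_numeral)
      then show ?thesis using Lp(2)[OF i] by (metis dot_cross_self(4))
    qed
    show ?thesis
    proof (cases "ob k")
      case True
      obtain w where w: "dot (L k) w = 0" "cross (p 0) w \<noteq> 0" using *[of k] k by auto
      have "dot (L (k + 3)) w = 0" if "ob (k + 3)"
        using parallel_orthogonal[OF Lp(2)[of k] _ w(1)] free True that k by simp
      then show ?thesis using unob[OF k, of w] w by blast
    next
      case False
      obtain w where w: "dot (L (k + 3)) w = 0" "cross (p 0) w \<noteq> 0" using *[of "k + 3"] k by auto
      then show ?thesis using unob[OF k, of w] False by blast
    qed
  qed
  \<comment> \<open>Obstruction of sides 0, 1 and 3 makes sides 0, 1, 2, 3 one line, so the opposite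
    sides 0 and 3 cannot differ. Hence point 0 or point 1 is free to move.\<close>
  have "\<not> (ob 0 \<and> ob (0 + 3) \<and> cross (L 0) (L (0 + 3)) \<noteq> 0) \<or>
      \<not> (ob 1 \<and> ob (1 + 3) \<and> cross (L 1) (L (1 + 3)) \<noteq> 0)"
  proof (rule ccontr)
    assume "\<not> ?thesis"
    then have ob: "ob 0" "ob 1" "ob 3" and ne: "cross (L 0) (L 3) \<noteq> 0" by simp_all
    have l: "cross (L 0) (L 1) = 0" "cross (L 1) (L 2) = 0" "cross (L 2) (L 3) = 0"
      using ob cross_eq_0_commute[of "L 2" "L 3"] by (simp_all add: ob_def numeral_2_eq_2)
    have "cross (L 0) (L 2) = 0" by (rule parallel_trans[OF _ l(1,2)]) (simp add: Lp)
    then have "cross (L 0) (L 3) = 0" by (rule parallel_trans[OF _ _ l(3), rotated]) (simp add: Lp)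
    then show False using ne by blast
  qed
  then have "\<exists>k<3. \<exists>w. unobstructed L k w \<and> cross (p 0) w \<noteq> 0"
  proof
    assume "\<not> (ob 0 \<and> ob (0 + 3) \<and> cross (L 0) (L (0 + 3)) \<noteq> 0)"
    then show ?thesis using pick[of 0] by (intro exI[of _ 0]) simp
  next
    assume "\<not> (ob 1 \<and> ob (1 + 3) \<and> cross (L 1) (L (1 + 3)) \<noteq> 0)"
    then show ?thesis using pick[of 1] by (intro exI[of _ 1]) simp
  qed
  then obtain k w where k: "k < 3" and w: "unobstructed L k w" "cross (p 0) w \<noteq> 0" by blast
  note c = cyclic_3[OF k]
  have p0: "p 0 \<noteq> 0" using nz by simp
  have par': "cross (p i) (p 0) = 0" if "i < 3" for i
    using par that cross_eq_0_commute by blast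
  have par0: "cross (p i) (p j) = 0" if "i < 3" "j < 3" for i j
    using parallel_trans[OF p0 par'[OF that(1)]] par that(2) by blast
  have pw: "cross (p i) w \<noteq> 0" if "i < 3" for i
    using parallel_trans[of "p i" "p 0" w] par nz w(2) that by blast
  have mp: "dot (cross (p 0) w) (p i) = 0" if "i < 3" for i
  proof -
    have "dot (p i) (cross (p 0) w) = 0"
      by (rule parallel_orthogonal[OF p0]) (use par that in simp_all)
    then show ?thesis by (subst dot_commute)
  qed
  show ?thesis
  proof (rule move_diagonal_point_limit[OF X(1) k _ L w(1) _ nonplanar,
        of "\<lambda>p. (\<forall>k<3. p k \<noteq> 0) \<and> (\<exists>j<3. cross (p j) (p (Suc j mod 3)) = 0 \<and>
          cross (p (Suc j mod 3)) (p (Suc (Suc j) mod 3)) \<noteq> 0)"])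
    show "p k \<noteq> 0" using nz k by blast
    show "triple ((p(k := p k + t\<^sup>2 *s w)) 0) ((p(k := p k + t\<^sup>2 *s w)) 1)
        ((p(k := p k + t\<^sup>2 *s w)) 2) = 0" for t
      by (rule triple_0_1_2_orthogonal[OF w(2)]) (use mp in simp)
    show "\<forall>\<^sub>F t in cofinite. (\<forall>l<3. (p(k := p k + t\<^sup>2 *s w)) l \<noteq> 0) \<and>
        (\<exists>j<3. cross ((p(k := p k + t\<^sup>2 *s w)) j) ((p(k := p k + t\<^sup>2 *s w)) (Suc j mod 3)) = 0 \<and>
          cross ((p(k := p k + t\<^sup>2 *s w)) (Suc j mod 3)) ((p(k := p k + t\<^sup>2 *s w)) (Suc (Suc j) mod 3)) \<noteq> 0)"
    proof (rule eventually_mono[OF generically_neq[of 0]])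
      fix t :: complex assume t: "t \<noteq> 0"
      let ?p = "p(k := p k + t\<^sup>2 *s w)"
      have nz': "cross (p (Suc (Suc k) mod 3)) (p k + t\<^sup>2 *s w) \<noteq> 0"
        using par0 pw c k t by (simp add: vector_mul_eq_0)
      then have "p k + t\<^sup>2 *s w \<noteq> 0" by (metis cross_linear(1))
      then have "\<forall>l<3. ?p l \<noteq> 0" using nz by simp
      \<comment> \<open>The pair still coinciding consists of the two unmoved points, so the index
        for the next case is \<open>k + 1\<close>.\<close>
      moreover have "cross (?p (Suc k mod 3)) (?p (Suc (Suc k mod 3) mod 3)) = 0"
        using par0 c by (simp add: mod_Suc_eq)
      moreover have "cross (?p (Suc (Suc k mod 3) mod 3)) (?p (Suc (Suc (Suc k mod 3)) mod 3)) \<noteq> 0"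
        using nz' c by (simp add: mod_simps)
      ultimately show "(\<forall>l<3. ?p l \<noteq> 0) \<and> (\<exists>j<3. cross (?p j) (?p (Suc j mod 3)) = 0 \<and>
          cross (?p (Suc j mod 3)) (?p (Suc (Suc j) mod 3)) \<noteq> 0)"
        using c(1) by blast
    qed
  qed (use hexagon_two_diagonal_points[OF X] in blast)
qed

lemma hexagon_in_closure:
  assumes X: "zariski_closed X" "pascal_families \<subseteq> X"
    and inc: "incident p q" and nonplanar: "assemble p q \<notin> plane_families"
    and nz: "\<forall>k<3. p k \<noteq> 0"
  shows "assemble p q \<in> X"
proof -
  define c where "c k \<longleftrightarrow> cross (p k) (p (Suc k mod 3)) = 0" for k
  \<comment> \<open>Parallelism is transitive because no diagonal point vanishes: the cases are
    three, one, or two distinct points on the diagonal line.\<close>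
  consider "\<not> c 0 \<and> \<not> c 1 \<and> \<not> c 2" | "c 0 \<and> c 1" | "\<exists>j<3. c j \<and> \<not> c (Suc j mod 3)"
  proof -
    have "(\<exists>j<3. c j \<and> \<not> c (Suc j mod 3)) \<or> \<not> c 0 \<and> \<not> c 1 \<and> \<not> c 2 \<or> c 0 \<and> c 1"
      using all_less_3[of "\<lambda>j. \<not> (c j \<and> \<not> c (Suc j mod 3))"] by (auto simp: numeral_2_eq_2)
    then show ?thesis using that by blast
  qed
  then show ?thesis
  proof cases
    case 1
    then have "\<forall>k<3. cross (p k) (p (Suc k mod 3)) \<noteq> 0" unfolding all_less_3 c_def by blast
    then show ?thesis by (rule hexagon_distinct_diagonal_points[OF X inc _ nonplanar])
  next
    case 2
    then have c: "cross (p 0) (p 1) = 0" "cross (p 1) (p 2) = 0"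
      unfolding c_def by (simp_all add: numeral_2_eq_2)
    have "p 1 \<noteq> 0" using nz by simp
    then have "cross (p 0) (p 2) = 0" using c by (rule parallel_trans)
    then have "\<forall>k<3. cross (p 0) (p k) = 0" unfolding all_less_3 using c by simp
    then show ?thesis by (rule hexagon_one_diagonal_point[OF X inc nonplanar nz])
  next
    case 3
    then obtain j where j: "j < 3" "c j" "\<not> c (Suc j mod 3)" by blast
    then show ?thesis
      using hexagon_two_diagonal_points[OF X inc nonplanar nz j(1)] unfolding c_def
      by (simp add: mod_Suc_eq)
  qed
qed

section \<open>Quadrilaterals\<close>

text \<open>Deleting the diagonal point \<open>k\<close> leaves four lines that form a quadrilateral with corners \<open>x\<close>
  and one further point \<open>y i\<close> on each side \<open>x i, x (i + 1)\<close>.\<close>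

definition quad :: "nat \<Rightarrow> (nat \<Rightarrow> complex ^ 3) \<Rightarrow> (nat \<Rightarrow> complex ^ 3) \<Rightarrow> complex ^ 3 ^ 9" where
  "quad k x y = assemble
     (\<lambda>j. if j = k then 0 else if j = Suc k mod 3 then x 0 else x 2)
     (\<lambda>j. if j = k then y 0 else if j = Suc k mod 6 then x 1 else if j = (k + 2) mod 6 then y 1
       else if j = (k + 3) mod 6 then y 3 else if j = (k + 4) mod 6 then x 3 else y 2)"

definition diagonal_label :: "nat \<Rightarrow> 9" where
  "diagonal_label k = (if k = 0 then 7 else if k = 1 then 8 else 9)"

definition quad_incident :: "(nat \<Rightarrow> complex ^ 3) \<Rightarrow> (nat \<Rightarrow> complex ^ 3) \<Rightarrow> bool" where
  "quad_incident x y \<longleftrightarrow> (\<forall>i<4. triple (x i) (x (Suc i mod 4)) (y i) = 0)"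

lemma less_3_cases: "k < (3::nat) \<Longrightarrow> k = 0 \<or> k = 1 \<or> k = 2"
  by auto

lemma incident_iff:
  "incident p q \<longleftrightarrow> triple (p 0) (p 1) (p 2) = 0 \<and> triple (p 0) (q 0) (q 5) = 0 \<and>
     triple (p 1) (q 1) (q 0) = 0 \<and> triple (p 2) (q 2) (q 1) = 0 \<and> triple (p 0) (q 3) (q 2) = 0 \<and>
     triple (p 1) (q 4) (q 3) = 0 \<and> triple (p 2) (q 5) (q 4) = 0"
  unfolding incident_def all_less_6 by simp

lemma quad_incident_iff:
  "quad_incident x y \<longleftrightarrow> triple (x 0) (x 1) (y 0) = 0 \<and> triple (x 1) (x 2) (y 1) = 0 \<and>
     triple (x 2) (x 3) (y 2) = 0 \<and> triple (x 3) (x 0) (y 3) = 0"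
proof -
  have "Suc 0 mod 4 = 1" "Suc 1 mod 4 = 2" "Suc 2 mod 4 = (3::nat)" "Suc 3 mod 4 = (0::nat)" by simp_all
  then show ?thesis unfolding quad_incident_def all_less_4 by (simp only:)
qed

text \<open>The three lines through the vanishing point hold trivially. The remaining sides
  \<open>k + 1\<close>, \<open>k + 2\<close>, \<open>k + 5\<close>, \<open>k + 4\<close> form the
  cycle with corners \<open>p (k + 1)\<close>, \<open>q (k + 1)\<close>, \<open>p (k + 2)\<close>,
  \<open>q (k + 4)\<close>.\<close>

lemma quad_in_circuit_variety_iff:
  assumes "pascal_configuration M" "k < 3"
  shows "quad k x y \<in> circuit_variety M \<longleftrightarrow> quad_incident x y"
proof -
  have perm: "triple (x 2) (y 1) (x 1) = 0 \<longleftrightarrow> triple (x 1) (x 2) (y 1) = 0"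
    "triple (x 2) (y 2) (x 3) = 0 \<longleftrightarrow> triple (x 2) (x 3) (y 2) = 0"
    "triple (x 0) (x 3) (y 3) = 0 \<longleftrightarrow> triple (x 3) (x 0) (y 3) = 0"
    using triple_perm(4)[of "x 2" "y 1" "x 1"] triple_perm(2)[of "x 2" "y 2" "x 3"]
      triple_perm(1)[of "x 0" "x 3" "y 3"] by simp_all
  define p where "p j = (if j = k then 0 else if j = Suc k mod 3 then x 0 else x 2)" for j
  define q where "q j = (if j = k then y 0 else if j = Suc k mod 6 then x 1 else if j = (k + 2) mod 6 then y 1
       else if j = (k + 3) mod 6 then y 3 else if j = (k + 4) mod 6 then x 3 else y 2)" for j
  have "incident p q \<longleftrightarrow> quad_incident x y"
    using less_3_cases[OF assms(2)]
  proof (elim disjE)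
    assume k: "k = 0"
    have "p 0 = 0" "p 1 = x 0" "p 2 = x 2" "q 0 = y 0" "q 1 = x 1" "q 2 = y 1" "q 3 = y 3" "q 4 = x 3" "q 5 = y 2"
      by (simp_all add: p_def q_def k)
    then show ?thesis unfolding incident_iff quad_incident_iff using perm by (auto simp only: triple_0)
  next
    assume k: "k = 1"
    have "p 1 = 0" "p 2 = x 0" "p 0 = x 2" "q 1 = y 0" "q 2 = x 1" "q 3 = y 1" "q 4 = y 3" "q 5 = x 3" "q 0 = y 2"
      by (simp_all add: p_def q_def k)
    then show ?thesis unfolding incident_iff quad_incident_iff using perm by (auto simp only: triple_0)
  next
    assume k: "k = 2"
    have "p 2 = 0" "p 0 = x 0" "p 1 = x 2" "q 2 = y 0" "q 3 = x 1" "q 4 = y 1" "q 5 = y 3" "q 0 = x 3" "q 1 = y 2"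
      by (simp_all add: p_def q_def k)
    then show ?thesis unfolding incident_iff quad_incident_iff using perm by (auto simp only: triple_0)
  qed
  moreover have "quad k x y = assemble p q" unfolding quad_def p_def q_def ..
  ultimately show ?thesis using assemble_in_circuit_variety_iff[OF assms(1)] by simp
qed

lemma quad_diagonal [simp]: "k < 3 \<Longrightarrow> quad k x y $ diagonal_label k = 0"
  by (drule less_3_cases) (auto simp: quad_def diagonal_label_def)

lemma quad_surj:
  assumes "k < 3" "\<gamma> $ diagonal_label k = 0"
  obtains x y where "\<gamma> = quad k x y"
proof -
  obtain p q where \<gamma>: "\<gamma> = assemble p q" by (rule assemble_surj)
  have p: "p k = 0"
    using less_3_cases[OF assms(1)] assms(2) unfolding \<gamma> diagonal_label_def by auto
  define x where "x i = (if i = 0 then p (Suc k mod 3) else if i = 1 then q (Suc k mod 6)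
    else if i = 2 then p ((k + 2) mod 3) else q ((k + 4) mod 6))" for i :: nat
  define y where "y i = (if i = 0 then q k else if i = 1 then q ((k + 2) mod 6)
    else if i = 2 then q ((k + 5) mod 6) else q ((k + 3) mod 6))" for i :: nat
  have "\<gamma> = quad k x y"
    unfolding \<gamma> vec_eq_iff[of "assemble p q"] forall_9
    using less_3_cases[OF assms(1)] p
    by (elim disjE; simp add: quad_def x_def y_def numeral_2_eq_2; simp add: numeral_eq_Suc)
  then show ?thesis by (rule that)
qed

lemma poly_curve_quad [poly_intros]:
  assumes "\<And>i. poly_vec (\<lambda>t. x t i)" "\<And>i. poly_vec (\<lambda>t. y t i)"
  shows "poly_curve (\<lambda>t. quad k (x t) (y t))"
  unfolding quad_def by (intro poly_intros assms)

lemma quad_cong: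
  assumes "\<forall>i<4. x i = x' i \<and> y i = y' i"
  shows "quad k x y = quad k x' y'"
  using assms by (simp add: quad_def all_less_4 cong: if_cong)

lemma quad_limit:
  assumes X: "zariski_closed X" and x: "\<And>i. poly_vec (\<lambda>t. F t i)" "\<And>i. i < 4 \<Longrightarrow> F 0 i = x i"
    and y: "\<And>i. poly_vec (\<lambda>t. G t i)" "\<And>i. i < 4 \<Longrightarrow> G 0 i = y i"
    and gen: "\<forall>\<^sub>F t in cofinite. quad k (F t) (G t) \<in> X"
  shows "quad k x y \<in> X"
proof -
  have "quad k (F 0) (G 0) \<in> X"
    by (rule zariski_closed_curve_limit[OF X _ gen]) (intro poly_intros x y)
  moreover have "quad k (F 0) (G 0) = quad k x y" using x(2) y(2) by (intro quad_cong) simp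
  ultimately show ?thesis by simp
qed

text \<open>Planar quadrilaterals are obtained as limits of the first parametrization, the others as limits of
  the second one.\<close>

definition corner_families :: "nat \<Rightarrow> (complex ^ 3 ^ 9) set" where
  "corner_families k = {quad k x (\<lambda>i. a i *s x i + b i *s x (Suc i mod 4)) |x a b. True}"

definition side_families :: "nat \<Rightarrow> (complex ^ 3 ^ 9) set" where
  "side_families k = {quad k (\<lambda>i. s i *s cross (P ((i + 3) mod 4)) (P i)) (\<lambda>i. cross (P i) (v i)) |s P v. True}"

lemma corner_familiesI:
  assumes "\<forall>i<4. y i = a i *s x i + b i *s x (Suc i mod 4)"
  shows "quad k x y \<in> corner_families k"
proof -
  have "quad k x y = quad k x (\<lambda>i. a i *s x i + b i *s x (Suc i mod 4))"
    by (intro quad_cong) (simp add: assms)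
  then show ?thesis unfolding corner_families_def by (intro CollectI) (intro exI conjI TrueI)
qed

lemma side_familiesI:
  assumes "\<forall>i<4. x i = s i *s cross (P ((i + 3) mod 4)) (P i)" "\<forall>i<4. y i = cross (P i) (v i)"
  shows "quad k x y \<in> side_families k"
proof -
  have "quad k x y = quad k (\<lambda>i. s i *s cross (P ((i + 3) mod 4)) (P i)) (\<lambda>i. cross (P i) (v i))"
    by (intro quad_cong) (simp add: assms)
  then show ?thesis unfolding side_families_def by (intro CollectI) (intro exI conjI TrueI)
qed

lemma curve_connected_corner_families: "curve_connected (corner_families k)"
  unfolding curve_connected_def
proof (intro ballI)
  fix \<gamma> \<delta> assume "\<gamma> \<in> corner_families k" "\<delta> \<in> corner_families k"
  then obtain x a b x' a' b' where
    g: "\<gamma> = quad k x (\<lambda>i. a i *s x i + b i *s x (Suc i mod 4))"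
    and d: "\<delta> = quad k x' (\<lambda>i. a' i *s x' i + b' i *s x' (Suc i mod 4))"
    unfolding corner_families_def mem_Collect_eq by (elim exE conjE) (rule that)
  define F where "F t i = (1 - t) *s x i + t *s x' i" for t i
  define G where "G t i = ((1 - t) * a i + t * a' i) *s F t i +
    ((1 - t) * b i + t * b' i) *s F t (Suc i mod 4)" for t i
  let ?c = "\<lambda>t. quad k (F t) (G t)"
  have "poly_curve ?c" unfolding G_def F_def by (intro poly_intros)
  moreover have "?c 0 = \<gamma>" "?c 1 = \<delta>"
    unfolding g d by (rule quad_cong; simp add: F_def G_def)+
  moreover have "?c t \<in> corner_families k" for t
    by (rule corner_familiesI[of _ "\<lambda>i. (1 - t) * a i + t * a' i" _ "\<lambda>i. (1 - t) * b i + t * b' i"])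
      (simp add: G_def del: cross_linear)
  ultimately show "\<exists>c. poly_curve c \<and> c 0 = \<gamma> \<and> c 1 = \<delta> \<and> (\<forall>t. c t \<in> corner_families k)"
    by (intro exI[of _ ?c]) simp
qed

lemma curve_connected_side_families: "curve_connected (side_families k)"
  unfolding curve_connected_def
proof (intro ballI)
  fix \<gamma> \<delta> assume "\<gamma> \<in> side_families k" "\<delta> \<in> side_families k"
  then obtain s P v s' P' v' where
    g: "\<gamma> = quad k (\<lambda>i. s i *s cross (P ((i + 3) mod 4)) (P i)) (\<lambda>i. cross (P i) (v i))"
    and d: "\<delta> = quad k (\<lambda>i. s' i *s cross (P' ((i + 3) mod 4)) (P' i)) (\<lambda>i. cross (P' i) (v' i))"
    unfolding side_families_def mem_Collect_eq by (elim exE conjE) (rule that)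
  define R where "R t i = (1 - t) *s P i + t *s P' i" for t and i :: nat
  define F where "F t i = ((1 - t) * s i + t * s' i) *s cross (R t ((i + 3) mod 4)) (R t i)" for t i
  define G where "G t i = cross (R t i) ((1 - t) *s v i + t *s v' i)" for t i
  let ?c = "\<lambda>t. quad k (F t) (G t)"
  have "poly_curve ?c" unfolding G_def F_def R_def by (intro poly_intros)
  moreover have "?c 0 = \<gamma>" "?c 1 = \<delta>"
    unfolding g d by (rule quad_cong; simp add: F_def G_def R_def)+
  moreover have "?c t \<in> side_families k" for t
    by (rule side_familiesI[of _ "\<lambda>i. (1 - t) * s i + t * s' i" "R t" _ "\<lambda>i. (1 - t) *s v i + t *s v' i"])
      (simp_all add: F_def G_def del: cross_linear)
  ultimately show "\<exists>c. poly_curve c \<and> c 0 = \<gamma> \<and> c 1 = \<delta> \<and> (\<forall>t. c t \<in> side_families k)"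
    by (intro exI[of _ ?c]) simp
qed

lemma corner_families_circuit:
  assumes "pascal_configuration M" "k < 3"
  shows "corner_families k \<subseteq> circuit_variety (make_loop M (diagonal_label k))"
proof
  fix \<gamma> assume "\<gamma> \<in> corner_families k"
  then obtain x a b where g: "\<gamma> = quad k x (\<lambda>i. a i *s x i + b i *s x (Suc i mod 4))"
    unfolding corner_families_def mem_Collect_eq by (elim exE conjE) (rule that)
  have "quad_incident x (\<lambda>i. a i *s x i + b i *s x (Suc i mod 4))"
    unfolding quad_incident_def by (simp add: triple_span del: dot_linear)
  then show "\<gamma> \<in> circuit_variety (make_loop M (diagonal_label k))"
    unfolding circuit_variety_make_loop g
    using quad_in_circuit_variety_iff[OF assms] assms(2) by simp
qed

lemma cyclic_4:
  assumes "i < (4::nat)"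
  shows "(Suc i mod 4 + 3) mod 4 = i" "Suc ((i + 3) mod 4) mod 4 = i" "(i + 3) mod 4 \<noteq> i" "Suc i mod 4 \<noteq> i"
    "(i + 3) mod 4 < 4" "Suc i mod 4 < 4" "(i + 3) mod 4 \<noteq> Suc i mod 4"
proof -
  have "\<forall>i<4. (Suc i mod 4 + 3) mod 4 = i \<and> Suc ((i + 3) mod 4) mod 4 = i \<and> (i + 3) mod 4 \<noteq> i \<and>
      Suc i mod 4 \<noteq> i \<and> (i + 3) mod 4 \<noteq> Suc i mod 4"
    unfolding all_less_4 by simp
  then show "(Suc i mod 4 + 3) mod 4 = i" "Suc ((i + 3) mod 4) mod 4 = i" "(i + 3) mod 4 \<noteq> i"
    "Suc i mod 4 \<noteq> i" "(i + 3) mod 4 \<noteq> Suc i mod 4" using assms by blast+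
qed simp_all

lemma side_families_circuit:
  assumes "pascal_configuration M" "k < 3"
  shows "side_families k \<subseteq> circuit_variety (make_loop M (diagonal_label k))"
proof
  fix \<gamma> assume "\<gamma> \<in> side_families k"
  then obtain s P v where g: "\<gamma> = quad k (\<lambda>i. s i *s cross (P ((i + 3) mod 4)) (P i)) (\<lambda>i. cross (P i) (v i))"
    unfolding side_families_def mem_Collect_eq by (elim exE conjE) (rule that)
  have "quad_incident (\<lambda>i. s i *s cross (P ((i + 3) mod 4)) (P i)) (\<lambda>i. cross (P i) (v i))"
    unfolding quad_incident_def
  proof (intro allI impI)
    fix i :: nat assume i: "i < 4"
    show "triple (s i *s cross (P ((i + 3) mod 4)) (P i))
      (s (Suc i mod 4) *s cross (P ((Suc i mod 4 + 3) mod 4)) (P (Suc i mod 4))) (cross (P i) (v i)) = 0"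
    proof (cases "P i = 0")
      case False
      then show ?thesis by (intro triple_eq_0_orthogonal[of "P i"]) (simp_all add: cyclic_4(1)[OF i])
    qed simp
  qed
  then show "\<gamma> \<in> circuit_variety (make_loop M (diagonal_label k))"
    unfolding circuit_variety_make_loop g
    using quad_in_circuit_variety_iff[OF assms] assms(2) by simp
qed

section \<open>Degenerate quadrilaterals as limits\<close>

lemma obtain_orthogonal_nonparallel:
  assumes "P \<noteq> 0"
  obtains \<beta> where "dot \<beta> b = 0" "cross P \<beta> \<noteq> 0"
proof -
  have "\<exists>\<beta>. dot \<beta> b = 0 \<and> cross P \<beta> \<noteq> 0" if b: "b \<noteq> 0" for b
  proof -
    obtain u w where uw: "b = cross u w" using b by (rule obtain_plane_basis)
    have "cross P u \<noteq> 0 \<or> cross P w \<noteq> 0"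
      using parallel_trans[OF assms, of u w] b cross_eq_0_commute[of P u] uw by blast
    then show ?thesis unfolding uw using dot_cross_self(1,2) by blast
  qed
  \<comment> \<open>For \<open>b = 0\<close> every vector is orthogonal, so a nonzero substitute for
    \<open>b\<close> gives a valid choice.\<close>
  then obtain \<beta> where "dot \<beta> (if b = 0 then axis 1 1 else b) = 0" "cross P \<beta> \<noteq> 0"
    by (metis axis_eq_0_iff zero_neq_one)
  then show ?thesis using that by (cases "b = 0") auto
qed

definition quad_supports :: "(nat \<Rightarrow> complex ^ 3) \<Rightarrow> (nat \<Rightarrow> complex ^ 3) \<Rightarrow> (nat \<Rightarrow> complex ^ 3) \<Rightarrow> bool" where
  "quad_supports P x y \<longleftrightarrow> (\<forall>i<4. P i \<noteq> 0 \<and> dot (P i) (x i) = 0 \<and>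
     dot (P i) (x (Suc i mod 4)) = 0 \<and> dot (P i) (y i) = 0)"

text \<open>The corners move within the plane until adjacent ones are independent; the fixed points
  \<open>y i\<close> are then combinations of them.\<close>

lemma quad_planar:
  assumes X: "zariski_closed X" "corner_families k \<subseteq> X"
    and m: "m \<noteq> 0" "\<forall>i<4. dot m (x i) = 0 \<and> dot m (y i) = 0"
  shows "quad k x y \<in> X"
proof -
  obtain u w where uw: "m = cross u w" using obtain_plane_basis[OF m(1)] .
  \<comment> \<open>Four is even, so the corners can alternate between two basis vectors.
    Independence of adjacent corners is checked at \<open>t = 1\<close>, while the limit is taken at
    \<open>t = 0\<close>.\<close>
  define z where "z i = (if even i then u else w)" for i :: nat
  define F where "F t i = (1 - t) *s x i + t *s z i" for t i
  show ?thesis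
  proof (rule quad_limit[OF X(1), of F _ "\<lambda>t. y"])
    show "poly_vec (\<lambda>t. F t i)" for i unfolding F_def by (intro poly_intros)
    have "\<forall>\<^sub>F t in cofinite. cross (F t i) (F t (Suc i mod 4)) \<noteq> 0" if i: "i < 4" for i
    proof (rule poly_vec_generically_nonzero[of _ 1])
      show "poly_vec (\<lambda>t. cross (F t i) (F t (Suc i mod 4)))" unfolding F_def by (intro poly_intros)
      have "\<forall>i<4. even (Suc i mod 4) \<longleftrightarrow> odd i" unfolding all_less_4 by simp
      then have "even (Suc i mod 4) \<longleftrightarrow> odd i" using i by blast
      then have "cross (z i) (z (Suc i mod 4)) \<noteq> 0"
        using m(1) uw cross_eq_0_commute[of w u] by (cases "even i") (auto simp: z_def)
      then show "cross (F 1 i) (F 1 (Suc i mod 4)) \<noteq> 0" by (simp add: F_def)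
    qed
    then have "\<forall>\<^sub>F t in cofinite. \<forall>i\<in>{..<4}. cross (F t i) (F t (Suc i mod 4)) \<noteq> 0"
      by (intro eventually_ball_finite) auto
    then show "\<forall>\<^sub>F t in cofinite. quad k (F t) y \<in> X"
    proof (rule eventually_mono)
      fix t assume t: "\<forall>i\<in>{..<4}. cross (F t i) (F t (Suc i mod 4)) \<noteq> 0"
      have mF: "dot m (F t i) = 0" if "i < 4" for i using m that by (simp add: F_def z_def uw)
      have "\<exists>a b. y i = a *s F t i + b *s F t (Suc i mod 4)" if i: "i < 4" for i
      proof -
        have nz: "cross (F t i) (F t (Suc i mod 4)) \<noteq> 0" using t i by blast
        have "triple (F t i) (F t (Suc i mod 4)) (y i) = 0"
          using m mF i by (intro triple_eq_0_orthogonal[OF m(1)]) simp_all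
        then show ?thesis using in_span_of_orthogonal[OF nz] unfolding triple_def by metis
      qed
      then obtain a b where "\<forall>i<4. y i = a i *s F t i + b i *s F t (Suc i mod 4)" by metis
      then have "quad k (F t) y \<in> corner_families k" by (rule corner_familiesI)
      then show "quad k (F t) y \<in> X" using X(2) by blast
    qed
  qed (simp_all add: F_def poly_intros)
qed

lemma quad_distinct_sides:
  assumes P: "quad_supports P x y" and ind: "\<forall>i<4. cross (P i) (P (Suc i mod 4)) \<noteq> 0"
  shows "quad k x y \<in> side_families k"
proof -
  have "\<exists>s. x i = s *s cross (P ((i + 3) mod 4)) (P i)" if i: "i < 4" for i
  proof -
    have "cross (P ((i + 3) mod 4)) (P i) \<noteq> 0" using ind cyclic_4[OF i] by metis
    moreover have "dot (P ((i + 3) mod 4)) (x i) = 0" "dot (P i) (x i) = 0"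
      using P cyclic_4[OF i] i unfolding quad_supports_def by metis+
    ultimately show ?thesis using orthogonal_pair_imp_multiple by metis
  qed
  moreover have "\<exists>v. y i = cross (P i) v" if "i < 4" for i
    using orthogonal_imp_cross P that unfolding quad_supports_def by metis
  ultimately obtain s v where "\<forall>i<4. x i = s i *s cross (P ((i + 3) mod 4)) (P i)"
    "\<forall>i<4. y i = cross (P i) (v i)" by metis
  then show ?thesis by (rule side_familiesI)
qed

text \<open>A side that coincides with its successor but not with its predecessor is rotated about the
  corner \<open>x (i + 1)\<close> that it shares with its successor.\<close>

lemma quad_rotate_side:
  assumes X: "zariski_closed X" and P: "quad_supports P x y" and i: "i < 4"
    and prev: "cross (P ((i + 3) mod 4)) (P i) \<noteq> 0" and succ: "cross (P i) (P (Suc i mod 4)) = 0"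
    and step: "\<And>P' x y. quad_supports P' x y \<Longrightarrow> \<forall>j<4. j \<noteq> i \<longrightarrow> P' j = P j \<Longrightarrow>
      cross (P ((i + 3) mod 4)) (P' i) \<noteq> 0 \<Longrightarrow> cross (P' i) (P (Suc i mod 4)) \<noteq> 0 \<Longrightarrow> quad k x y \<in> X"
  shows "quad k x y \<in> X"
proof -
  note c = cyclic_4[OF i]
  have Pi: "P i \<noteq> 0" "dot (P i) (x i) = 0" "dot (P i) (x (Suc i mod 4)) = 0" "dot (P i) (y i) = 0"
    using P i unfolding quad_supports_def by blast+
  obtain \<beta> where \<beta>: "dot \<beta> (x (Suc i mod 4)) = 0" "cross (P i) \<beta> \<noteq> 0"
    using obtain_orthogonal_nonparallel[OF Pi(1)] .
  obtain v where v: "y i = cross (P i) v" using orthogonal_imp_cross[OF Pi(1,4)] .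
  have "dot (P ((i + 3) mod 4)) (x i) = 0" using P c unfolding quad_supports_def by metis
  then obtain s where s: "x i = s *s cross (P ((i + 3) mod 4)) (P i)"
    using orthogonal_pair_imp_multiple[OF prev _ Pi(2)] by blast
  \<comment> \<open>As \<open>\<beta>\<close> is orthogonal to \<open>x (i + 1)\<close>, every
    \<open>R t\<close> passes through that corner. With \<open>s\<close> and \<open>v\<close> fixed,
    \<open>x i\<close> slides along the preceding side and \<open>y i\<close> follows the rotated
    one.\<close>
  define R where "R t = P i + t *s \<beta>" for t
  define F where "F t = x(i := s *s cross (P ((i + 3) mod 4)) (R t))" for t
  define G where "G t = y(i := cross (R t) v)" for t
  have PS: "P (Suc i mod 4) \<noteq> 0" using P c unfolding quad_supports_def by blast
  have \<beta>S: "cross \<beta> (P (Suc i mod 4)) \<noteq> 0"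
    using parallel_trans[OF PS succ] \<beta>(2) cross_eq_0_commute by blast
  have "\<forall>\<^sub>F t in cofinite. cross (P ((i + 3) mod 4)) (R t) \<noteq> 0"
    by (rule poly_vec_generically_nonzero[of _ 0]) (auto simp: R_def prev intro!: poly_intros)
  then have "\<forall>\<^sub>F t in cofinite. cross (P ((i + 3) mod 4)) (R t) \<noteq> 0 \<and> t \<noteq> 0"
    using generically_neq by (rule eventually_conj)
  then have lim: "\<forall>\<^sub>F t in cofinite. quad k (F t) (G t) \<in> X"
  proof (rule eventually_mono, elim conjE)
    fix t :: complex
    assume t: "cross (P ((i + 3) mod 4)) (R t) \<noteq> 0" "t \<noteq> 0"
    show "quad k (F t) (G t) \<in> X"
    proof (rule step[of "P(i := R t)"])
      show "quad_supports (P(i := R t)) (F t) (G t)"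
        unfolding quad_supports_def
      proof (intro allI impI)
        fix j :: nat assume j: "j < 4"
        have Pj: "P j \<noteq> 0" "dot (P j) (x j) = 0" "dot (P j) (x (Suc j mod 4)) = 0" "dot (P j) (y j) = 0"
          using P j unfolding quad_supports_def by blast+
        consider "j = i" | "j \<noteq> i" "Suc j mod 4 = i" | "j \<noteq> i" "Suc j mod 4 \<noteq> i" by blast
        then show "(P(i := R t)) j \<noteq> 0 \<and> dot ((P(i := R t)) j) (F t j) = 0 \<and>
          dot ((P(i := R t)) j) (F t (Suc j mod 4)) = 0 \<and> dot ((P(i := R t)) j) (G t j) = 0"
        proof cases
          case 1
          have "R t \<noteq> 0" using t(1) by auto
          moreover have "dot (R t) (x (Suc i mod 4)) = 0" using Pi \<beta> by (simp add: R_def)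
          ultimately show ?thesis using 1 c by (simp add: F_def G_def)
        next
          case 2
          then have "(i + 3) mod 4 = j" using cyclic_4(1)[OF j] by simp
          then show ?thesis using 2 Pj by (simp add: F_def G_def)
        next
          case 3
          then show ?thesis using Pj by (simp add: F_def G_def)
        qed
      qed
      show "cross (P ((i + 3) mod 4)) ((P(i := R t)) i) \<noteq> 0" using t by simp
      show "cross ((P(i := R t)) i) (P (Suc i mod 4)) \<noteq> 0"
        using t(2) \<beta>S succ by (simp add: R_def vector_mul_eq_0)
    qed simp
  qed
  show ?thesis
  proof (rule quad_limit[OF X _ _ _ _ lim])
    show "poly_vec (\<lambda>t. F t j)" for j unfolding F_def R_def fun_upd_def by (intro poly_intros)
    show "poly_vec (\<lambda>t. G t j)" for j unfolding G_def R_def fun_upd_def by (intro poly_intros)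
  qed (simp_all add: F_def G_def R_def s[symmetric] v[symmetric])
qed

text \<open>Induction on the number of coinciding consecutive sides: one rotation removes such a
  coincidence and creates none with the preceding side.\<close>

lemma quad_nonplanar:
  assumes X: "zariski_closed X" "side_families k \<subseteq> X"
    and "quad_supports P x y" "\<exists>i<4. cross (P i) (P (Suc i mod 4)) \<noteq> 0"
  shows "quad k x y \<in> X"
  using assms(3,4)
proof (induction "card {i. i < 4 \<and> cross (P i) (P (Suc i mod 4)) = 0}" arbitrary: P x y rule: less_induct)
  case less
  define c where "c P i \<longleftrightarrow> cross (P i) (P (Suc i mod 4)) = 0" for P :: "nat \<Rightarrow> complex ^ 3" and i
  show ?case
  proof (cases "\<exists>i<4. c P i")
    case False
    then have "quad k x y \<in> side_families k"
      by (intro quad_distinct_sides[OF less.prems(1)]) (simp add: c_def)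
    then show ?thesis using X(2) by blast
  next
    case True
    \<comment> \<open>Going backwards around the cycle, coincidences must stop, since some
      consecutive pair of sides differs.\<close>
    have "\<exists>i<4. c P i \<and> \<not> c P ((i + 3) mod 4)"
    proof (rule ccontr)
      assume "\<not> ?thesis"
      then have "\<forall>i<4. c P i \<longrightarrow> c P ((i + 3) mod 4)" by blast
      then have "c P 0 \<longrightarrow> c P 3" "c P 1 \<longrightarrow> c P 0" "c P 2 \<longrightarrow> c P 1" "c P 3 \<longrightarrow> c P 2"
        unfolding all_less_4 by simp_all
      moreover have "c P 0 \<or> c P 1 \<or> c P 2 \<or> c P 3"
        using True all_less_4[of "\<lambda>i. \<not> c P i"] by blast
      ultimately have "\<forall>i<4. c P i" unfolding all_less_4 by blast
      then show False using less.prems(2) unfolding c_def by blast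
    qed
    then obtain i where i: "i < 4" "c P i" "\<not> c P ((i + 3) mod 4)" by blast
    note cyc = cyclic_4[OF i(1)]
    show ?thesis
    proof (rule quad_rotate_side[OF X(1) less.prems(1) i(1)])
      show "cross (P ((i + 3) mod 4)) (P i) \<noteq> 0" "cross (P i) (P (Suc i mod 4)) = 0"
        using i cyc unfolding c_def by simp_all
      fix P' x y assume P': "quad_supports P' x y" "\<forall>j<4. j \<noteq> i \<longrightarrow> P' j = P j"
        "cross (P ((i + 3) mod 4)) (P' i) \<noteq> 0" "cross (P' i) (P (Suc i mod 4)) \<noteq> 0"
      have eq: "P' ((i + 3) mod 4) = P ((i + 3) mod 4)" "P' (Suc i mod 4) = P (Suc i mod 4)"
        using P'(2) cyc by simp_all
      have i': "\<not> c P' i" using P'(4) eq by (simp add: c_def)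
      have "c P j" if j: "j < 4" "c P' j" for j
      proof (cases "Suc j mod 4 = i")
        case True
        then have "j = (i + 3) mod 4" using cyclic_4(1)[OF j(1)] by simp
        then have "\<not> c P' j" using P'(3) eq cyc by (simp add: c_def)
        then show ?thesis using j by blast
      next
        case False
        then show ?thesis using j i' P'(2) unfolding c_def by (metis mod_less_divisor zero_less_numeral)
      qed
      then have "{j. j < 4 \<and> c P' j} \<subset> {j. j < 4 \<and> c P j}" using i i' by blast
      then have "card {j. j < 4 \<and> c P' j} < card {j. j < 4 \<and> c P j}" by (intro psubset_card_mono) auto
      moreover have "\<exists>j<4. cross (P' j) (P' (Suc j mod 4)) \<noteq> 0" using i(1) i' unfolding c_def by blast
      ultimately show "quad k x y \<in> X" using less.hyps P'(1) unfolding c_def by blast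
    qed
  qed
qed

text \<open>Corners alone do not determine a side whose ends coincide, and sides alone do not
  determine corners when the sides coincide. Hence the split: some consecutive sides differ, or all
  are one line and the family is planar.\<close>

lemma quad_in_closure:
  assumes X: "zariski_closed X" "corner_families k \<subseteq> X" "side_families k \<subseteq> X"
    and inc: "quad_incident x y"
  shows "quad k x y \<in> X"
proof -
  have "\<exists>m. m \<noteq> 0 \<and> dot m (x i) = 0 \<and> dot m (x (Suc i mod 4)) = 0 \<and> dot m (y i) = 0" if "i < 4" for i
  proof -
    have "triple (x i) (x (Suc i mod 4)) (y i) = 0" using inc that unfolding quad_incident_def by blast
    then show ?thesis by (rule obtain_common_orthogonal) blast
  qed
  then obtain P where P: "quad_supports P x y" unfolding quad_supports_def by metis
  show ?thesis
  proof (cases "\<exists>i<4. cross (P i) (P (Suc i mod 4)) \<noteq> 0")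
    case True
    then show ?thesis by (rule quad_nonplanar[OF X(1,3) P])
  next
    case False
    then have all: "cross (P i) (P j) = 0" if "i < 4" "Suc i mod 4 = j" for i j
      using that by blast
    have par: "cross (P 0) (P 1) = 0" "cross (P 1) (P 2) = 0" "cross (P 2) (P 3) = 0"
      by (rule all; simp)+
    have nz: "P 0 \<noteq> 0" "P 1 \<noteq> 0" "P 2 \<noteq> 0" "P 3 \<noteq> 0" using P unfolding quad_supports_def by simp_all
    have "cross (P 0) (P 2) = 0" by (rule parallel_trans[OF nz(2) par(1,2)])
    moreover then have "cross (P 0) (P 3) = 0" by (rule parallel_trans[OF nz(3) _ par(3)])
    ultimately have "\<forall>i<4. cross (P i) (P 0) = 0"
      unfolding all_less_4 using par(1) cross_eq_0_commute[of "P 0"] by simp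
    then have "\<forall>i<4. dot (P 0) (x i) = 0 \<and> dot (P 0) (y i) = 0"
      using P parallel_orthogonal unfolding quad_supports_def by blast
    then show ?thesis by (rule quad_planar[OF X(1,2) nz(1)])
  qed
qed

section \<open>The five components\<close>

definition hexagon_label :: "nat \<Rightarrow> 9" where
  "hexagon_label i = (if i = 0 then 1 else if i = 1 then 6 else if i = 2 then 2 else if i = 3 then 4
     else if i = 4 then 3 else 5)"

lemma assemble_diagonal_label: "k < 3 \<Longrightarrow> assemble p q $ diagonal_label k = p k"
  by (drule less_3_cases) (auto simp: diagonal_label_def)

lemma assemble_hexagon_label:
  assumes "i < 6"
  shows "assemble p q $ hexagon_label i = q i"
proof -
  have "\<forall>i<6. assemble p q $ hexagon_label i = q i"
    unfolding all_less_6 by (simp add: hexagon_label_def)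
  then show ?thesis using assms by blast
qed

lemma quad_corner_labels:
  assumes "k < 3"
  obtains l where "\<And>x y i. i < 4 \<Longrightarrow> quad k x y $ l i = x i" "\<And>i. i < 4 \<Longrightarrow> l i \<noteq> diagonal_label k"
    "\<And>i. i < 4 \<Longrightarrow> {l ((i + 3) mod 4), l i, l (Suc i mod 4)} \<notin> pascal_lines"
    "\<And>i j. i < 4 \<Longrightarrow> j < 4 \<Longrightarrow> i \<noteq> j \<Longrightarrow> l i \<noteq> l j"
proof -
  \<comment> \<open>The labels of \<open>p (k + 1)\<close>, \<open>q (k + 1)\<close>,
    \<open>p (k + 2)\<close>, \<open>q (k + 4)\<close>, in this cyclic order.\<close>
  define l :: "nat \<Rightarrow> 9" where "l i = (if k = 0 then [8, 6, 9, 3] else if k = 1 then [9, 2, 7, 5] else [7, 4, 8, 1]) ! i" for i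
  have l1: "\<forall>i<4. quad k x y $ l i = x i" for x y
    using less_3_cases[OF assms] unfolding all_less_4 by (elim disjE) (simp_all add: l_def quad_def)
  have l2: "\<forall>i<4. l i \<noteq> diagonal_label k"
    using less_3_cases[OF assms] unfolding all_less_4 by (elim disjE) (simp_all add: l_def diagonal_label_def)
  have l3: "\<forall>i<4. {l ((i + 3) mod 4), l i, l (Suc i mod 4)} \<notin> pascal_lines"
    using less_3_cases[OF assms] unfolding all_less_4
    by (elim disjE) (simp_all add: l_def pascal_lines_def set_eq_iff forall_9)
  have l4: "\<forall>i<4. \<forall>j<4. i \<noteq> j \<longrightarrow> l i \<noteq> l j"
    using less_3_cases[OF assms] unfolding all_less_4 by (elim disjE) (simp_all add: l_def)
  show ?thesis
    by (rule that[of l]) (use l1 l2 l3 l4 in blast)+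
qed

lemma loop_realization_corners:
  assumes M: "pascal_configuration M" and k: "k < 3"
    and R: "quad k x y \<in> realizations (make_loop M (diagonal_label k))" and i: "i < 4"
  shows "triple (x ((i + 3) mod 4)) (x i) (x (Suc i mod 4)) \<noteq> 0"
    and "cross (x i) (x (Suc i mod 4)) \<noteq> 0"
proof -
  obtain l where l: "\<And>x y i. i < 4 \<Longrightarrow> quad k x y $ l i = x i" "\<And>i. i < 4 \<Longrightarrow> l i \<noteq> diagonal_label k"
    "\<And>i. i < 4 \<Longrightarrow> {l ((i + 3) mod 4), l i, l (Suc i mod 4)} \<notin> pascal_lines"
    "\<And>i j. i < 4 \<Longrightarrow> j < 4 \<Longrightarrow> i \<noteq> j \<Longrightarrow> l i \<noteq> l j"
    by (rule quad_corner_labels[OF k]) (rule that)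
  note c = cyclic_4[OF i]
  let ?T = "{l ((i + 3) mod 4), l i, l (Suc i mod 4)}"
  have d: "l ((i + 3) mod 4) \<noteq> l i" "l ((i + 3) mod 4) \<noteq> l (Suc i mod 4)" "l i \<noteq> l (Suc i mod 4)"
    using l(4) c i by metis+
  then have "M ?T" using pascal_independent_iff[OF M] l(3)[OF i] by simp
  moreover have "diagonal_label k \<notin> ?T" using l(2) c i by (metis insertE singletonD)
  ultimately have "\<not> family_dependent (quad k x y) ?T"
    using R unfolding realizations_def make_loop_def by blast
  then show tr: "triple (x ((i + 3) mod 4)) (x i) (x (Suc i mod 4)) \<noteq> 0"
    using d c i by (simp add: family_dependent_triple l(1))
  show "cross (x i) (x (Suc i mod 4)) \<noteq> 0"
  proof
    assume "cross (x i) (x (Suc i mod 4)) = 0"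
    then have "triple (x i) (x (Suc i mod 4)) (x ((i + 3) mod 4)) = 0" by (simp add: triple_def)
    then show False using tr triple_perm(4) by metis
  qed
qed

lemma loop_realization_quad:
  assumes M: "pascal_configuration M" and k: "k < 3"
    and R: "\<gamma> \<in> realizations (make_loop M (diagonal_label k))"
  obtains x y where "\<gamma> = quad k x y" "quad_incident x y"
proof -
  have \<gamma>: "\<gamma> \<in> circuit_variety M" "\<gamma> $ diagonal_label k = 0"
    using R realizations_subset_circuit_variety circuit_variety_make_loop by blast+
  obtain x y where xy: "\<gamma> = quad k x y" using quad_surj[OF k \<gamma>(2)] .
  then show ?thesis using \<gamma>(1) quad_in_circuit_variety_iff[OF M k] that by blast
qed

lemma loop_realizations_subset_corner_families:
  assumes M: "pascal_configuration M" and k: "k < 3"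
  shows "realizations (make_loop M (diagonal_label k)) \<subseteq> corner_families k"
proof
  fix \<gamma> assume R: "\<gamma> \<in> realizations (make_loop M (diagonal_label k))"
  obtain x y where xy: "\<gamma> = quad k x y" "quad_incident x y"
    by (rule loop_realization_quad[OF M k R]) (rule that)
  have "\<exists>a b. y i = a *s x i + b *s x (Suc i mod 4)" if i: "i < 4" for i
    using in_span_of_orthogonal[OF loop_realization_corners(2)[OF M k R[unfolded xy(1)] i]] xy(2) i
    unfolding quad_incident_def triple_def by metis
  then obtain a b where "\<forall>i<4. y i = a i *s x i + b i *s x (Suc i mod 4)" by metis
  then show "\<gamma> \<in> corner_families k" unfolding xy(1) by (rule corner_familiesI)
qed

lemma loop_realizations_subset_side_families:
  assumes M: "pascal_configuration M" and k: "k < 3"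
  shows "realizations (make_loop M (diagonal_label k)) \<subseteq> side_families k"
proof
  fix \<gamma> assume R: "\<gamma> \<in> realizations (make_loop M (diagonal_label k))"
  obtain x y where xy: "\<gamma> = quad k x y" "quad_incident x y"
    by (rule loop_realization_quad[OF M k R]) (rule that)
  note corners = loop_realization_corners[OF M k R[unfolded xy(1)]]
  define P where "P i = cross (x i) (x (Suc i mod 4))" for i
  have "quad_supports P x y"
    unfolding quad_supports_def P_def using corners(2) xy(2)
    by (simp add: quad_incident_def triple_def)
  moreover have "cross (P i) (P (Suc i mod 4)) \<noteq> 0" if i: "i < 4" for i
  proof -
    have t: "triple (x i) (x (Suc i mod 4)) (x (Suc (Suc i mod 4) mod 4)) \<noteq> 0"
      using corners(1)[of "Suc i mod 4"] cyclic_4[OF i] by simp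
    have nz: "x (Suc i mod 4) \<noteq> 0" using t by auto
    \<comment> \<open>Two consecutive sides meet in their common corner, with the determinant of
      three consecutive corners as factor; noncollinear corners thus give distinct sides.\<close>
    have "cross (P i) (P (Suc i mod 4)) =
      triple (x i) (x (Suc i mod 4)) (x (Suc (Suc i mod 4) mod 4)) *s x (Suc i mod 4)"
      unfolding P_def cross_cross_right by (simp add: triple_def)
    then show ?thesis using t nz by (simp add: vector_mul_eq_0)
  qed
  ultimately show "\<gamma> \<in> side_families k" unfolding xy(1) using quad_distinct_sides by blast
qed

lemma loop_realizations_nonempty:
  assumes "pascal_configuration M"
  shows "realizations (make_loop M l) \<noteq> {}"
  using pascal_realization_exists[OF assms] realizations_make_loop by blast

lemma loop_variety_subsets:
  assumes M: "pascal_configuration M" and k: "k < 3"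
  shows "corner_families k \<subseteq> matroid_variety (make_loop M (diagonal_label k))"
    and "side_families k \<subseteq> matroid_variety (make_loop M (diagonal_label k))"
proof -
  obtain \<gamma> where \<gamma>: "\<gamma> \<in> realizations (make_loop M (diagonal_label k))"
    using loop_realizations_nonempty[OF M] by blast
  show "corner_families k \<subseteq> matroid_variety (make_loop M (diagonal_label k))"
    by (rule curve_connected_subset_matroid_variety[OF curve_connected_corner_families
        corner_families_circuit[OF M k] _ \<gamma>])
      (use \<gamma> loop_realizations_subset_corner_families[OF M k] in blast)
  show "side_families k \<subseteq> matroid_variety (make_loop M (diagonal_label k))"
    by (rule curve_connected_subset_matroid_variety[OF curve_connected_side_families
        side_families_circuit[OF M k] _ \<gamma>])
      (use \<gamma> loop_realizations_subset_side_families[OF M k] in blast)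
qed

lemma loop_variety_irreducible:
  assumes M: "pascal_configuration M" and k: "k < 3"
  shows "zariski_irreducible (matroid_variety (make_loop M (diagonal_label k)))"
  by (rule curve_connected_irreducible[OF curve_connected_corner_families
      loop_variety_subsets(1)[OF M k] loop_realizations_subset_corner_families[OF M k]
      loop_realizations_nonempty[OF M]])

text \<open>Since every quadrilateral is a limit of realizations, the loop variety has explicit
  equations. Membership and nonmembership can then be read off from the coordinates.\<close>

lemma loop_variety_eq:
  assumes M: "pascal_configuration M" and k: "k < 3"
  shows "matroid_variety (make_loop M (diagonal_label k)) =
    {\<gamma> \<in> circuit_variety M. \<gamma> $ diagonal_label k = 0}"
proof
  have "zariski_closed {\<gamma> :: complex ^ 3 ^ 9. \<forall>j\<in>UNIV. \<gamma> $ diagonal_label k $ j = 0}"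
    using zariski_closed_common_zeros[of UNIV "\<lambda>j \<gamma>. \<gamma> $ diagonal_label k $ j"] by (simp add: polyfuns.coord)
  then have "zariski_closed (circuit_variety M \<inter> {\<gamma>. \<forall>j\<in>UNIV. \<gamma> $ diagonal_label k $ j = 0})"
    by (rule zariski_closed_Int[OF zariski_closed_circuit_variety_pascal[OF M]])
  moreover have "circuit_variety M \<inter> {\<gamma>. \<forall>j\<in>UNIV. \<gamma> $ diagonal_label k $ j = 0} =
      {\<gamma> \<in> circuit_variety M. \<gamma> $ diagonal_label k = 0}"
    by (auto simp: vec_eq_iff)
  moreover have "realizations (make_loop M (diagonal_label k)) \<subseteq>
      {\<gamma> \<in> circuit_variety M. \<gamma> $ diagonal_label k = 0}"
    using realizations_subset_circuit_variety circuit_variety_make_loop by blast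
  ultimately show "matroid_variety (make_loop M (diagonal_label k)) \<subseteq>
      {\<gamma> \<in> circuit_variety M. \<gamma> $ diagonal_label k = 0}"
    by (intro matroid_variety_minimal) simp_all
  show "{\<gamma> \<in> circuit_variety M. \<gamma> $ diagonal_label k = 0} \<subseteq>
      matroid_variety (make_loop M (diagonal_label k))"
  proof
    fix \<gamma> assume \<gamma>: "\<gamma> \<in> {\<gamma> \<in> circuit_variety M. \<gamma> $ diagonal_label k = 0}"
    then obtain x y where xy: "\<gamma> = quad k x y" using quad_surj[OF k] by blast
    then have "quad_incident x y" using \<gamma> quad_in_circuit_variety_iff[OF M k] by blast
    then show "\<gamma> \<in> matroid_variety (make_loop M (diagonal_label k))"
      unfolding xy
      by (intro quad_in_closure zariski_closed_matroid_variety loop_variety_subsets M k)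
  qed
qed

lemma uniform_2_variety_9: "matroid_variety (uniform_matroid 2) = (plane_families :: (complex ^ 3 ^ 9) set)"
  by (rule uniform_2_variety) simp

lemma circuit_variety_decomposition:
  assumes M: "pascal_configuration M"
  shows "circuit_variety M = matroid_variety M \<union> plane_families \<union>
    (\<Union>k<3. matroid_variety (make_loop M (diagonal_label k)))"
proof (intro equalityI subsetI)
  fix \<gamma> assume \<gamma>: "\<gamma> \<in> circuit_variety M"
  obtain p q where pq: "\<gamma> = assemble p q" by (rule assemble_surj)
  then have inc: "incident p q" using \<gamma> assemble_in_circuit_variety_iff[OF M] by blast
  show "\<gamma> \<in> matroid_variety M \<union> plane_families \<union> (\<Union>k<3. matroid_variety (make_loop M (diagonal_label k)))"
  proof (cases "\<exists>k<3. p k = 0")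
    case True
    then obtain k where k: "k < 3" "p k = 0" by blast
    then have "\<gamma> \<in> matroid_variety (make_loop M (diagonal_label k))"
      using \<gamma> by (simp add: loop_variety_eq[OF M] pq assemble_diagonal_label)
    then show ?thesis using k(1) by blast
  next
    case False
    then show ?thesis
      using hexagon_in_closure[OF zariski_closed_matroid_variety pascal_families_subset_variety[OF M] inc]
      unfolding pq by blast
  qed
next
  fix \<gamma> assume "\<gamma> \<in> matroid_variety M \<union> plane_families \<union>
    (\<Union>k<3. matroid_variety (make_loop M (diagonal_label k)))"
  moreover have "matroid_variety M \<subseteq> circuit_variety M"
    by (rule matroid_variety_minimal[OF realizations_subset_circuit_variety
        zariski_closed_circuit_variety_pascal[OF M]])
  moreover have "plane_families \<subseteq> circuit_variety M"
  proof
    fix \<gamma> :: "complex ^ 3 ^ 9" assume \<gamma>: "\<gamma> \<in> plane_families"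
    have "card S \<ge> 3" if "\<not> M S" for S
    proof (cases "S \<in> pascal_lines")
      case True
      then show ?thesis unfolding pascal_lines_def by auto
    next
      case False
      then show ?thesis using that pascal_independent_iff[OF M, of S] by simp
    qed
    then show "\<gamma> \<in> circuit_variety M"
      using plane_families_dependent[OF \<gamma>] unfolding circuit_variety_def by blast
  qed
  ultimately show "\<gamma> \<in> circuit_variety M" using loop_variety_eq[OF M] by blast
qed


section \<open>Irredundancy\<close>

lemma singleton_not_pascal_line: "{l} \<notin> pascal_lines"
proof
  assume "{l} \<in> pascal_lines"
  then have "card {l} = 3" unfolding pascal_lines_def by auto
  then show False by simp
qed

text \<open>The rotation speeds in \<open>hexagon_rotate\<close> have product of ratios \<open>1\<close> around the hexagon.  This is
  an equation satisfied by all Pascal configurations, but not by all families of rank two.\<close>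

lemma pascal_families_cycle_identity:
  assumes "assemble p q \<in> pascal_families"
  shows "(\<Prod>i<6. triple (p (i mod 3)) (q i) n) = (\<Prod>i<6. triple (q i) (p (Suc i mod 3)) n)"
proof -
  obtain u w a b v s where g: "assemble p q = assemble (\<lambda>k. a k *s u + b k *s w)
       (\<lambda>i. s i *s cross (cross (a (i mod 3) *s u + b (i mod 3) *s w) (v i))
         (cross (a (Suc i mod 3) *s u + b (Suc i mod 3) *s w) (v (Suc i mod 6))))"
    using assms by (rule pascal_familiesE)
  define A where "A i = cross (p (i mod 3)) (v i)" for i
  have p: "p k = a k *s u + b k *s w" if "k < 3" for k
    using arg_cong[OF g, of "\<lambda>\<gamma>. \<gamma> $ diagonal_label k"] that by (simp add: assemble_diagonal_label)
  have q: "q i = s i *s cross (A i) (A (Suc i mod 6))" if "i < 6" for i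
    using arg_cong[OF g, of "\<lambda>\<gamma>. \<gamma> $ hexagon_label i"] that
    by (simp add: assemble_hexagon_label A_def p Suc_mod_6_mod_3 del: cross_linear)
  \<comment> \<open>\<open>cross (p i) (p (i + 1))\<close> equals \<open>D i *s cross u w\<close>,
    so the pairing of one diagonal point with an adjacent side factors into \<open>D\<close> and
    \<open>T\<close>.\<close>
  define D where "D i = a (i mod 3) * b (Suc i mod 3) - b (i mod 3) * a (Suc i mod 3)" for i
  define T where "T i = triple u w (v i)" for i
  have left: "triple (p (i mod 3)) (q i) n = s i * D i * T (Suc i mod 6) * dot (A i) n" if i: "i < 6" for i
  proof -
    have "triple (p (i mod 3)) (q i) n = s i * dot (p (i mod 3)) (A (Suc i mod 6)) * dot (A i) n"
      using i by (simp add: q triple_def cross_cross_right) (simp add: A_def)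
    moreover have "dot (p (i mod 3)) (A (Suc i mod 6)) = D i * T (Suc i mod 6)"
      unfolding A_def Suc_mod_6_mod_3 T_def triple_def D_def
      by (simp add: p) (simp add: dot_def algebra_simps)
    ultimately show ?thesis by simp
  qed
  have right: "triple (q i) (p (Suc i mod 3)) n = - (s i * D i * T i * dot (A (Suc i mod 6)) n)" if i: "i < 6" for i
  proof -
    have "triple (q i) (p (Suc i mod 3)) n = s i * dot (A i) (p (Suc i mod 3)) * dot (A (Suc i mod 6)) n"
      using i by (simp add: q triple_def cross_cross_left) (simp add: A_def Suc_mod_6_mod_3)
    moreover have "dot (A i) (p (Suc i mod 3)) = - (D i * T i)"
      unfolding A_def T_def triple_def D_def
      by (simp add: p) (simp add: dot_def algebra_simps)
    ultimately show ?thesis by simp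
  qed
  have shift: "(\<Prod>i<6. h (Suc i mod 6)) = (\<Prod>i<6. h i)" for h :: "nat \<Rightarrow> complex"
  proof -
    have "{..<6} = {0, 1, 2, 3, 4, 5::nat}" by auto
    then show ?thesis by (simp add: mult_ac numeral_2_eq_2) (simp add: numeral_eq_Suc)
  qed
  have "(\<Prod>i<6. triple (p (i mod 3)) (q i) n) =
      (\<Prod>i<6. s i) * (\<Prod>i<6. D i) * (\<Prod>i<6. T (Suc i mod 6)) * (\<Prod>i<6. dot (A i) n)"
    by (simp add: left prod.distrib)
  also have "\<dots> = (\<Prod>i<6. s i) * (\<Prod>i<6. D i) * (\<Prod>i<6. T i) * (\<Prod>i<6. dot (A (Suc i mod 6)) n)"
    using shift[of T] shift[of "\<lambda>i. dot (A i) n"] by simp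
  also have "\<dots> = (\<Prod>i<6. s i * D i * T i * dot (A (Suc i mod 6)) n)"
    by (simp add: prod.distrib)
  \<comment> \<open>Six is even, so the signs cancel in the product.\<close>
  also have "\<dots> = (\<Prod>i<6. - (s i * D i * T i * dot (A (Suc i mod 6)) n))"
    by (simp add: prod_uminus)
  also have "\<dots> = (\<Prod>i<6. triple (q i) (p (Suc i mod 3)) n)"
    by (simp add: right)
  finally show ?thesis .
qed

lemma plane_family_outside_pascal_variety:
  assumes M: "pascal_configuration M"
  shows "\<exists>\<gamma>\<in>plane_families. \<gamma> \<notin> matroid_variety M \<and> (\<forall>k<3. \<gamma> $ diagonal_label k \<noteq> 0)"
proof -
  \<comment> \<open>A vector off the plane of the witness below. For
    \<open>q i = x *s p i + y *s p (i + 1)\<close> in that plane, the two factors at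
    \<open>i\<close> are \<open>y\<close> and \<open>x\<close> times the same nonzero
    determinant.\<close>
  let ?n = "vector [0, 0, 1] :: complex ^ 3"
  let ?f = "\<lambda>\<gamma> :: complex ^ 3 ^ 9.
    (\<Prod>i<6. triple (\<gamma> $ diagonal_label (i mod 3)) (\<gamma> $ hexagon_label i) ?n) -
    (\<Prod>i<6. triple (\<gamma> $ hexagon_label i) (\<gamma> $ diagonal_label (Suc i mod 3)) ?n)"
  have "?f \<in> polyfuns"
    by (intro polyfuns_diff polyfuns_prod polyfuns_triple polyfuns.coord polyfuns.const) auto
  then have closed: "zariski_closed {\<gamma>. ?f \<gamma> = 0}" by (rule zariski_closed_zero)
  have "realizations M \<subseteq> {\<gamma>. ?f \<gamma> = 0}"
  proof
    fix \<gamma> assume "\<gamma> \<in> realizations M"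
    then have \<gamma>: "\<gamma> \<in> pascal_families" using realizations_subset_pascal_families[OF M] by blast
    obtain p q where pq: "\<gamma> = assemble p q" by (rule assemble_surj)
    show "\<gamma> \<in> {\<gamma>. ?f \<gamma> = 0}"
      using pascal_families_cycle_identity[of p q ?n] \<gamma>
      by (simp add: pq assemble_diagonal_label assemble_hexagon_label)
  qed
  then have sub: "matroid_variety M \<subseteq> {\<gamma>. ?f \<gamma> = 0}" using closed by (rule matroid_variety_minimal)
  define p :: "nat \<Rightarrow> complex ^ 3" where
    "p k = (if k = 0 then vector [1, 0, 0] else if k = 1 then vector [0, 1, 0] else vector [1, 1, 0])" for k
  \<comment> \<open>All coefficients are one except a single 2, so the products of the two kinds of
    coefficients are 2 and 1, and the cycle identity fails.\<close>
  define q where "q i = p (i mod 3) + (if i = 0 then 2 else 1) *s p (Suc i mod 3)" for i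
  have "assemble p q \<in> plane_families"
    by (rule plane_families_assembleI[of ?n]) (auto simp: p_def q_def dot_def vec3_eq_iff)
  moreover have "?f (assemble p q) \<noteq> 0"
  proof -
    have "{..<6} = {0, 1, 2, 3, 4, 5::nat}" by auto
    then have "(\<Prod>i<6. triple (p (i mod 3)) (q i) ?n) \<noteq> (\<Prod>i<6. triple (q i) (p (Suc i mod 3)) ?n)"
      by (simp add: p_def q_def triple_def dot_def)
    then show ?thesis by (simp add: assemble_diagonal_label assemble_hexagon_label)
  qed
  moreover have "\<forall>k<3. assemble p q $ diagonal_label k \<noteq> 0"
    by (simp add: assemble_diagonal_label p_def vec3_eq_iff)
  ultimately show ?thesis using sub by blast
qed

text \<open>The lines \<open>k\<close> and \<open>k + 3\<close> of a Pascal configuration meet in the diagonal point \<open>k\<close>, hence on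
  the line of the other two diagonal points.  A quadrilateral need not have this property.\<close>

lemma quad_outside_pascal_variety:
  assumes M: "pascal_configuration M" and k: "k < 3"
  shows "\<exists>\<gamma>\<in>matroid_variety (make_loop M (diagonal_label k)). \<gamma> \<notin> matroid_variety M \<and>
    \<gamma> \<notin> plane_families \<and> (\<forall>j<3. j \<noteq> k \<longrightarrow> \<gamma> $ diagonal_label j \<noteq> 0)"
proof -
  \<comment> \<open>The inner cross products are sides \<open>k\<close> and \<open>k + 3\<close>;
    vanishing says that their meet is collinear with the other two diagonal points.\<close>
  let ?f = "\<lambda>\<gamma> :: complex ^ 3 ^ 9. triple
    (cross (cross (\<gamma> $ hexagon_label k) (\<gamma> $ hexagon_label ((k + 5) mod 6)))
      (cross (\<gamma> $ hexagon_label (k + 3)) (\<gamma> $ hexagon_label (k + 2))))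
    (\<gamma> $ diagonal_label (Suc k mod 3)) (\<gamma> $ diagonal_label (Suc (Suc k) mod 3))"
  have "?f \<in> polyfuns"
    by (intro polyfuns_triple polyfuns_cross polyfuns.coord)
  then have closed: "zariski_closed {\<gamma>. ?f \<gamma> = 0}" by (rule zariski_closed_zero)
  have "realizations M \<subseteq> {\<gamma>. ?f \<gamma> = 0}"
  proof
    fix \<gamma> assume R: "\<gamma> \<in> realizations M"
    obtain p q where pq: "\<gamma> = assemble p q" by (rule assemble_surj)
    have inc: "incident p q"
      using R realizations_subset_circuit_variety assemble_in_circuit_variety_iff[OF M] pq by blast
    have "M {diagonal_label k}" using pascal_independent_iff[OF M] singleton_not_pascal_line by simp
    then have "\<not> family_dependent \<gamma> {diagonal_label k}" using R unfolding realizations_def by blast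
    then have nz: "p k \<noteq> 0" using k by (simp add: pq assemble_diagonal_label)
    let ?C = "cross (q k) (q ((k + 5) mod 6))" and ?D = "cross (q (k + 3)) (q (k + 2))"
    have mods: "(k + 3 + 5) mod 6 = k + 2" "(k + 3) mod 3 = k" "k mod 3 = k" using k by presburger+
    have inc6: "triple (p (i mod 3)) (q i) (q ((i + 5) mod 6)) = 0" if "i < 6" for i
      using inc that unfolding incident_def by blast
    have "k < 6" "k + 3 < 6" using k by simp_all
    then have "triple (p k) (q k) (q ((k + 5) mod 6)) = 0" "triple (p k) (q (k + 3)) (q (k + 2)) = 0"
      using inc6[of k] inc6[of "k + 3"] unfolding mods by blast+
    then have "dot ?C (p k) = 0" "dot ?D (p k) = 0"
      using triple_perm(4)[of "q k" "q ((k + 5) mod 6)" "p k"] triple_perm(4)[of "q (k + 3)" "q (k + 2)" "p k"]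
      unfolding triple_def by argo+
    then have "cross (cross ?C ?D) (p k) = 0" unfolding cross_cross_left[of ?C ?D "p k"] by simp
    then obtain c where c: "cross ?C ?D = c *s p k"
      using parallel_imp_multiple[OF nz] cross_eq_0_commute by metis
    obtain m where m: "m \<noteq> 0" "dot m (p 0) = 0" "dot m (p 1) = 0" "dot m (p 2) = 0"
      using inc obtain_common_orthogonal unfolding incident_def by metis
    then have mp: "\<forall>k<3. dot m (p k) = 0" unfolding all_less_3 by blast
    have "triple (cross ?C ?D) (p (Suc k mod 3)) (p (Suc (Suc k) mod 3)) = 0"
      unfolding c using mp k by (intro triple_eq_0_orthogonal[OF m(1)]) simp_all
    then show "\<gamma> \<in> {\<gamma>. ?f \<gamma> = 0}"
      using k by (simp add: pq assemble_diagonal_label assemble_hexagon_label)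
  qed
  then have sub: "matroid_variety M \<subseteq> {\<gamma>. ?f \<gamma> = 0}" using closed by (rule matroid_variety_minimal)
  \<comment> \<open>With the last corner zero, two sides impose no condition and \<open>y 2\<close>,
    \<open>y 3\<close> are free. The lines \<open>y 0 y 2\<close> and \<open>y 1 y 3\<close> meet in
    (1,1,1), off the line of \<open>x 0\<close> and \<open>x 2\<close>.\<close>
  define x :: "nat \<Rightarrow> complex ^ 3" where
    "x i = (if i = 0 then vector [1, 0, 0] else if i = 1 then vector [0, 1, 0]
      else if i = 2 then vector [0, 0, 1] else 0)" for i
  define y :: "nat \<Rightarrow> complex ^ 3" where
    "y i = (if i = 0 then vector [1, 1, 0] else if i = 1 then vector [0, 1, 1]
      else if i = 2 then vector [0, 0, 1] else vector [1, 0, 0])" for i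
  have "quad_incident x y"
    unfolding quad_incident_iff by (simp add: x_def y_def triple_def dot_def)
  then have "quad k x y \<in> matroid_variety (make_loop M (diagonal_label k))"
    unfolding loop_variety_eq[OF M k] using quad_in_circuit_variety_iff[OF M k] k by simp
  moreover have "?f (quad k x y) \<noteq> 0"
    using less_3_cases[OF k]
    by (elim disjE) (simp_all add: quad_def assemble_diagonal_label assemble_hexagon_label x_def y_def
      triple_def dot_def)
  moreover have "quad k x y \<notin> plane_families"
  proof
    assume pl: "quad k x y \<in> plane_families"
    obtain l where l: "\<And>x y i. i < 4 \<Longrightarrow> quad k x y $ l i = x i"
      by (rule quad_corner_labels[OF k]) (rule that)
    have "triple (x 0) (x 1) (x 2) = 0"
      using plane_families_triple[OF pl, of "l 0" "l 1" "l 2"] by (simp add: l)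
    then show False by (simp add: x_def triple_def dot_def)
  qed
  moreover have "\<forall>j<3. j \<noteq> k \<longrightarrow> quad k x y $ diagonal_label j \<noteq> 0"
    by (simp add: quad_def assemble_diagonal_label x_def vec3_eq_iff)
  ultimately show ?thesis using sub by blast
qed

text \<open>Irredundancy is shown by exhibiting in each component a point outside the other four: a
  realization of \<open>M\<close>, a planar family violating the cycle identity, and a quadrilateral
  for each loop.\<close>

theorem theorem4p13:
  fixes M :: "9 set \<Rightarrow> bool"
  assumes "pascal_configuration M"
  shows "irredundant_irreducible_decomposition (circuit_variety M)
    [matroid_variety M, matroid_variety (uniform_matroid 2),
     matroid_variety (make_loop M 7), matroid_variety (make_loop M 8),
     matroid_variety (make_loop M 9)]"
proof -
  note M = assms
  define W where "W k = matroid_variety (make_loop M (diagonal_label k))" for k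
  \<comment> \<open>Loop components have indices 2, 3, 4; the shift by 2 aligns them with the
    diagonal points 0, 1, 2.\<close>
  define V where "V i = (if i = 0 then matroid_variety M else if i = 1 then plane_families else W (i - 2))" for i :: nat
  have W: "\<gamma> \<in> W k \<Longrightarrow> \<gamma> $ diagonal_label k = 0" if "k < 3" for \<gamma> k
    using loop_variety_eq[OF M that] unfolding W_def by blast
  have list: "[matroid_variety M, matroid_variety (uniform_matroid 2),
     matroid_variety (make_loop M 7), matroid_variety (make_loop M 8),
     matroid_variety (make_loop M 9)] = map V [0, 1, 2, 3, 4]"
    by (simp add: V_def W_def uniform_2_variety_9 diagonal_label_def)
  have all5: "(\<forall>i<5. Q i) \<longleftrightarrow> Q 0 \<and> Q 1 \<and> (\<forall>k<3. Q (k + 2))" for Q :: "nat \<Rightarrow> bool"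
  proof
    assume Q: "Q 0 \<and> Q 1 \<and> (\<forall>k<3. Q (k + 2))"
    show "\<forall>i<5. Q i"
    proof (intro allI impI)
      fix i :: nat assume "i < 5"
      then have "i = 0 \<or> i = 1 \<or> i - 2 < 3 \<and> i = i - 2 + 2" by auto
      then show "Q i" using Q by metis
    qed
  qed auto
  have nth: "map V [0, 1, 2, 3, 4] ! i = V i" if "i < 5" for i
  proof -
    have "[0, 1, 2, 3, 4] ! i = i" using that by (simp add: nth_Cons split: nat.splits)
    moreover have "i < length [0, 1, 2, 3, 4 :: nat]" using that by simp
    ultimately show ?thesis by (simp only: nth_map)
  qed
  have V01: "V 0 = matroid_variety M" "V 1 = plane_families" by (simp_all add: V_def)
  have V2: "V (k + 2) = W k" for k by (simp add: V_def)
  have "\<forall>i<5. zariski_closed (V i) \<and> zariski_irreducible (V i)"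
    unfolding all5 V2
    using pascal_variety_irreducible[OF M] zariski_closed_plane_families
      uniform_2_variety(2)[where 'd = 9] loop_variety_irreducible[OF M]
    by (simp add: V_def W_def uniform_2_variety_9 zariski_closed_matroid_variety)
  moreover have "circuit_variety M = (\<Union>i<5. V i)"
  proof -
    have "x \<in> (\<Union>i<5. V i) \<longleftrightarrow> x \<in> matroid_variety M \<union> plane_families \<union> (\<Union>k<3. W k)" for x
      using all5[of "\<lambda>i. x \<notin> V i"] unfolding V2 V01 by blast
    then have "(\<Union>i<5. V i) = matroid_variety M \<union> plane_families \<union> (\<Union>k<3. W k)" by (rule set_eqI)
    then show ?thesis unfolding circuit_variety_decomposition[OF M] W_def by (rule sym)
  qed
  moreover have witness: "\<forall>i<5. \<exists>\<gamma>\<in>V i. \<forall>j<5. j \<noteq> i \<longrightarrow> \<gamma> \<notin> V j"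
  proof -
    obtain \<gamma>\<^sub>0 where R: "\<gamma>\<^sub>0 \<in> realizations M" using pascal_realization_exists[OF M] by blast
    have ind: "\<not> family_dependent \<gamma>\<^sub>0 S" if "card S \<le> 3" "S \<notin> pascal_lines" for S
      using R that pascal_independent_iff[OF M] unfolding realizations_def by blast
    have "\<not> family_dependent \<gamma>\<^sub>0 {1, 2, 3}"
      by (rule ind) (simp_all add: pascal_lines_def set_eq_iff forall_9)
    then have nP: "\<gamma>\<^sub>0 \<notin> plane_families" using plane_families_dependent[of \<gamma>\<^sub>0 "{1, 2, 3}"] by auto
    have nW: "\<gamma>\<^sub>0 \<notin> W k" if "k < 3" for k
      using ind[of "{diagonal_label k}"] singleton_not_pascal_line W[OF that] by auto
    have 0: "\<exists>\<gamma>\<in>V 0. \<forall>j<5. j \<noteq> 0 \<longrightarrow> \<gamma> \<notin> V j"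
    proof (rule bexI)
      show "\<forall>j<5. j \<noteq> 0 \<longrightarrow> \<gamma>\<^sub>0 \<notin> V j" unfolding all5 V2 V01 using nP nW by blast
      show "\<gamma>\<^sub>0 \<in> V 0" unfolding V01 using R realizations_subset by (rule rev_subsetD)
    qed
    obtain \<gamma>\<^sub>1 where \<gamma>\<^sub>1: "\<gamma>\<^sub>1 \<in> plane_families" "\<gamma>\<^sub>1 \<notin> matroid_variety M"
      "\<forall>k<3. \<gamma>\<^sub>1 $ diagonal_label k \<noteq> 0"
      using plane_family_outside_pascal_variety[OF M] by blast
    have 1: "\<exists>\<gamma>\<in>V 1. \<forall>j<5. j \<noteq> 1 \<longrightarrow> \<gamma> \<notin> V j"
    proof (rule bexI)
      have "\<gamma>\<^sub>1 \<notin> W k" if "k < 3" for k using \<gamma>\<^sub>1(3) W[OF that] that by blast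
      then show "\<forall>j<5. j \<noteq> 1 \<longrightarrow> \<gamma>\<^sub>1 \<notin> V j" unfolding all5 V2 V01 using \<gamma>\<^sub>1(2) by blast
      show "\<gamma>\<^sub>1 \<in> V 1" unfolding V01 by (rule \<gamma>\<^sub>1(1))
    qed
    have "\<exists>\<gamma>\<in>V (k + 2). \<forall>j<5. j \<noteq> k + 2 \<longrightarrow> \<gamma> \<notin> V j" if k: "k < 3" for k
    proof -
      obtain \<gamma> where \<gamma>: "\<gamma> \<in> W k" "\<gamma> \<notin> matroid_variety M" "\<gamma> \<notin> plane_families"
        "\<forall>j<3. j \<noteq> k \<longrightarrow> \<gamma> $ diagonal_label j \<noteq> 0"
        using quad_outside_pascal_variety[OF M k] unfolding W_def by blast
      have "\<gamma> \<notin> W j" if "j < 3" "j \<noteq> k" for j using \<gamma>(4) W[OF that(1)] that by blast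
      then have "\<forall>j<5. j \<noteq> k + 2 \<longrightarrow> \<gamma> \<notin> V j" unfolding all5 V2 V01 using \<gamma>(2,3) by simp
      then show ?thesis unfolding V2 using \<gamma>(1) by blast
    qed
    with 0 1 show ?thesis unfolding all5[of "\<lambda>i. \<exists>\<gamma>\<in>V i. \<forall>j<5. j \<noteq> i \<longrightarrow> \<gamma> \<notin> V j"] by blast
  qed
  moreover have "set (map V [0, 1, 2, 3, 4]) = V ` {..<5}"
  proof -
    have "{..<5} = {0, 1, 2, 3, 4::nat}" by auto
    then show ?thesis by simp
  qed
  moreover have "\<not> map V [0, 1, 2, 3, 4] ! i \<subseteq> (\<Union>j \<in> {..<5} - {i}. map V [0, 1, 2, 3, 4] ! j)"
    if i: "i < 5" for i
  proof
    assume sub: "map V [0, 1, 2, 3, 4] ! i \<subseteq> (\<Union>j \<in> {..<5} - {i}. map V [0, 1, 2, 3, 4] ! j)"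
    obtain \<gamma> where \<gamma>: "\<gamma> \<in> V i" "\<forall>j<5. j \<noteq> i \<longrightarrow> \<gamma> \<notin> V j" using witness i by blast
    then obtain j where "j < 5" "j \<noteq> i" "\<gamma> \<in> map V [0, 1, 2, 3, 4] ! j"
      using sub unfolding nth[OF i] by blast
    then show False using \<gamma>(2) nth by metis
  qed
  moreover have "length (map V [0, 1, 2, 3, 4]) = 5" by simp
  ultimately show ?thesis
    unfolding list irredundant_irreducible_decomposition_def by (simp only: ball_simps) blast
qed

end
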